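(* Let $G=GL_n$, let $(G,K)$ be one of the symmetric pairs $(GL_{p+q},GL_p\times GL_q)$, $(GL_{2m},Sp_{2m})$, $(GL_n,O_n)$, let $Y_0$ be a closed $K$-orbit on $G/B$, and let $Q=(j_1,\ldots,j_N)$ be a word. The configuration space $\mathcal{C}(Q,Y_0)$ is the image of $\mathcal{BEM}^{Y_0,Q}$ under the map $\delta$. Therefore, $\mathcal{C}(Q,Y_0)$ is isomorphic as a $K$-variety to $\mathcal{BE}^{Y_0,Q}$.
   Context: Setting: $G=GL_n(\mathbb C)$ with involution $\theta$, $K=G^\theta$, and $B$ a $\theta$-stable Borel subgroup containing a $\theta$-stable maximal torus. $K$ acts on $G/B$ by left multiplication. With $B$ the stabilizer of the standard coordinate flag, $G/B$ is identified with the variety of complete flags $F_1\subset\cdots\subset F_{n-1}$ in $\mathbb C^n$ ($\dim F_i=i$, $F_0=0$, $F_n=\mathbb C^n$). $s_i$ is the simple transposition $(i\ i+1)$, $P_i=B\cup Bs_iB$ the minimal parabolic subgroup, $P_{\widehat i}$ the maximal standard parabolic subgroup for all simple roots except the $i$-th; $G/P_{\widehat i}=Gr(i,n)$. A word is a tuple of elements of $\{1,\ldots,n-1\}$. $\mathcal{BEM}^{Y_0,Q}$ is the set of $(x_{N+1},x_N,\ldots,x_1)\in Y_0\times (G/B)^N$ such that $x_{i+1}$ and $x_i$ have the same image in $G/P_{j_i}$ for $i=1,\ldots,N$, with diagonal $K$-action. The map $\delta:\mathcal{BEM}^{Y_0,Q}\to\prod_{i=1}^{n-1}G/P_{\widehat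 i}\times G/P_{\widehat{j_N}}\times G/P_{\widehat{j_{N-1}}}\times\cdots\times G/P_{\widehat{j_1}}$ is $(xB,g_NB,\ldots,g_1B)\mapsto(xP_{\widehat 1},\ldots,xP_{\widehat{n-1}},g_NP_{\widehat{j_N}},\ldots,g_1P_{\widehat{j_1}})$. Configuration space: for a subset $F\subseteq G/B$, $\mathcal{C}(Q,F)$ is the set of tuples $(F_1,\ldots,F_{n-1},V_N,\ldots,V_1)$ of subspaces of $\mathbb C^n$ with $(F_1,\ldots,F_{n-1})\in F$, $\dim V_k=j_k$, subject to the following containments. The initial right border is $R^{(N+1)}=(F_0,F_1,\ldots,F_{n-1},F_n)$. For $k=N,N-1,\ldots,1$ in turn, $V_k$ must satisfy $R^{(k+1)}_{j_k-1}\subset V_k\subset R^{(k+1)}_{j_k+1}$, and the new right border $R^{(k)}$ is obtained from $R^{(k+1)}$ by replacing its member of dimension $j_k$ by $V_k$. (Here $R^{(k)}_d$ is the $d$-dimensional member of $R^{(k)}$.) $K$ acts diagonally. Barbasch-Evens variety: with $\widetilde{Y_0}$ the preimage of $Y_0$ in $G$, $\mathcal{BE}^{Y_0,Q}:=\widetilde{Y_0}\times^B P_{j_N}\times^B\cdots\times^B P_{j_1}/B$, the quotient of $\widetilde{Y_0}\times P_{j_N}\times\cdots\times P_{j_2}\times(P_{j_1}/B)$ by the action of $B^N$ given by $(g,p_N,p_{N-1},\ldots,p_1B)\mapsto (gb_{N},b_{N}^{-1}p_Nb_{N-1},b_{N-1}^{-1}p_{N-1}b_{N-2},\ldots,b_1^{-1}p_1B)$;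 $K$ acts by left multiplication on the first coordinate. *)

theory Defs
  imports
    "HOL-Analysis.Analysis"
    "HOL-Algebra.Generated_Groups"
    "HOL-Algebra.Left_Coset"
    "HOL-Algebra.Group_Action"
begin

section \<open>Spaces with functions\<close>

text \<open>
  Complex varieties are treated in the classical language of spaces with functions: a topological
  space together with, for every open set, the complex valued functions that are regular on it.
  Varieties form a full subcategory of the category of these spaces, closed under products and
  under passing to locally closed subsets, and geometric quotients are quotients in this category.
  So morphisms and isomorphisms of varieties are exactly the morphisms and isomorphisms
  defined here.  Regular functions are total HOL functions of which only the values
  on the open set in question are relevant.
\<close>

record 'a fspace =
  ztop :: "'a topology"
  regular :: "'a set \<Rightarrow> ('a \<Rightarrow> complex) \<Rightarrow> bool"

abbreviation points :: "'a fspace \<Rightarrow> 'a set" where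
  "points X \<equiv> topspace (ztop X)"

definition morphism :: "'a fspace \<Rightarrow> 'b fspace \<Rightarrow> ('a \<Rightarrow> 'b) \<Rightarrow> bool" where
  "morphism X Y \<phi> \<longleftrightarrow> continuous_map (ztop X) (ztop Y) \<phi> \<and>
     (\<forall>V f. regular Y V f \<longrightarrow> regular X {x \<in> points X. \<phi> x \<in> V} (f \<circ> \<phi>))"

definition isomorphism :: "'a fspace \<Rightarrow> 'b fspace \<Rightarrow> ('a \<Rightarrow> 'b) \<Rightarrow> bool" where
  "isomorphism X Y \<phi> \<longleftrightarrow> morphism X Y \<phi> \<and>
     (\<exists>\<psi>. morphism Y X \<psi> \<and> (\<forall>x\<in>points X. \<psi> (\<phi> x) = x) \<and> (\<forall>y\<in>points Y. \<phi> (\<psi> y) = y))"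

text \<open>\<open>a\<close> and \<open>b\<close> are the actions of \<open>K\<close> on the points of \<open>X\<close> and \<open>Y\<close>.\<close>

definition equivariantly_isomorphic ::
    "'k set \<Rightarrow> 'a fspace \<Rightarrow> ('k \<Rightarrow> 'a \<Rightarrow> 'a) \<Rightarrow> 'b fspace \<Rightarrow> ('k \<Rightarrow> 'b \<Rightarrow> 'b) \<Rightarrow> bool" where
  "equivariantly_isomorphic K X a Y b \<longleftrightarrow>
     (\<forall>k\<in>K. \<forall>x\<in>points X. a k x \<in> points X) \<and>
     (\<forall>k\<in>K. \<forall>y\<in>points Y. b k y \<in> points Y) \<and>
     (\<exists>\<phi>. isomorphism X Y \<phi> \<and> (\<forall>k\<in>K. \<forall>x\<in>points X. \<phi> (a k x) = b k (\<phi> x)))"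

inductive_set polynomials_in :: "('a \<Rightarrow> complex) set \<Rightarrow> ('a \<Rightarrow> complex) set"
  for A :: "('a \<Rightarrow> complex) set" where
  const: "(\<lambda>_. c) \<in> polynomials_in A"
| gen: "f \<in> A \<Longrightarrow> f \<in> polynomials_in A"
| add: "f \<in> polynomials_in A \<Longrightarrow> g \<in> polynomials_in A \<Longrightarrow> (\<lambda>x. f x + g x) \<in> polynomials_in A"
| mult: "f \<in> polynomials_in A \<Longrightarrow> g \<in> polynomials_in A \<Longrightarrow> (\<lambda>x. f x * g x) \<in> polynomials_in A"

text \<open>
  The coarsest structure on the set \<open>S\<close> for which, for every \<open>(U, f) \<in> L\<close>, the set
  \<open>S \<inter> U\<close> is open and \<open>f\<close> is regular on it: the basic open sets are the nonvanishing sets of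
  polynomials in finitely many members of \<open>L\<close> on their common domain, and regular
  functions are locally quotients of such polynomials.  Affine spaces, subspaces and products
  are all of this form.
\<close>

definition common_dom :: "'a set \<Rightarrow> ('a set \<times> ('a \<Rightarrow> complex)) set \<Rightarrow> 'a set" where
  "common_dom S F = S \<inter> (\<Inter>(U, f)\<in>F. U)"

definition initial_fspace :: "'a set \<Rightarrow> ('a set \<times> ('a \<Rightarrow> complex)) set \<Rightarrow> 'a fspace" where
  "initial_fspace S L =
     (let T = topology_generated_by
                {{x \<in> common_dom S F. q x \<noteq> 0} | F q.
                   finite F \<and> F \<subseteq> L \<and> q \<in> polynomials_in (snd ` F)}
      in \<lparr>ztop = T,
          regular = (\<lambda>W f. openin T W \<and>
            (\<forall>x\<in>W. \<exists>F p q. finite F \<and> F \<subseteq> L \<and>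
               p \<in> polynomials_in (snd ` F) \<and> q \<in> polynomials_in (snd ` F) \<and>
               x \<in> common_dom S F \<and> q x \<noteq> 0 \<and>
               (\<forall>y \<in> W \<inter> common_dom S F. q y \<noteq> 0 \<longrightarrow> f y = p y / q y)))\<rparr>)"

definition sub_fspace :: "'a fspace \<Rightarrow> 'a set \<Rightarrow> 'a fspace" where
  "sub_fspace X S = initial_fspace (points X \<inter> S) {(U, f). regular X U f}"

definition pair_fspace :: "'a fspace \<Rightarrow> 'b fspace \<Rightarrow> ('a \<times> 'b) fspace" where
  "pair_fspace X Y = initial_fspace (points X \<times> points Y)
     ({(fst -` U, f \<circ> fst) | U f. regular X U f} \<union> {(snd -` V, g \<circ> snd) | V g. regular Y V g})"

definition list_fspace :: "'a fspace list \<Rightarrow> 'a list fspace" where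
  "list_fspace Xs = initial_fspace
     {xs. length xs = length Xs \<and> (\<forall>i<length Xs. xs ! i \<in> points (Xs ! i))}
     {({xs. xs ! i \<in> U}, \<lambda>xs. f (xs ! i)) | i U f. i < length Xs \<and> regular (Xs ! i) U f}"

definition quotient_fspace :: "'a fspace \<Rightarrow> ('a \<Rightarrow> 'b) \<Rightarrow> 'b fspace" where
  "quotient_fspace X \<pi> =
     (let T = topology (\<lambda>V. V \<subseteq> \<pi> ` points X \<and> openin (ztop X) {x \<in> points X. \<pi> x \<in> V})
      in \<lparr>ztop = T,
          regular = (\<lambda>V f. openin T V \<and> regular X {x \<in> points X. \<pi> x \<in> V} (f \<circ> \<pi>))\<rparr>)"

lemma istopology_quotient:
  "istopology (\<lambda>V. V \<subseteq> \<pi> ` topspace T \<and> openin T {x \<in> topspace T. \<pi> x \<in> V})"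
  unfolding istopology_def
proof (intro conjI allI impI)
  fix S S' assume S: "S \<subseteq> \<pi> ` topspace T \<and> openin T {x \<in> topspace T. \<pi> x \<in> S}"
    and S': "S' \<subseteq> \<pi> ` topspace T \<and> openin T {x \<in> topspace T. \<pi> x \<in> S'}"
  have "{x \<in> topspace T. \<pi> x \<in> S \<inter> S'} = {x \<in> topspace T. \<pi> x \<in> S} \<inter> {x \<in> topspace T. \<pi> x \<in> S'}"
    by auto
  with S S' show "openin T {x \<in> topspace T. \<pi> x \<in> S \<inter> S'}" by auto
  show "S \<inter> S' \<subseteq> \<pi> ` topspace T" using S by auto
next
  fix \<K> assume K: "\<forall>K\<in>\<K>. K \<subseteq> \<pi> ` topspace T \<and> openin T {x \<in> topspace T. \<pi> x \<in> K}"
  have "{x \<in> topspace T. \<pi> x \<in> \<Union>\<K>} = (\<Union>K\<in>\<K>. {x \<in> topspace T. \<pi> x \<in> K})"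
    by auto
  with K show "openin T {x \<in> topspace T. \<pi> x \<in> \<Union>\<K>}" by auto
  show "\<Union>\<K> \<subseteq> \<pi> ` topspace T" using K by auto
qed

lemma openin_quotient_fspace:
  "openin (ztop (quotient_fspace X \<pi>)) V \<longleftrightarrow>
     V \<subseteq> \<pi> ` points X \<and> openin (ztop X) {x \<in> points X. \<pi> x \<in> V}"
  by (simp add: quotient_fspace_def Let_def topology_inverse'[OF istopology_quotient])


section \<open>The general linear group\<close>

text \<open>
  The rows and columns of a matrix are indexed by a finite linearly ordered type \<open>'n\<close>, so
  \<open>n = CARD('n)\<close>; \<open>ix\<close> is the increasing enumeration of the indices by \<open>1, \<dots>, n\<close>.
\<close>

type_synonym 'n mat = "complex ^ 'n ^ 'n"
type_synonym 'n subspc = "(complex ^ 'n) set"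

definition ix :: "'n::{finite,linorder} \<Rightarrow> nat" where
  "ix a = card {b. b \<le> a}"

definition GL :: "'n::finite mat monoid" where
  "GL = \<lparr>carrier = {g. invertible g}, mult = (**), one = mat 1\<rparr>"

definition GL_fspace :: "'n::finite mat fspace" where
  "GL_fspace = sub_fspace (initial_fspace UNIV {(UNIV, \<lambda>g. g $ a $ b) | a b. True}) (carrier GL)"

definition act :: "'n::finite mat \<Rightarrow> 'n subspc \<Rightarrow> 'n subspc" where
  "act g V = (*v) g ` V"

definition coord_subspace :: "nat \<Rightarrow> 'n::{finite,linorder} subspc" where
  "coord_subspace i = vec.span {axis a 1 | a. ix a \<le> i}"

definition borel_subgroup :: "'n::{finite,linorder} mat set" where
  "borel_subgroup = {g \<in> carrier GL. \<forall>i\<le>CARD('n). act g (coord_subspace i) = coord_subspace i}"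

definition simple_transposition :: "nat \<Rightarrow> 'n::{finite,linorder} mat" where
  "simple_transposition i =
     (\<chi> a b. if ix a = Transposition.transpose i (i + 1) (ix b) then 1 else 0)"

definition minimal_parabolic :: "nat \<Rightarrow> 'n::{finite,linorder} mat set" where
  "minimal_parabolic i = borel_subgroup \<union>
     {b ** simple_transposition i ** b' | b b'. b \<in> borel_subgroup \<and> b' \<in> borel_subgroup}"

definition maximal_parabolic :: "nat \<Rightarrow> 'n::{finite,linorder} mat set" where
  "maximal_parabolic i =
     generate GL (borel_subgroup \<union> simple_transposition ` ({1..<CARD('n)} - {i}))"

abbreviation flag_variety :: "'n::{finite,linorder} mat set set" where
  "flag_variety \<equiv> lcosets\<^bsub>GL\<^esub> borel_subgroup"

definition flag_fspace :: "'n::{finite,linorder} mat set fspace" where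
  "flag_fspace = quotient_fspace GL_fspace (\<lambda>g. g <#\<^bsub>GL\<^esub> borel_subgroup)"

text \<open>
  The identifications of \<open>G/P\<close>, for \<open>P\<close> the \<open>i\<close>-th maximal parabolic, with the Grassmannian
  and of \<open>G/B\<close> with the complete flags \<open>[F\<^sub>1, \<dots>, F\<^sub>n\<^sub>-\<^sub>1]\<close>: a coset of \<open>g\<close> is sent to the image
  of the coordinate subspace under any of its elements.
\<close>

definition coset_to_subspace :: "nat \<Rightarrow> 'n::{finite,linorder} mat set \<Rightarrow> 'n subspc" where
  "coset_to_subspace i c = (\<Union>g\<in>c. act g (coord_subspace i))"

definition coset_to_flag :: "'n::{finite,linorder} mat set \<Rightarrow> 'n subspc list" where
  "coset_to_flag c = map (\<lambda>i. coset_to_subspace i c) [1..<CARD('n)]"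

definition grassmannian_fspace :: "nat \<Rightarrow> 'n::{finite,linorder} subspc fspace" where
  "grassmannian_fspace i = quotient_fspace GL_fspace (\<lambda>g. act g (coord_subspace i))"


section \<open>Symmetric pairs\<close>

definition fixed_subgroup :: "('n::finite mat \<Rightarrow> 'n mat) \<Rightarrow> 'n mat set" where
  "fixed_subgroup \<theta> = {g \<in> carrier GL. \<theta> g = g}"

text \<open>
  The three kinds of involutions of \<open>GL\<^sub>n\<close>, each in the form that the involution takes
  in an arbitrary basis.  Their fixed point groups are the centraliser of an
  involutive matrix with eigenspaces of dimension \<open>p\<close> and \<open>q\<close>, and the isometry groups of a
  nondegenerate alternating, respectively symmetric, bilinear form.
\<close>

definition involution_GLp_GLq :: "nat \<Rightarrow> nat \<Rightarrow> ('n::finite mat \<Rightarrow> 'n mat) \<Rightarrow> bool" where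
  "involution_GLp_GLq p q \<theta> \<longleftrightarrow> CARD('n) = p + q \<and>
     (\<exists>D. D ** D = mat 1 \<and> vec.dim {v. D *v v = v} = p \<and> vec.dim {v. D *v v = - v} = q \<and>
          (\<forall>g\<in>carrier GL. \<theta> g = D ** g ** matrix_inv D))"

definition involution_Sp :: "nat \<Rightarrow> ('n::finite mat \<Rightarrow> 'n mat) \<Rightarrow> bool" where
  "involution_Sp m \<theta> \<longleftrightarrow> CARD('n) = 2 * m \<and>
     (\<exists>S. invertible S \<and> transpose S = - S \<and>
          (\<forall>g\<in>carrier GL. \<theta> g = S ** transpose (matrix_inv g) ** matrix_inv S))"

definition involution_O :: "('n::finite mat \<Rightarrow> 'n mat) \<Rightarrow> bool" where
  "involution_O \<theta> \<longleftrightarrow>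
     (\<exists>S. invertible S \<and> transpose S = S \<and>
          (\<forall>g\<in>carrier GL. \<theta> g = S ** transpose (matrix_inv g) ** matrix_inv S))"

definition torus :: "'n::finite mat set \<Rightarrow> bool" where
  "torus T \<longleftrightarrow> subgroup T GL \<and> closedin (ztop GL_fspace) T \<and> connectedin (ztop GL_fspace) T \<and>
     (\<exists>h\<in>carrier GL. \<forall>t\<in>T. \<forall>a b. a \<noteq> b \<longrightarrow> (h ** t ** matrix_inv h) $ a $ b = 0)"

definition maximal_torus :: "'n::finite mat set \<Rightarrow> bool" where
  "maximal_torus T \<longleftrightarrow> torus T \<and> (\<forall>T'. torus T' \<and> T \<subseteq> T' \<longrightarrow> T' = T)"

definition closed_orbit :: "'n::{finite,linorder} mat set \<Rightarrow> 'n mat set set \<Rightarrow> bool" where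
  "closed_orbit K Y \<longleftrightarrow>
     (\<exists>x\<in>flag_variety. Y = orbit (GL\<lparr>carrier := K\<rparr>) (\<lambda>k c. k <#\<^bsub>GL\<^esub> c) x) \<and>
     closedin (ztop flag_fspace) Y"


section \<open>The Barbasch--Evens--Magyar variety and the configuration space\<close>

text \<open>
  Words are lists \<open>Q = [j\<^sub>1, \<dots>, j\<^sub>N]\<close>.  Tuples are written in the decreasing order
  \<open>(x\<^sub>N\<^sub>+\<^sub>1, x\<^sub>N, \<dots>, x\<^sub>1)\<close>, so their entries match those of \<open>rev Q = [j\<^sub>N, \<dots>, j\<^sub>1]\<close>:
  position \<open>k\<close> of \<open>rev Q\<close> holds \<open>j\<^sub>i\<close> for \<open>i = N - k\<close>, and positions \<open>k\<close> and \<open>k + 1\<close> of the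
  tuple hold \<open>x\<^sub>i\<^sub>+\<^sub>1\<close> and \<open>x\<^sub>i\<close>.  For a subgroup \<open>P\<close> containing \<open>B\<close>, the map \<open>G/B \<rightarrow> G/P\<close> is
  \<open>c \<mapsto> c <#> P\<close>.
\<close>

definition BEM :: "'n::{finite,linorder} mat set set \<Rightarrow> nat list \<Rightarrow> 'n mat set list set" where
  "BEM Y Q = {xs. length xs = length Q + 1 \<and> xs ! 0 \<in> Y \<and> set (tl xs) \<subseteq> flag_variety \<and>
     (\<forall>k<length Q. xs ! k <#>\<^bsub>GL\<^esub> minimal_parabolic (rev Q ! k) =
                   xs ! (k + 1) <#>\<^bsub>GL\<^esub> minimal_parabolic (rev Q ! k))}"

definition delta :: "nat list \<Rightarrow> 'n::{finite,linorder} mat set list \<Rightarrow> 'n mat set list" where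
  "delta Q xs =
     map (\<lambda>i. xs ! 0 <#>\<^bsub>GL\<^esub> maximal_parabolic i) [1..<CARD('n)] @
     map (\<lambda>k. xs ! (k + 1) <#>\<^bsub>GL\<^esub> maximal_parabolic (rev Q ! k)) [0..<length Q]"

text \<open>
  The dimensions of the members of a configuration, and the identification of the
  target of \<^const>\<open>delta\<close> with a product of Grassmannians.
\<close>

definition dims :: "'n::finite itself \<Rightarrow> nat list \<Rightarrow> nat list" where
  "dims _ Q = [1..<CARD('n)] @ rev Q"

definition cosets_to_subspaces ::
    "nat list \<Rightarrow> 'n::{finite,linorder} mat set list \<Rightarrow> 'n subspc list" where
  "cosets_to_subspaces Q cs = map2 coset_to_subspace (dims TYPE('n) Q) cs"

text \<open>
  \<open>fits R js Vs\<close>: the subspaces \<open>Vs\<close>, of dimensions \<open>js\<close>, satisfy the successive containments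
  starting from the right border \<open>R = [R\<^sub>0, \<dots>, R\<^sub>n]\<close>.
\<close>

fun fits :: "'n::finite subspc list \<Rightarrow> nat list \<Rightarrow> 'n subspc list \<Rightarrow> bool" where
  "fits R [] [] \<longleftrightarrow> True"
| "fits R (j # js) (V # Vs) \<longleftrightarrow>
     vec.subspace V \<and> vec.dim V = j \<and> R ! (j - 1) \<subseteq> V \<and> V \<subseteq> R ! (j + 1) \<and>
     fits (R[j := V]) js Vs"
| "fits _ _ _ \<longleftrightarrow> False"

definition configuration_space ::
    "nat list \<Rightarrow> 'n::finite subspc list set \<Rightarrow> 'n subspc list set" where
  "configuration_space Q \<F> = {Fs @ Vs | Fs Vs. Fs \<in> \<F> \<and> fits ({0} # Fs @ [UNIV]) (rev Q) Vs}"

definition configuration_fspace ::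
    "nat list \<Rightarrow> 'n::{finite,linorder} subspc list set \<Rightarrow> 'n subspc list fspace" where
  "configuration_fspace Q \<F> =
     sub_fspace (list_fspace (map grassmannian_fspace (dims TYPE('n) Q))) (configuration_space Q \<F>)"


section \<open>The Barbasch--Evens variety\<close>

definition preimage :: "'n::{finite,linorder} mat set set \<Rightarrow> 'n mat set" where
  "preimage Y = {g \<in> carrier GL. g <#\<^bsub>GL\<^esub> borel_subgroup \<in> Y}"

text \<open>
  \<open>BE_factors Y Q\<close> lists the \<open>N + 1\<close> factors: the preimage of \<open>Y\<close>, then the minimal parabolics
  for \<open>j\<^sub>N, \<dots>, j\<^sub>1\<close>.  In \<open>BE_total\<close> the last factor is replaced by its quotient by \<open>B\<close>; its points
  are the pairs \<open>([g, p\<^sub>N, \<dots>, p\<^sub>2], p\<^sub>1B)\<close>, or \<open>([], gB)\<close> for the empty word.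
\<close>

definition BE_factors :: "'n::{finite,linorder} mat set set \<Rightarrow> nat list \<Rightarrow> 'n mat fspace list" where
  "BE_factors Y Q = map (sub_fspace GL_fspace) (preimage Y # map minimal_parabolic (rev Q))"

definition BE_total ::
    "'n::{finite,linorder} mat set set \<Rightarrow> nat list \<Rightarrow> ('n mat list \<times> 'n mat set) fspace" where
  "BE_total Y Q =
     pair_fspace (list_fspace (butlast (BE_factors Y Q)))
       (quotient_fspace (last (BE_factors Y Q)) (\<lambda>p. p <#\<^bsub>GL\<^esub> borel_subgroup))"

text \<open>
  For \<open>bs = [b\<^sub>N, \<dots>, b\<^sub>1]\<close> this is the map
  \<open>([g, p\<^sub>N, \<dots>, p\<^sub>2], p\<^sub>1B) \<mapsto> ([g b\<^sub>N, b\<^sub>N\<inverse> p\<^sub>N b\<^sub>N\<^sub>-\<^sub>1, \<dots>, b\<^sub>2\<inverse> p\<^sub>2 b\<^sub>1], b\<^sub>1\<inverse> p\<^sub>1B)\<close>;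
  the matrix \<open>mat 1\<close> stands in for the missing factor on the left of \<open>g\<close>.
\<close>

definition BE_twist ::
    "'n::finite mat list \<Rightarrow> 'n mat list \<times> 'n mat set \<Rightarrow> 'n mat list \<times> 'n mat set" where
  "BE_twist bs z =
     (map (\<lambda>i. matrix_inv ((mat 1 # bs) ! i) ** fst z ! i ** bs ! i) [0..<length (fst z)],
      matrix_inv (last (mat 1 # bs)) <#\<^bsub>GL\<^esub> snd z)"

definition BE_class ::
    "nat list \<Rightarrow> 'n::{finite,linorder} mat list \<times> 'n mat set \<Rightarrow> ('n mat list \<times> 'n mat set) set" where
  "BE_class Q z = {BE_twist bs z | bs. length bs = length Q \<and> set bs \<subseteq> borel_subgroup}"

definition BE ::
    "'n::{finite,linorder} mat set set \<Rightarrow> nat list \<Rightarrow> ('n mat list \<times> 'n mat set) set fspace" where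
  "BE Y Q = quotient_fspace (BE_total Y Q) (BE_class Q)"

text \<open>For the empty word the coset \<open>gB\<close> is the first coordinate.\<close>

definition BE_act ::
    "'n::finite mat \<Rightarrow> ('n mat list \<times> 'n mat set) set \<Rightarrow> ('n mat list \<times> 'n mat set) set" where
  "BE_act k Z = (\<lambda>(gs, c). case gs of [] \<Rightarrow> ([], k <#\<^bsub>GL\<^esub> c) | g # ps \<Rightarrow> ((k ** g) # ps, c)) ` Z"

end

theory Submission
  imports Defs
begin

text \<open>
  Both sides are described by lists of matrices.  A gallery is a list \<open>h\<^sub>0, \<dots>, h\<^sub>N\<close> of invertible
  matrices with \<open>h\<^sub>0B \<in> Y\<close> in which the flags of two consecutive matrices differ at most
  in the dimension prescribed by the word, the flag of \<open>h\<close> being the image of the coordinate flag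
  \<open>E\<^sub>1 \<subset> \<dots> \<subset> E\<^sub>n\<close>.  It determines a configuration, whose new subspaces are the members
  in the prescribed dimension of the flags of \<open>h\<^sub>1, \<dots>, h\<^sub>N\<close>, and a point of the Barbasch--Evens
  variety, the class of \<open>(h\<^sub>0, h\<^sub>0\<inverse> h\<^sub>1, \<dots>, h\<^sub>N\<^sub>-\<^sub>1\<inverse> h\<^sub>N B)\<close>.

  The reason why everything comes from galleries is that \<open>P\<^sub>j\<close> is the stabilizer of the coordinate flag
  without its \<open>j\<close>-th member and that it acts transitively on the subspaces between \<open>E\<^sub>j\<^sub>-\<^sub>1\<close> and
  \<open>E\<^sub>j\<^sub>+\<^sub>1\<close> (\<open>minimal_parabolic_transitive\<close>, \<open>minimal_parabolic_iff\<close>).  Hence configurations, points of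
  the Barbasch--Evens--Magyar variety and points of the total space over the Barbasch--Evens
  variety all come from galleries (\<open>configuration_space_eq\<close>, \<open>BEM_eq\<close>,
  \<open>points_BE_total_gallery\<close>), and the first claim follows.  Two galleries give the same configuration, or the
  same Barbasch--Evens class, exactly if they have the same flags (\<open>gallery_config_eq_iff\<close>,
  \<open>BE_class_eq_iff\<close>).  This is the bijection, and it is equivariant because \<open>K\<close> acts on galleries by
  left multiplication.

  It remains to see that the bijection is regular in both directions.  Towards the configuration
  space it is given by matrix products and by the action of matrices on subspaces.  In the other direction matrices
  must be found from flags.  Near a given point this can be done regularly
  (\<open>local_flag_lift\<close>), because a vector of a member of the flag extends to a local section of the
  tautological bundle of a Grassmannian (\<open>tautological_section\<close>).  All borders of a configuration
  are flags made of its own members, so the lift provides a gallery that depends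
  regularly on the configuration.  Since lifts exist only locally, regularity is treated in terms
  of germs from the beginning.
\<close>


section \<open>Germs of regular functions and morphisms\<close>

definition regular_at :: "'a fspace \<Rightarrow> 'a \<Rightarrow> ('a \<Rightarrow> complex) \<Rightarrow> bool" where
  "regular_at X x f \<longleftrightarrow> (\<exists>U. x \<in> U \<and> regular X U f)"

text \<open>
  The regular functions form a sheaf of local rings, stated for germs.  These axioms make it
  possible to check regularity, and whether a map is a morphism, one point at a time; this is needed
  because the lifts constructed below exist only near a given point.
\<close>

locale ringed =
  fixes X :: "'a fspace"
  assumes regular_iff: "regular X U f \<longleftrightarrow> openin (ztop X) U \<and> (\<forall>x\<in>U. regular_at X x f)"
    and regular_at_const: "x \<in> points X \<Longrightarrow> regular_at X x (\<lambda>_. c)"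
    and regular_at_add:
      "regular_at X x f \<Longrightarrow> regular_at X x g \<Longrightarrow> regular_at X x (\<lambda>y. f y + g y)"
    and regular_at_mult:
      "regular_at X x f \<Longrightarrow> regular_at X x g \<Longrightarrow> regular_at X x (\<lambda>y. f y * g y)"
    and regular_at_nonzero:
      "regular_at X x f \<Longrightarrow> f x \<noteq> 0 \<Longrightarrow> \<forall>\<^sub>F y in nhdsin (ztop X) x. f y \<noteq> 0"
    and regular_at_inverse:
      "regular_at X x f \<Longrightarrow> f x \<noteq> 0 \<Longrightarrow> regular_at X x (\<lambda>y. inverse (f y))"
    and regular_at_cong:
      "regular_at X x f \<Longrightarrow> \<forall>\<^sub>F y in nhdsin (ztop X) x. f y = g y \<Longrightarrow> regular_at X x g"
begin

lemma regular_at_divide: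
  assumes "regular_at X x f" "regular_at X x g" "g x \<noteq> 0"
  shows "regular_at X x (\<lambda>y. f y / g y)"
  unfolding divide_inverse using assms by (intro regular_at_mult regular_at_inverse)

lemma regular_at_sum:
  assumes "x \<in> points X" "\<And>i. i \<in> I \<Longrightarrow> regular_at X x (f i)"
  shows "regular_at X x (\<lambda>y. \<Sum>i\<in>I. f i y)"
  using assms(2)
  by (induction I rule: infinite_finite_induct)
     (simp_all add: assms regular_at_const regular_at_add)

lemma regular_at_prod:
  assumes "x \<in> points X" "\<And>i. i \<in> I \<Longrightarrow> regular_at X x (f i)"
  shows "regular_at X x (\<lambda>y. \<Prod>i\<in>I. f i y)"
  using assms(2)
  by (induction I rule: infinite_finite_induct)
     (simp_all add: assms regular_at_const regular_at_mult)

end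

lemma eventually_nhdsin_open:
  assumes "openin T U" "x \<in> U"
  shows "\<forall>\<^sub>F y in nhdsin T x. y \<in> U"
  using assms by (auto simp: eventually_nhdsin)

lemma eventually_nhdsin_self:
  assumes "eventually P (nhdsin T x)" "x \<in> topspace T"
  shows "P x"
  using assms by (auto simp: eventually_nhdsin)

lemma openin_if_eventually:
  assumes "U \<subseteq> topspace T" "\<And>x. x \<in> U \<Longrightarrow> \<forall>\<^sub>F y in nhdsin T x. y \<in> U"
  shows "openin T U"
proof (subst openin_subopen, intro ballI)
  fix x assume x: "x \<in> U"
  then obtain S where "openin T S" "x \<in> S" "\<forall>y\<in>S. y \<in> U"
    using assms(1) assms(2)[OF x] by (auto simp: eventually_nhdsin)
  thus "\<exists>S. openin T S \<and> x \<in> S \<and> S \<subseteq> U" by blast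
qed

text \<open>
  The stalkwise notion, for maps that are given by a formula only near \<open>x\<close>; a map that satisfies it
  everywhere is a morphism.
\<close>

definition morphism_at :: "'a fspace \<Rightarrow> 'b fspace \<Rightarrow> 'a \<Rightarrow> ('a \<Rightarrow> 'b) \<Rightarrow> bool" where
  "morphism_at X Y x \<phi> \<longleftrightarrow> x \<in> points X \<and> \<phi> x \<in> points Y \<and>
     filterlim \<phi> (nhdsin (ztop Y) (\<phi> x)) (nhdsin (ztop X) x) \<and>
     (\<forall>f. regular_at Y (\<phi> x) f \<longrightarrow> regular_at X x (\<lambda>y. f (\<phi> y)))"

lemma morphism_at_points:
  "morphism_at X Y x \<phi> \<Longrightarrow> x \<in> points X \<and> \<phi> x \<in> points Y"
  by (simp add: morphism_at_def)

lemma morphism_at_regular: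
  "morphism_at X Y x \<phi> \<Longrightarrow> regular_at Y (\<phi> x) f \<Longrightarrow> regular_at X x (\<lambda>y. f (\<phi> y))"
  by (simp add: morphism_at_def)

lemma morphism_at_eventually:
  "morphism_at X Y x \<phi> \<Longrightarrow> eventually P (nhdsin (ztop Y) (\<phi> x)) \<Longrightarrow>
     \<forall>\<^sub>F y in nhdsin (ztop X) x. P (\<phi> y)"
  by (simp add: morphism_at_def filterlim_iff)

lemma morphism_at_compose:
  assumes "morphism_at X Y x \<phi>" "morphism_at Y Z (\<phi> x) \<psi>"
  shows "morphism_at X Z x (\<lambda>y. \<psi> (\<phi> y))"
  using assms unfolding morphism_at_def by (auto intro: filterlim_compose)

text \<open>
  Continuity and regularity at \<open>x\<close> depend on the germ of the map only.  In this way globally defined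
  maps are compared with formulas that are chosen near a point.
\<close>

lemma morphism_at_cong:
  assumes X: "ringed X" and \<phi>: "morphism_at X Y x \<phi>"
    and eq: "\<forall>\<^sub>F y in nhdsin (ztop X) x. \<phi> y = \<psi> y"
  shows "morphism_at X Y x \<psi>"
proof -
  have x: "x \<in> points X" using \<phi> by (simp add: morphism_at_def)
  have eqx: "\<phi> x = \<psi> x" using eventually_nhdsin_self[OF eq x] .
  have "filterlim \<psi> (nhdsin (ztop Y) (\<psi> x)) (nhdsin (ztop X) x)"
    using \<phi> eq filterlim_cong[OF refl refl eq] by (simp add: morphism_at_def eqx)
  moreover have "regular_at X x (\<lambda>y. f (\<psi> y))" if "regular_at Y (\<psi> x) f" for f
    by (rule ringed.regular_at_cong[OF X morphism_at_regular[OF \<phi>]])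
       (use that eqx eq in \<open>auto elim: eventually_mono\<close>)
  ultimately show ?thesis using \<phi> x by (simp add: morphism_at_def eqx)
qed

lemma morphism_if_morphism_at:
  assumes X: "ringed X" and Y: "ringed Y" and \<phi>: "\<And>x. x \<in> points X \<Longrightarrow> morphism_at X Y x \<phi>"
  shows "morphism X Y \<phi>"
proof -
  have op: "openin (ztop X) {x \<in> points X. \<phi> x \<in> V}" if V: "openin (ztop Y) V" for V
  proof (rule openin_if_eventually)
    fix x assume x: "x \<in> {x \<in> points X. \<phi> x \<in> V}"
    have "\<forall>\<^sub>F y in nhdsin (ztop X) x. \<phi> y \<in> V"
      using x V by (intro morphism_at_eventually[OF \<phi>] eventually_nhdsin_open) auto
    moreover have "\<forall>\<^sub>F y in nhdsin (ztop X) x. y \<in> points X"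
      using x by (intro eventually_nhdsin_open) auto
    ultimately show "\<forall>\<^sub>F y in nhdsin (ztop X) x. y \<in> {x \<in> points X. \<phi> x \<in> V}"
      by eventually_elim auto
  qed auto
  have "regular X {x \<in> points X. \<phi> x \<in> V} (f \<circ> \<phi>)" if f: "regular Y V f" for V f
    unfolding ringed.regular_iff[OF X]
  proof (intro conjI ballI)
    show "openin (ztop X) {x \<in> points X. \<phi> x \<in> V}"
      using f by (intro op) (simp add: ringed.regular_iff[OF Y])
    fix x assume "x \<in> {x \<in> points X. \<phi> x \<in> V}"
    hence "x \<in> points X" "regular_at Y (\<phi> x) f"
      using f by (auto simp: regular_at_def)
    thus "regular_at X x (f \<circ> \<phi>)"
      unfolding o_def by (intro morphism_at_regular[OF \<phi>])
  qed
  moreover have "continuous_map (ztop X) (ztop Y) \<phi>"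
    using op morphism_at_points[OF \<phi>] by (auto simp: continuous_map_def)
  ultimately show ?thesis by (simp add: morphism_def)
qed

lemma morphism_at_if_morphism:
  assumes "morphism X Y \<phi>" "x \<in> points X"
  shows "morphism_at X Y x \<phi>"
proof -
  have c: "continuous_map (ztop X) (ztop Y) \<phi>" using assms by (simp add: morphism_def)
  have "\<forall>\<^sub>F y in nhdsin (ztop X) x. P (\<phi> y)"
    if "eventually P (nhdsin (ztop Y) (\<phi> x))" for P
  proof -
    have "\<phi> x \<in> points Y" using c assms(2) by (auto simp: continuous_map_def)
    then obtain S where S: "openin (ztop Y) S" "\<phi> x \<in> S" "\<forall>x\<in>S. P x"
      using \<open>eventually P (nhdsin (ztop Y) (\<phi> x))\<close> by (auto simp: eventually_nhdsin)
    have "\<forall>\<^sub>F y in nhdsin (ztop X) x. y \<in> {x \<in> points X. \<phi> x \<in> S}"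
      using c S assms(2) by (intro eventually_nhdsin_open) (auto simp: continuous_map_def)
    thus ?thesis using S(3) by (auto elim: eventually_mono)
  qed
  moreover have "regular_at X x (\<lambda>y. f (\<phi> y))" if f: "regular_at Y (\<phi> x) f" for f
  proof -
    obtain U where U: "\<phi> x \<in> U" "regular Y U f" using f by (auto simp: regular_at_def)
    hence "regular X {x \<in> points X. \<phi> x \<in> U} (f \<circ> \<phi>)" using assms(1) by (simp add: morphism_def)
    thus ?thesis using U assms(2) unfolding regular_at_def o_def
      by (intro exI[of _ "{x \<in> points X. \<phi> x \<in> U}"]) simp
  qed
  moreover have "\<phi> x \<in> points Y" using c assms(2) by (auto simp: continuous_map_def)
  ultimately show ?thesis using assms(2) by (simp add: morphism_at_def filterlim_iff)
qed

section \<open>Initial structures\<close>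

lemma polynomials_in_mono: "p \<in> polynomials_in A \<Longrightarrow> A \<subseteq> B \<Longrightarrow> p \<in> polynomials_in B"
  by (induction rule: polynomials_in.induct)
     (auto intro: polynomials_in.intros)

text \<open>
  The nonvanishing sets of the polynomials \<open>q\<close> in finitely many generators.  They are closed under
  finite intersections, so they form a basis and not only a subbasis of the topology.
\<close>

definition basic_dom :: "'a set \<Rightarrow> ('a set \<times> ('a \<Rightarrow> complex)) set \<Rightarrow> ('a \<Rightarrow> complex) \<Rightarrow> 'a set" where
  "basic_dom S F q = {x \<in> common_dom S F. q x \<noteq> 0}"

definition finite_poly ::
    "('a set \<times> ('a \<Rightarrow> complex)) set \<Rightarrow> ('a set \<times> ('a \<Rightarrow> complex)) set \<Rightarrow> ('a \<Rightarrow> complex) \<Rightarrow> bool" where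
  "finite_poly L F q \<longleftrightarrow> finite F \<and> F \<subseteq> L \<and> q \<in> polynomials_in (snd ` F)"

lemma finite_poly_mult:
  "finite_poly L F p \<Longrightarrow> finite_poly L F' q \<Longrightarrow> finite_poly L (F \<union> F') (\<lambda>x. p x * q x)"
  unfolding finite_poly_def
  using polynomials_in_mono[of p "snd ` F" "snd ` (F \<union> F')"]
    polynomials_in_mono[of q "snd ` F'" "snd ` (F \<union> F')"]
  by (simp add: image_Un polynomials_in.mult)

lemma finite_poly_add:
  "finite_poly L F p \<Longrightarrow> finite_poly L F' q \<Longrightarrow> finite_poly L (F \<union> F') (\<lambda>x. p x + q x)"
  unfolding finite_poly_def
  using polynomials_in_mono[of p "snd ` F" "snd ` (F \<union> F')"]
    polynomials_in_mono[of q "snd ` F'" "snd ` (F \<union> F')"]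
  by (simp add: image_Un polynomials_in.add)

lemma finite_poly_const: "finite_poly L {} (\<lambda>_. c)"
  unfolding finite_poly_def by (auto intro: polynomials_in.intros)

lemma basic_dom_mult: "basic_dom S (F \<union> F') (\<lambda>x. p x * q x) = basic_dom S F p \<inter> basic_dom S F' q"
  unfolding basic_dom_def common_dom_def by auto

lemma ztop_initial:
  "ztop (initial_fspace S L) = topology_generated_by {basic_dom S F q | F q. finite_poly L F q}"
  unfolding initial_fspace_def Let_def basic_dom_def finite_poly_def by simp

lemma openin_basic_dom: "finite_poly L F q \<Longrightarrow> openin (ztop (initial_fspace S L)) (basic_dom S F q)"
  unfolding ztop_initial by (rule topology_generated_by_Basis) auto

lemma basic_dom_1: "basic_dom S {} (\<lambda>_. 1) = S"
  by (simp add: basic_dom_def common_dom_def)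

lemma points_initial [simp]: "points (initial_fspace S L) = S"
proof -
  have "S \<in> {basic_dom S F q | F q. finite_poly L F q}"
    using finite_poly_const[of L 1] basic_dom_1[of S] by blast
  thus ?thesis unfolding ztop_initial topology_generated_by_topspace
    by (auto simp: basic_dom_def common_dom_def)
qed

text \<open>
  Intersections of basic sets are basic because \<open>q \<noteq> 0\<close> and \<open>q' \<noteq> 0\<close> together say \<open>q * q' \<noteq> 0\<close>.
\<close>

lemma openin_initial_basis:
  assumes "openin (ztop (initial_fspace S L)) W" "x \<in> W"
  shows "\<exists>F q. finite_poly L F q \<and> x \<in> basic_dom S F q \<and> basic_dom S F q \<subseteq> W"
proof -
  have "generate_topology_on {basic_dom S F q | F q. finite_poly L F q} W"
    using assms(1) unfolding ztop_initial openin_topology_generated_by_iff .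
  thus ?thesis using assms(2)
  proof (induction rule: generate_topology_on.induct)
    case (Int a b)
    then obtain F q F' q' where "finite_poly L F q" "x \<in> basic_dom S F q" "basic_dom S F q \<subseteq> a"
      "finite_poly L F' q'" "x \<in> basic_dom S F' q'" "basic_dom S F' q' \<subseteq> b" by blast
    thus ?case
      by (intro exI[of _ "F \<union> F'"] exI[of _ "\<lambda>x. q x * q' x"])
         (auto simp: finite_poly_mult basic_dom_mult)
  next
    case (UN K)
    then obtain k where "k \<in> K" "x \<in> k" by blast
    thus ?case using UN.IH[of k] by blast
  qed blast+
qed

lemma eventually_initial:
  assumes "x \<in> S"
  shows "eventually P (nhdsin (ztop (initial_fspace S L)) x) \<longleftrightarrow>
    (\<exists>F q. finite_poly L F q \<and> x \<in> basic_dom S F q \<and> (\<forall>y\<in>basic_dom S F q. P y))"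
  (is "?l = ?r")
proof
  assume ?l
  then obtain W where "openin (ztop (initial_fspace S L)) W" "x \<in> W" "\<forall>y\<in>W. P y"
    using assms by (auto simp: eventually_nhdsin)
  with openin_initial_basis[of S L W x] show ?r by blast
next
  assume ?r
  then obtain F q where "finite_poly L F q" "x \<in> basic_dom S F q" "\<forall>y\<in>basic_dom S F q. P y"
    by blast
  thus ?l unfolding eventually_nhdsin using openin_basic_dom[of L F q S] by blast
qed

lemma regular_initial:
  "regular (initial_fspace S L) W f \<longleftrightarrow> openin (ztop (initial_fspace S L)) W \<and>
     (\<forall>x\<in>W. \<exists>F p q. finite_poly L F p \<and> finite_poly L F q \<and> x \<in> basic_dom S F q \<and>
        (\<forall>y \<in> W \<inter> basic_dom S F q. f y = p y / q y))"
  (is "_ \<longleftrightarrow> _ \<and> (\<forall>x\<in>W. ?P x)")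
proof -
  have "(\<exists>F p q. finite F \<and> F \<subseteq> L \<and>
               p \<in> polynomials_in (snd ` F) \<and> q \<in> polynomials_in (snd ` F) \<and>
               x \<in> common_dom S F \<and> q x \<noteq> 0 \<and>
               (\<forall>y \<in> W \<inter> common_dom S F. q y \<noteq> 0 \<longrightarrow> f y = p y / q y)) \<longleftrightarrow> ?P x" for x
    unfolding finite_poly_def basic_dom_def by blast
  thus ?thesis unfolding initial_fspace_def Let_def by simp
qed

text \<open>
  A regular germ is a fraction on a whole basic neighbourhood: the open set on which the given
  representation holds is shrunk to the nonvanishing set of some \<open>q'\<close>, and \<open>p / q\<close> is expanded
  to \<open>(p * q') / (q * q')\<close>, whose denominator has exactly this smaller domain.
\<close>

lemma regular_at_initial:
  "regular_at (initial_fspace S L) x f \<longleftrightarrow>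
     (\<exists>F p q. finite_poly L F p \<and> finite_poly L F q \<and> x \<in> basic_dom S F q \<and>
        (\<forall>y \<in> basic_dom S F q. f y = p y / q y))"
  (is "?l = ?r")
proof
  assume ?l
  then obtain W F p q where W: "openin (ztop (initial_fspace S L)) W" "x \<in> W"
    and F: "finite_poly L F p" "finite_poly L F q" "x \<in> basic_dom S F q"
      "\<forall>y \<in> W \<inter> basic_dom S F q. f y = p y / q y"
    unfolding regular_at_def regular_initial by blast
  obtain F' q' where F': "finite_poly L F' q'" "x \<in> basic_dom S F' q'" "basic_dom S F' q' \<subseteq> W"
    using openin_initial_basis[OF W] by blast
  show ?r
  proof (intro exI conjI ballI)
    show "finite_poly L (F \<union> F') (\<lambda>x. p x * q' x)" "finite_poly L (F \<union> F') (\<lambda>x. q x * q' x)"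
      using F F' by (auto intro: finite_poly_mult)
    show "x \<in> basic_dom S (F \<union> F') (\<lambda>x. q x * q' x)"
      using F F' by (simp add: basic_dom_mult)
    fix y assume y: "y \<in> basic_dom S (F \<union> F') (\<lambda>x. q x * q' x)"
    hence "q' y \<noteq> 0" by (auto simp: basic_dom_def)
    moreover have "f y = p y / q y" using y F F' by (auto simp: basic_dom_mult)
    ultimately show "f y = (p y * q' y) / (q y * q' y)" by simp
  qed
next
  assume ?r
  then obtain F p q where "finite_poly L F p" "finite_poly L F q" "x \<in> basic_dom S F q"
    "\<forall>y \<in> basic_dom S F q. f y = p y / q y" by blast
  thus ?l unfolding regular_at_def regular_initial using openin_basic_dom[of L F q S] by blast
qed

text \<open>
  Sums, products and inverses of fractions are fractions.  The nonvanishing set of \<open>p / q\<close> is that of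
  \<open>q * p\<close>, hence open.
\<close>

lemma ringed_initial: "ringed (initial_fspace S L)"
proof -
  let ?X = "initial_fspace S L"
  have reg: "regular ?X U f \<longleftrightarrow> openin (ztop ?X) U \<and> (\<forall>x\<in>U. regular_at ?X x f)" for U f
  proof
    assume "regular ?X U f"
    thus "openin (ztop ?X) U \<and> (\<forall>x\<in>U. regular_at ?X x f)"
      by (auto simp: regular_at_def regular_initial)
  next
    assume *: "openin (ztop ?X) U \<and> (\<forall>x\<in>U. regular_at ?X x f)"
    show "regular ?X U f"
      unfolding regular_initial
    proof (intro conjI ballI)
      show "openin (ztop ?X) U" using * by simp
      fix x assume "x \<in> U"
      with * have "regular_at ?X x f" by simp
      thus "\<exists>F p q. finite_poly L F p \<and> finite_poly L F q \<and> x \<in> basic_dom S F q \<and>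
          (\<forall>y \<in> U \<inter> basic_dom S F q. f y = p y / q y)"
        unfolding regular_at_initial by blast
    qed
  qed
  show ?thesis
  proof
    fix U f show "regular ?X U f \<longleftrightarrow> openin (ztop ?X) U \<and> (\<forall>x\<in>U. regular_at ?X x f)" by (rule reg)
  next
    fix x c assume "x \<in> points ?X"
    hence "x \<in> S" by simp
    thus "regular_at ?X x (\<lambda>_. c)"
      unfolding regular_at_initial
      using finite_poly_const[of L c] finite_poly_const[of L 1] basic_dom_1[of S]
      by (intro exI[of _ "{}"] exI[of _ "\<lambda>_. c"] exI[of _ "\<lambda>_. 1"]) auto
  next
    fix x f g assume "regular_at ?X x f" "regular_at ?X x g"
    then obtain F p q F' p' q' where
      F: "finite_poly L F p" "finite_poly L F q" "x \<in> basic_dom S F q"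
        "\<forall>y \<in> basic_dom S F q. f y = p y / q y" and
      F': "finite_poly L F' p'" "finite_poly L F' q'" "x \<in> basic_dom S F' q'"
        "\<forall>y \<in> basic_dom S F' q'. g y = p' y / q' y"
      unfolding regular_at_initial by blast
    note fp = finite_poly_mult[OF F(1) F'(1)] finite_poly_mult[OF F(2) F'(2)]
      finite_poly_mult[OF F(1) F'(2)] finite_poly_mult[OF F(2) F'(1)]
    have x: "x \<in> basic_dom S (F \<union> F') (\<lambda>x. q x * q' x)" using F F' by (simp add: basic_dom_mult)
    have nz: "q y \<noteq> 0 \<and> q' y \<noteq> 0 \<and> f y = p y / q y \<and> g y = p' y / q' y"
      if "y \<in> basic_dom S (F \<union> F') (\<lambda>x. q x * q' x)" for y
      using that F F' by (simp add: basic_dom_mult) (simp add: basic_dom_def)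
    show "regular_at ?X x (\<lambda>y. f y * g y)"
      unfolding regular_at_initial
      by (rule exI[of _ "F \<union> F'"], rule exI[of _ "\<lambda>x. p x * p' x"], rule exI[of _ "\<lambda>x. q x * q' x"])
         (use x fp nz in auto)
    have "finite_poly L ((F \<union> F') \<union> (F \<union> F')) (\<lambda>x. p x * q' x + q x * p' x)"
      by (intro finite_poly_add fp)
    hence "finite_poly L (F \<union> F') (\<lambda>x. p x * q' x + q x * p' x)" by simp
    thus "regular_at ?X x (\<lambda>y. f y + g y)"
      unfolding regular_at_initial
      by (intro exI[of _ "F \<union> F'"] exI[of _ "\<lambda>x. p x * q' x + q x * p' x"]
            exI[of _ "\<lambda>x. q x * q' x"]) (use x fp nz in \<open>auto simp: field_simps\<close>)
  next
    fix x f assume f: "regular_at ?X x f" "f x \<noteq> 0"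
    then obtain F p q where
      F: "finite_poly L F p" "finite_poly L F q" "x \<in> basic_dom S F q"
        "\<forall>y \<in> basic_dom S F q. f y = p y / q y" unfolding regular_at_initial by blast
    hence xS: "x \<in> S" by (simp add: basic_dom_def common_dom_def)
    have "finite_poly L (F \<union> F) (\<lambda>x. q x * q x)" "finite_poly L (F \<union> F) (\<lambda>x. q x * p x)"
      by (intro finite_poly_mult F)+
    hence fp: "finite_poly L F (\<lambda>x. q x * q x)" "finite_poly L F (\<lambda>x. q x * p x)" by simp_all
    have x: "x \<in> basic_dom S F (\<lambda>x. q x * p x)"
      using F f by (auto simp: basic_dom_def)
    have *: "y \<in> basic_dom S F q \<and> p y \<noteq> 0 \<and> q y \<noteq> 0" if "y \<in> basic_dom S F (\<lambda>x. q x * p x)" for y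
      using that by (auto simp: basic_dom_def)
    show "\<forall>\<^sub>F y in nhdsin (ztop ?X) x. f y \<noteq> 0"
      unfolding eventually_initial[OF xS] using fp x * F
      by (intro exI[of _ F] exI[of _ "\<lambda>x. q x * p x"]) (auto simp del: mult_eq_0_iff)
    show "regular_at ?X x (\<lambda>y. inverse (f y))"
      unfolding regular_at_initial
      by (rule exI[of _ F], rule exI[of _ "\<lambda>x. q x * q x"], rule exI[of _ "\<lambda>x. q x * p x"])
         (use x fp * F(4) in auto)
  next
    fix x f g assume f: "regular_at ?X x f"
      and ev: "\<forall>\<^sub>F y in nhdsin (ztop ?X) x. f y = g y"
    hence xS: "x \<in> points ?X"
      by (auto simp: regular_at_initial basic_dom_def common_dom_def)
    obtain U where U: "openin (ztop ?X) U" "x \<in> U" "\<forall>y\<in>U. f y = g y"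
      using ev xS by (auto simp: eventually_nhdsin)
    obtain V where V: "x \<in> V" "regular ?X V f" using f by (auto simp: regular_at_def)
    have "regular ?X (U \<inter> V) g"
      unfolding regular_initial
    proof (intro conjI ballI)
      show "openin (ztop ?X) (U \<inter> V)" using U V by (auto simp: regular_initial)
      fix z assume "z \<in> U \<inter> V"
      with V obtain F p q where
        "finite_poly L F p" "finite_poly L F q" "z \<in> basic_dom S F q"
        "\<forall>y \<in> V \<inter> basic_dom S F q. f y = p y / q y" unfolding regular_initial by blast
      thus "\<exists>F p q. finite_poly L F p \<and> finite_poly L F q \<and> z \<in> basic_dom S F q \<and>
              (\<forall>y\<in>U \<inter> V \<inter> basic_dom S F q. g y = p y / q y)"
        using U(3) by (intro exI[of _ F] exI[of _ p] exI[of _ q]) auto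
    qed
    thus "regular_at ?X x g" using U V unfolding regular_at_def by blast
  qed
qed

lemma regular_initial_generator:
  assumes "(U, f) \<in> L"
  shows "regular (initial_fspace S L) (S \<inter> U) f"
proof -
  have fp: "finite_poly L {(U, f)} f" "finite_poly L {(U, f)} (\<lambda>_. 1)"
    using assms by (auto simp: finite_poly_def intro: polynomials_in.intros)
  have D: "basic_dom S {(U, f)} (\<lambda>_. 1) = S \<inter> U"
    by (auto simp: basic_dom_def common_dom_def)
  show ?thesis
    unfolding ringed.regular_iff[OF ringed_initial] regular_at_initial
  proof (intro conjI ballI)
    show "openin (ztop (initial_fspace S L)) (S \<inter> U)" using openin_basic_dom[OF fp(2), of S] D by simp
    fix x assume "x \<in> S \<inter> U"
    thus "\<exists>F p q. finite_poly L F p \<and> finite_poly L F q \<and> x \<in> basic_dom S F q \<and>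
        (\<forall>y\<in>basic_dom S F q. f y = p y / q y)"
      using fp D by (intro exI[of _ "{(U, f)}"] exI[of _ f] exI[of _ "\<lambda>_. 1"]) simp
  qed
qed

text \<open>
  The universal property of an initial structure: only the generating functions have to be
  pulled back.
\<close>

lemma morphism_at_initial:
  assumes X: "ringed X" and x: "x \<in> points X"
    and S: "\<forall>\<^sub>F y in nhdsin (ztop X) x. \<phi> y \<in> S"
    and L: "\<And>U f. (U, f) \<in> L \<Longrightarrow> \<phi> x \<in> U \<Longrightarrow>
              (\<forall>\<^sub>F y in nhdsin (ztop X) x. \<phi> y \<in> U) \<and> regular_at X x (\<lambda>y. f (\<phi> y))"
  shows "morphism_at X (initial_fspace S L) x \<phi>"
proof -
  have \<phi>x: "\<phi> x \<in> S" using eventually_nhdsin_self[OF S x] .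
  have poly: "regular_at X x (\<lambda>y. p (\<phi> y))"
    if F: "finite_poly L F p" and dom: "\<phi> x \<in> common_dom S F" for F p
  proof -
    have "p \<in> polynomials_in (snd ` F)" and FL: "F \<subseteq> L" using F by (auto simp: finite_poly_def)
    thus ?thesis
    proof (induction rule: polynomials_in.induct)
      case (gen f)
      then obtain U where "(U, f) \<in> F" by auto
      thus ?case using L[of U f] FL dom by (auto simp: common_dom_def)
    qed (auto intro: ringed.regular_at_const[OF X x] ringed.regular_at_add[OF X] ringed.regular_at_mult[OF X])
  qed
  have dom: "\<forall>\<^sub>F y in nhdsin (ztop X) x. \<phi> y \<in> basic_dom S F q"
    if F: "finite_poly L F q" and dom: "\<phi> x \<in> basic_dom S F q" for F q
  proof -
    have fin: "finite F" and FL: "F \<subseteq> L" using F by (auto simp: finite_poly_def)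
    have "\<forall>\<^sub>F y in nhdsin (ztop X) x. \<forall>Uf\<in>F. \<phi> y \<in> fst Uf"
    proof (intro eventually_ball_finite[OF fin] ballI)
      fix Uf assume "Uf \<in> F"
      thus "\<forall>\<^sub>F y in nhdsin (ztop X) x. \<phi> y \<in> fst Uf"
        using L[of "fst Uf" "snd Uf"] FL dom
        by (auto simp: basic_dom_def common_dom_def case_prod_unfold)
    qed
    moreover have "\<forall>\<^sub>F y in nhdsin (ztop X) x. q (\<phi> y) \<noteq> 0"
      by (rule ringed.regular_at_nonzero[OF X poly[OF F]]) (use dom in \<open>auto simp: basic_dom_def\<close>)
    ultimately show ?thesis using S
      by eventually_elim (auto simp: basic_dom_def common_dom_def)
  qed
  have "filterlim \<phi> (nhdsin (ztop (initial_fspace S L)) (\<phi> x)) (nhdsin (ztop X) x)"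
    unfolding filterlim_iff eventually_initial[OF \<phi>x] using dom by (blast intro: eventually_mono)
  moreover have "regular_at X x (\<lambda>y. f (\<phi> y))" if f: "regular_at (initial_fspace S L) (\<phi> x) f" for f
  proof -
    obtain F p q where F: "finite_poly L F p" "finite_poly L F q" "\<phi> x \<in> basic_dom S F q"
        "\<forall>y \<in> basic_dom S F q. f y = p y / q y"
      using f unfolding regular_at_initial by blast
    have *: "regular_at X x (\<lambda>y. p (\<phi> y) / q (\<phi> y))"
      using F by (intro ringed.regular_at_divide[OF X] poly) (auto simp: basic_dom_def)
    show ?thesis
      by (rule ringed.regular_at_cong[OF X *])
         (use dom[OF F(2,3)] F(4) in \<open>auto elim: eventually_mono\<close>)
  qed
  ultimately show ?thesis using x \<phi>x by (simp add: morphism_at_def)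
qed

text \<open>
  The projections of a product and the inclusion of a subspace are morphisms for this reason: the
  functions pulled back along them are among the generators.
\<close>

lemma morphism_at_from_initial:
  assumes x: "x \<in> S" "\<phi> x \<in> points Y"
    and L: "\<And>U f. regular Y U f \<Longrightarrow> \<phi> x \<in> U \<Longrightarrow> (\<phi> -` U, f \<circ> \<phi>) \<in> L"
    and Y: "ringed Y"
  shows "morphism_at (initial_fspace S L) Y x \<phi>"
proof -
  have *: "(\<forall>\<^sub>F y in nhdsin (ztop (initial_fspace S L)) x. \<phi> y \<in> U) \<and>
      regular_at (initial_fspace S L) x (\<lambda>y. f (\<phi> y))" if "regular Y U f" "\<phi> x \<in> U" for U f
  proof -
    have r: "regular (initial_fspace S L) (S \<inter> \<phi> -` U) (f \<circ> \<phi>)"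
      by (rule regular_initial_generator[OF L[OF that]])
    hence op: "openin (ztop (initial_fspace S L)) (S \<inter> \<phi> -` U)" by (simp add: regular_initial)
    have "\<forall>\<^sub>F y in nhdsin (ztop (initial_fspace S L)) x. y \<in> S \<inter> \<phi> -` U"
      using x that by (intro eventually_nhdsin_open[OF op]) auto
    moreover have "regular_at (initial_fspace S L) x (f \<circ> \<phi>)"
      unfolding regular_at_def using r that x by (intro exI[of _ "S \<inter> \<phi> -` U"]) auto
    ultimately show ?thesis by (auto simp: o_def elim: eventually_mono)
  qed
  have "\<forall>\<^sub>F y in nhdsin (ztop (initial_fspace S L)) x. P (\<phi> y)"
    if P: "eventually P (nhdsin (ztop Y) (\<phi> x))" for P
  proof -
    obtain V where V: "openin (ztop Y) V" "\<phi> x \<in> V" "\<forall>y\<in>V. P y"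
      using P x(2) by (auto simp: eventually_nhdsin)
    have "regular Y V (\<lambda>_. 0)"
      unfolding ringed.regular_iff[OF Y] using V openin_subset[OF V(1)] ringed.regular_at_const[OF Y] by blast
    from *[OF this V(2)] V(3) show ?thesis by (auto elim: eventually_mono)
  qed
  moreover have "regular_at (initial_fspace S L) x (\<lambda>y. f (\<phi> y))" if "regular_at Y (\<phi> x) f" for f
    using that * by (auto simp: regular_at_def[of Y])
  ultimately show ?thesis using x by (simp add: morphism_at_def filterlim_iff)
qed

section \<open>Subspaces, products and quotients\<close>

lemma ringed_sub: "ringed (sub_fspace X S)"
  by (simp add: sub_fspace_def ringed_initial)

lemma points_sub [simp]: "points (sub_fspace X S) = points X \<inter> S"
  by (simp add: sub_fspace_def)

lemma morphism_at_sub_incl: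
  assumes "ringed X" "x \<in> points X \<inter> S"
  shows "morphism_at (sub_fspace X S) X x (\<lambda>y. y)"
  unfolding sub_fspace_def
  by (rule morphism_at_from_initial) (use assms in \<open>auto simp: o_def vimage_def\<close>)

lemma morphism_at_sub:
  assumes X: "ringed X" and Y: "ringed Y" and \<phi>: "morphism_at X Y x \<phi>"
    and S: "\<forall>\<^sub>F y in nhdsin (ztop X) x. \<phi> y \<in> S"
  shows "morphism_at X (sub_fspace Y S) x \<phi>"
  unfolding sub_fspace_def
proof (rule morphism_at_initial[OF X])
  show x: "x \<in> points X" using morphism_at_points[OF \<phi>] by simp
  have *: "\<forall>\<^sub>F y in nhdsin (ztop X) x. \<phi> y \<in> U" if "openin (ztop Y) U" "\<phi> x \<in> U" for U
    by (intro morphism_at_eventually[OF \<phi>] eventually_nhdsin_open that)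
  show "\<forall>\<^sub>F y in nhdsin (ztop X) x. \<phi> y \<in> points Y \<inter> S"
    using *[OF openin_topspace] morphism_at_points[OF \<phi>] S by (auto elim: eventually_elim2)
  fix U f assume "(U, f) \<in> {(U, f). regular Y U f}" "\<phi> x \<in> U"
  thus "(\<forall>\<^sub>F y in nhdsin (ztop X) x. \<phi> y \<in> U) \<and> regular_at X x (\<lambda>y. f (\<phi> y))"
    using * by (auto simp: ringed.regular_iff[OF Y] intro: morphism_at_regular[OF \<phi>])
qed

lemma ringed_pair: "ringed (pair_fspace X Y)"
  by (simp add: pair_fspace_def ringed_initial)

lemma points_pair [simp]: "points (pair_fspace X Y) = points X \<times> points Y"
  by (simp add: pair_fspace_def)

lemma morphism_at_fst:
  assumes "ringed X" "z \<in> points X \<times> points Y"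
  shows "morphism_at (pair_fspace X Y) X z fst"
  unfolding pair_fspace_def
  by (rule morphism_at_from_initial) (use assms in auto)

lemma morphism_at_snd:
  assumes "ringed Y" "z \<in> points X \<times> points Y"
  shows "morphism_at (pair_fspace X Y) Y z snd"
  unfolding pair_fspace_def
  by (rule morphism_at_from_initial) (use assms in auto)

lemma morphism_at_ball_regular:
  assumes "ringed Y" "morphism_at X Y x \<phi>" "regular Y U f" "\<phi> x \<in> U"
  shows "(\<forall>\<^sub>F y in nhdsin (ztop X) x. \<phi> y \<in> U) \<and> regular_at X x (\<lambda>y. f (\<phi> y))"
  using assms(3,4)
  by (auto simp: ringed.regular_iff[OF assms(1)]
      intro: morphism_at_regular[OF assms(2)] morphism_at_eventually[OF assms(2)] eventually_nhdsin_open)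

lemma morphism_at_eventually_points:
  assumes "morphism_at X Y x \<phi>"
  shows "\<forall>\<^sub>F y in nhdsin (ztop X) x. \<phi> y \<in> points Y"
  using morphism_at_points[OF assms]
  by (intro morphism_at_eventually[OF assms] eventually_nhdsin_open) auto

lemma morphism_at_pair:
  assumes Z: "ringed Z" and X: "ringed X" and Y: "ringed Y"
    and \<phi>: "morphism_at Z X z \<phi>" and \<psi>: "morphism_at Z Y z \<psi>"
  shows "morphism_at Z (pair_fspace X Y) z (\<lambda>y. (\<phi> y, \<psi> y))"
  unfolding pair_fspace_def
proof (rule morphism_at_initial[OF Z])
  show "z \<in> points Z" using morphism_at_points[OF \<phi>] by simp
  show "\<forall>\<^sub>F y in nhdsin (ztop Z) z. (\<phi> y, \<psi> y) \<in> points X \<times> points Y"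
    using morphism_at_eventually_points[OF \<phi>] morphism_at_eventually_points[OF \<psi>]
    by eventually_elim auto
  fix W h assume "(W, h) \<in> {(fst -` U, f \<circ> fst) |U f. regular X U f} \<union>
      {(snd -` V, g \<circ> snd) |V g. regular Y V g}" "(\<phi> z, \<psi> z) \<in> W"
  thus "(\<forall>\<^sub>F y in nhdsin (ztop Z) z. (\<phi> y, \<psi> y) \<in> W) \<and> regular_at Z z (\<lambda>y. h (\<phi> y, \<psi> y))"
    using morphism_at_ball_regular[OF X \<phi>] morphism_at_ball_regular[OF Y \<psi>] by auto
qed

lemma ringed_list: "ringed (list_fspace Xs)"
  by (simp add: list_fspace_def ringed_initial)

lemma points_list:
  "points (list_fspace Xs) = {xs. length xs = length Xs \<and> (\<forall>i<length Xs. xs ! i \<in> points (Xs ! i))}"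
  by (simp add: list_fspace_def)

lemma morphism_at_nth:
  assumes "xs \<in> points (list_fspace Xs)" "i < length Xs" "ringed (Xs ! i)"
  shows "morphism_at (list_fspace Xs) (Xs ! i) xs (\<lambda>ys. ys ! i)"
  unfolding list_fspace_def
proof (rule morphism_at_from_initial)
  fix U f assume U: "regular (Xs ! i) U f"
  show "((\<lambda>ys. ys ! i) -` U, f \<circ> (\<lambda>ys. ys ! i)) \<in> {({xs. xs ! i \<in> U}, \<lambda>xs. f (xs ! i)) |i U f.
           i < length Xs \<and> regular (Xs ! i) U f}"
    by (auto intro!: exI[of _ i] exI[of _ U] exI[of _ f] simp: U assms)
qed (use assms in \<open>auto simp: points_list\<close>)

lemma morphism_at_list:
  assumes Z: "ringed Z" and z: "z \<in> points Z"
    and len: "\<And>y. length (\<phi> y) = length Xs"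
    and X: "\<And>i. i < length Xs \<Longrightarrow> ringed (Xs ! i)"
    and \<phi>: "\<And>i. i < length Xs \<Longrightarrow> morphism_at Z (Xs ! i) z (\<lambda>y. \<phi> y ! i)"
  shows "morphism_at Z (list_fspace Xs) z \<phi>"
  unfolding list_fspace_def
proof (rule morphism_at_initial[OF Z z])
  have "\<forall>\<^sub>F y in nhdsin (ztop Z) z. \<forall>i\<in>{..<length Xs}. \<phi> y ! i \<in> points (Xs ! i)"
    using morphism_at_eventually_points[OF \<phi>] by (intro eventually_ball_finite) auto
  thus "\<forall>\<^sub>F y in nhdsin (ztop Z) z. \<phi> y \<in>
      {xs. length xs = length Xs \<and> (\<forall>i<length Xs. xs ! i \<in> points (Xs ! i))}"
    by eventually_elim (auto simp: len)
  fix W h assume "(W, h) \<in> {({xs. xs ! i \<in> U}, \<lambda>xs. f (xs ! i)) |i U f.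
        i < length Xs \<and> regular (Xs ! i) U f}" "\<phi> z \<in> W"
  thus "(\<forall>\<^sub>F y in nhdsin (ztop Z) z. \<phi> y \<in> W) \<and> regular_at Z z (\<lambda>y. h (\<phi> y))"
    using morphism_at_ball_regular[OF X \<phi>] by auto
qed

lemma points_quotient [simp]: "points (quotient_fspace X \<pi>) = \<pi> ` points X"
proof -
  have "openin (ztop (quotient_fspace X \<pi>)) (\<pi> ` points X)"
    unfolding openin_quotient_fspace
  proof
    have "{x \<in> points X. \<pi> x \<in> \<pi> ` points X} = points X" by auto
    thus "openin (ztop X) {x \<in> points X. \<pi> x \<in> \<pi> ` points X}" by simp
  qed simp
  moreover have "points (quotient_fspace X \<pi>) \<subseteq> \<pi> ` points X"
    using openin_quotient_fspace[of X \<pi>] openin_topspace by blast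
  ultimately show ?thesis using openin_subset by blast
qed

lemma regular_quotient:
  "regular (quotient_fspace X \<pi>) V f \<longleftrightarrow>
     openin (ztop (quotient_fspace X \<pi>)) V \<and> regular X {x \<in> points X. \<pi> x \<in> V} (f \<circ> \<pi>)"
  by (simp add: quotient_fspace_def Let_def)

lemma morphism_quotient_proj: "morphism X (quotient_fspace X \<pi>) \<pi>"
proof -
  have "continuous_map (ztop X) (ztop (quotient_fspace X \<pi>)) \<pi>"
    unfolding continuous_map_def by (auto simp: openin_quotient_fspace)
  thus ?thesis by (simp add: morphism_def regular_quotient)
qed

lemma morphism_from_quotient:
  assumes Y: "ringed Y" and \<phi>: "morphism X Y (\<lambda>x. \<phi> (\<pi> x))"
  shows "morphism (quotient_fspace X \<pi>) Y \<phi>"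
proof -
  have eq: "{x \<in> points X. \<pi> x \<in> \<pi> ` points X \<and> \<phi> (\<pi> x) \<in> V} = {x \<in> points X. \<phi> (\<pi> x) \<in> V}" for V
    by auto
  have c: "continuous_map (ztop X) (ztop Y) (\<lambda>x. \<phi> (\<pi> x))" using \<phi> by (simp add: morphism_def)
  have op: "openin (ztop (quotient_fspace X \<pi>)) {y \<in> \<pi> ` points X. \<phi> y \<in> V}"
    if "openin (ztop Y) V" for V
    unfolding openin_quotient_fspace using c that by (auto simp: continuous_map_def eq)
  have "regular (quotient_fspace X \<pi>) {y \<in> \<pi> ` points X. \<phi> y \<in> V} (f \<circ> \<phi>)"
    if "regular Y V f" for V f
    unfolding regular_quotient using op[of V] \<phi> that
    by (auto simp: morphism_def eq o_def ringed.regular_iff[OF Y])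
  moreover have "continuous_map (ztop (quotient_fspace X \<pi>)) (ztop Y) \<phi>"
    using c op by (auto simp: continuous_map_def)
  ultimately show ?thesis by (simp add: morphism_def)
qed

text \<open>
  Openness and regularity on a quotient are tested after pulling back along \<open>\<pi>\<close>, and pulling back
  commutes with the operations on functions.
\<close>

lemma ringed_quotient:
  assumes X: "ringed X"
  shows "ringed (quotient_fspace X \<pi>)"
proof -
  let ?Q = "quotient_fspace X \<pi>"
  let ?pre = "\<lambda>V. {x \<in> points X. \<pi> x \<in> V}"
  have reg: "regular ?Q V f \<longleftrightarrow> V \<subseteq> \<pi> ` points X \<and> openin (ztop X) (?pre V) \<and>
      (\<forall>x\<in>?pre V. regular_at X x (\<lambda>x. f (\<pi> x)))" for V f
    by (auto simp: regular_quotient openin_quotient_fspace ringed.regular_iff[OF X] o_def)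
  have Int: "{x \<in> points X. \<pi> x \<in> V \<and> \<pi> x \<in> V'} = ?pre V \<inter> ?pre V'" for V V' by auto
  have regI: "regular_at ?Q y h"
    if "y \<in> V" "V \<subseteq> \<pi> ` points X" "openin (ztop X) (?pre V)"
      "\<And>x. x \<in> points X \<Longrightarrow> \<pi> x \<in> V \<Longrightarrow> regular_at X x (\<lambda>x. h (\<pi> x))" for y V h
    unfolding regular_at_def[of ?Q] reg using that by blast
  show ?thesis
  proof
    fix V f show "regular ?Q V f \<longleftrightarrow> openin (ztop ?Q) V \<and> (\<forall>y\<in>V. regular_at ?Q y f)"
    proof
      assume "regular ?Q V f"
      thus "openin (ztop ?Q) V \<and> (\<forall>y\<in>V. regular_at ?Q y f)"
        by (auto simp: regular_quotient regular_at_def)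
    next
      assume *: "openin (ztop ?Q) V \<and> (\<forall>y\<in>V. regular_at ?Q y f)"
      show "regular ?Q V f" unfolding reg
        using * unfolding openin_quotient_fspace regular_at_def[of ?Q] reg by blast
    qed
  next
    fix y c assume "y \<in> points ?Q"
    moreover have "{x \<in> points X. \<pi> x \<in> \<pi> ` points X} = points X" by auto
    ultimately show "regular_at ?Q y (\<lambda>_. c)"
      by (intro regI[of y "\<pi> ` points X"] ringed.regular_at_const[OF X]) simp_all
  next
    fix y f g assume "regular_at ?Q y f" "regular_at ?Q y g"
    then obtain V V' where V: "y \<in> V" "regular ?Q V f" "y \<in> V'" "regular ?Q V' g"
      by (auto simp: regular_at_def)
    show "regular_at ?Q y (\<lambda>y. f y + g y)"
      by (rule regI[of y "V \<inter> V'"]) (use V in \<open>auto simp: reg Int intro!: ringed.regular_at_add[OF X]\<close>)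
    show "regular_at ?Q y (\<lambda>y. f y * g y)"
      by (rule regI[of y "V \<inter> V'"]) (use V in \<open>auto simp: reg Int intro!: ringed.regular_at_mult[OF X]\<close>)
  next
    fix y f assume "regular_at ?Q y f" "f y \<noteq> 0"
    then obtain V where V: "y \<in> V" "regular ?Q V f" by (auto simp: regular_at_def)
    define V' where "V' = {y \<in> V. f y \<noteq> 0}"
    have V': "openin (ztop X) (?pre V')"
    proof (rule openin_if_eventually)
      fix x assume x: "x \<in> ?pre V'"
      have "\<forall>\<^sub>F z in nhdsin (ztop X) x. f (\<pi> z) \<noteq> 0"
        by (rule ringed.regular_at_nonzero[OF X]) (use x V in \<open>auto simp: reg V'_def\<close>)
      moreover have "\<forall>\<^sub>F z in nhdsin (ztop X) x. z \<in> ?pre V"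
        by (rule eventually_nhdsin_open) (use x V in \<open>auto simp: reg V'_def\<close>)
      ultimately show "\<forall>\<^sub>F z in nhdsin (ztop X) x. z \<in> ?pre V'"
        by eventually_elim (auto simp: V'_def)
    qed auto
    have yV': "y \<in> V'" using V \<open>f y \<noteq> 0\<close> by (simp add: V'_def)
    have "openin (ztop ?Q) V'" using V' V by (auto simp: openin_quotient_fspace reg V'_def)
    from eventually_nhdsin_open[OF this yV'] show "\<forall>\<^sub>F z in nhdsin (ztop ?Q) y. f z \<noteq> 0"
      by eventually_elim (auto simp: V'_def)
    show "regular_at ?Q y (\<lambda>y. inverse (f y))"
      by (rule regI[OF yV' _ V'])
         (use V in \<open>auto simp: reg V'_def intro!: ringed.regular_at_inverse[OF X]\<close>)
  next
    fix y f g assume "regular_at ?Q y f"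
      and "\<forall>\<^sub>F z in nhdsin (ztop ?Q) y. f z = g z"
    obtain V where V: "y \<in> V" "regular ?Q V f"
      using \<open>regular_at ?Q y f\<close> by (auto simp: regular_at_def)
    have "y \<in> points ?Q" using V by (auto simp: reg)
    then obtain V' where V': "y \<in> V'" "openin (ztop ?Q) V'" "\<forall>z\<in>V'. f z = g z"
      using \<open>\<forall>\<^sub>F z in nhdsin (ztop ?Q) y. f z = g z\<close>
      by (auto simp: eventually_nhdsin simp del: points_quotient)
    note V = V V'
    have op: "openin (ztop X) (?pre (V \<inter> V'))"
      using V by (auto simp: reg Int openin_quotient_fspace)
    show "regular_at ?Q y g"
    proof (rule regI[of y "V \<inter> V'"])
      fix x assume x: "x \<in> points X" "\<pi> x \<in> V \<inter> V'"
      have "\<forall>\<^sub>F z in nhdsin (ztop X) x. z \<in> ?pre (V \<inter> V')"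
        by (rule eventually_nhdsin_open[OF op]) (use x in auto)
      hence "\<forall>\<^sub>F z in nhdsin (ztop X) x. f (\<pi> z) = g (\<pi> z)"
        by eventually_elim (use V in auto)
      thus "regular_at X x (\<lambda>x. g (\<pi> x))"
        by (rule ringed.regular_at_cong[OF X, rotated]) (use x V in \<open>auto simp: reg\<close>)
    qed (use V op in \<open>auto simp: reg\<close>)
  qed
qed


section \<open>Flags, Borel subgroup and parabolic subgroups\<close>

lemma carrier_GL [simp]: "g \<in> carrier GL \<longleftrightarrow> invertible g"
  by (simp add: GL_def)

lemma mult_GL [simp]: "mult GL = (**)"
  by (simp add: GL_def)

lemma one_GL [simp]: "one GL = mat 1"
  by (simp add: GL_def)

lemma matrix_inv_inverse:
  fixes g :: "'a::field ^ 'n ^ 'n"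
  assumes "invertible g"
  shows "g ** matrix_inv g = mat 1" "matrix_inv g ** g = mat 1"
  using assms someI_ex[of "\<lambda>A. g ** A = mat 1 \<and> A ** g = mat 1"]
  unfolding invertible_def matrix_inv_def by auto

lemma invertible_matrix_inv [simp]:
  fixes g :: "'a::field ^ 'n ^ 'n"
  shows "invertible g \<Longrightarrow> invertible (matrix_inv g)"
  using matrix_inv_inverse[of g] unfolding invertible_def by blast

lemma invertible_mat_1 [simp]: "invertible (mat 1 :: 'a::field ^ 'n ^ 'n)"
  unfolding invertible_def by (intro exI[of _ "mat 1"]) simp

lemma matrix_inv_apply [simp]:
  fixes g :: "'a::field ^ 'n ^ 'n"
  assumes "invertible g"
  shows "matrix_inv g *v (g *v x) = x" "g *v (matrix_inv g *v x) = x"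
  using matrix_inv_inverse[OF assms] by (simp_all add: matrix_vector_mul_assoc)

lemma matrix_inv_unique:
  fixes g :: "'a::field ^ 'n ^ 'n"
  assumes "g ** h = mat 1"
  shows "matrix_inv g = h"
proof -
  have "invertible g" using assms invertible_right_inverse by blast
  hence "matrix_inv g ** (g ** h) = h" by (simp add: matrix_mul_assoc matrix_inv_inverse)
  thus ?thesis using assms by simp
qed

lemma matrix_inv_mat_1 [simp]: "matrix_inv (mat 1 :: 'a::field ^ 'n ^ 'n) = mat 1"
  by (rule matrix_inv_unique) simp

lemma matrix_inv_mult:
  fixes g h :: "'a::field ^ 'n ^ 'n"
  assumes "invertible g" "invertible h"
  shows "matrix_inv (g ** h) = matrix_inv h ** matrix_inv g"
proof (rule matrix_inv_unique)
  have "g ** h ** (matrix_inv h ** matrix_inv g) = g ** (h ** matrix_inv h) ** matrix_inv g"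
    by (simp only: matrix_mul_assoc)
  thus "g ** h ** (matrix_inv h ** matrix_inv g) = mat 1"
    using assms by (simp add: matrix_inv_inverse)
qed

lemma matrix_inv_cancel [simp]:
  fixes g h :: "'a::field ^ 'n ^ 'n"
  assumes "invertible g"
  shows "g ** (matrix_inv g ** h) = h" "matrix_inv g ** (g ** h) = h"
  using assms by (simp_all add: matrix_mul_assoc matrix_inv_inverse)

lemma invertible_if_left_inverse:
  fixes g :: "'a::field ^ 'n ^ 'n"
  assumes "\<And>x. g' *v (g *v x) = x"
  shows "invertible g"
proof -
  have "g' ** g = mat 1"
    using assms by (simp add: matrix_eq matrix_vector_mul_assoc[symmetric])
  thus ?thesis using invertible_left_inverse by blast
qed

lemma group_GL: "group (GL :: 'n::finite mat monoid)"
proof (rule groupI)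
  fix x :: "'n mat" assume "x \<in> carrier GL"
  thus "\<exists>y\<in>carrier GL. y \<otimes>\<^bsub>GL\<^esub> x = \<one>\<^bsub>GL\<^esub>"
    by (intro bexI[of _ "matrix_inv x"]) (simp_all add: matrix_inv_inverse)
qed (simp_all add: invertible_mult matrix_mul_assoc)

lemma inv_GL: "invertible g \<Longrightarrow> inv\<^bsub>GL\<^esub> g = matrix_inv g"
  by (rule group.inv_equality[OF group_GL]) (simp_all add: matrix_inv_inverse)

subsection \<open>The action on subspaces\<close>

lemma act_mult: "act (g ** h) V = act g (act h V)"
  by (simp add: act_def image_image matrix_vector_mul_assoc)

lemma act_one [simp]: "act (mat 1) V = V"
  by (simp add: act_def)

lemma act_mono: "V \<subseteq> W \<Longrightarrow> act g V \<subseteq> act g W"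
  by (auto simp: act_def)

lemma act_inv_act [simp]:
  assumes "invertible g"
  shows "act (matrix_inv g) (act g V) = V" "act g (act (matrix_inv g) V) = V"
  using assms by (simp_all add: act_mult[symmetric] matrix_inv_inverse)

lemma act_eq_iff: "invertible g \<Longrightarrow> act g V = act g W \<longleftrightarrow> V = W"
  by (metis act_inv_act(1))

lemma act_inv_subset_iff: "invertible g \<Longrightarrow> act (matrix_inv g) V \<subseteq> W \<longleftrightarrow> V \<subseteq> act g W"
  by (metis act_inv_act act_mono)

lemma subset_act_inv_iff: "invertible g \<Longrightarrow> V \<subseteq> act (matrix_inv g) W \<longleftrightarrow> act g V \<subseteq> W"
  by (metis act_inv_act act_mono)

lemma mem_act_iff:
  assumes "invertible g"
  shows "v \<in> act g V \<longleftrightarrow> matrix_inv g *v v \<in> V"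
  unfolding act_def image_iff using matrix_inv_apply[OF assms] by metis

lemma subspace_act: "vec.subspace V \<Longrightarrow> vec.subspace (act g V)"
  unfolding act_def
  by (intro module_hom.subspace_image)
     (simp_all add: linear_iff_module_hom[symmetric] matrix_vector_mul_linear_gen)

lemma dim_act:
  assumes "invertible g"
  shows "vec.dim (act g V) = vec.dim V"
proof -
  have "inj ((*v) g)" using matrix_inv_apply(1)[OF assms] by (metis injI)
  thus ?thesis unfolding act_def
    by (intro vec.dim_image_eq matrix_vector_mul_linear_gen) (auto intro: inj_on_subset)
qed

lemma act_eq_if_subset:
  assumes "invertible g" "vec.subspace V" "vec.subspace W" "act g V \<subseteq> W" "vec.dim W = vec.dim V"
  shows "act g V = W"
  using assms by (intro vec.subspace_dim_equal subspace_act) (simp_all add: dim_act)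

lemma act_UNIV [simp]: "invertible g \<Longrightarrow> act g UNIV = UNIV"
  using mem_act_iff by blast

lemma act_0 [simp]: "act g {0} = {0}"
  by (simp add: act_def)

subsection \<open>The coordinate flag\<close>

lemma bij_betw_ix: "bij_betw (ix :: 'n::{finite,linorder} \<Rightarrow> nat) UNIV {1..CARD('n)}"
proof -
  have "strict_mono (ix :: 'n \<Rightarrow> nat)"
    unfolding strict_mono_def ix_def
  proof (intro allI impI psubset_card_mono)
    fix x y :: 'n assume "x < y"
    hence "y \<in> {b. b \<le> y} - {b. b \<le> x}" by simp
    moreover have "{b. b \<le> x} \<subseteq> {b. b \<le> y}" using \<open>x < y\<close> by auto
    ultimately show "{b. b \<le> x} \<subset> {b. b \<le> y}" by blast
  qed simp
  hence inj: "inj (ix :: 'n \<Rightarrow> nat)" by (rule strict_mono_imp_inj_on)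
  have "range (ix :: 'n \<Rightarrow> nat) \<subseteq> {1..CARD('n)}"
  proof safe
    fix a :: 'n
    have "card {a} \<le> ix a" unfolding ix_def by (intro card_mono) auto
    moreover have "ix a \<le> CARD('n)" unfolding ix_def by (intro card_mono) auto
    ultimately show "ix a \<in> {1..CARD('n)}" by simp
  qed
  moreover have "card (range (ix :: 'n \<Rightarrow> nat)) = card {1..CARD('n)}"
    using inj by (simp add: card_image)
  ultimately have "range (ix :: 'n \<Rightarrow> nat) = {1..CARD('n)}"
    by (intro card_subset_eq) auto
  thus ?thesis using inj by (simp add: bij_betw_def)
qed

lemma ix_inject [simp]: "ix a = ix b \<longleftrightarrow> a = b"
  using bij_betw_ix by (auto simp: bij_betw_def inj_on_def)

lemma ix_bounds: "1 \<le> ix (a :: 'n::{finite,linorder})" "ix (a :: 'n) \<le> CARD('n)"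
  using bij_betw_ix[where 'n = 'n] by (auto simp: bij_betw_def)

lemma ex_ix:
  assumes "1 \<le> i" "i \<le> CARD('n::{finite,linorder})"
  shows "\<exists>a::'n. ix a = i"
proof -
  have "i \<in> range (ix :: 'n \<Rightarrow> nat)" using assms bij_betw_ix[where 'n = 'n] by (simp add: bij_betw_def)
  thus ?thesis by auto
qed

lemma mem_coord_subspace:
  "v \<in> (coord_subspace i :: 'n::{finite,linorder} subspc) \<longleftrightarrow> (\<forall>a. i < ix a \<longrightarrow> v $ a = 0)"
proof
  assume "v \<in> (coord_subspace i :: 'n subspc)"
  moreover have "coord_subspace i \<subseteq> {v :: (complex, 'n) vec. \<forall>a. i < ix a \<longrightarrow> v $ a = 0}"
    unfolding coord_subspace_def
    by (intro vec.span_minimal) (auto simp: vec.subspace_def axis_def)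
  ultimately show "\<forall>a. i < ix a \<longrightarrow> v $ a = 0" by blast
next
  assume v: "\<forall>a. i < ix a \<longrightarrow> v $ a = 0"
  have "(\<Sum>a\<in>UNIV. v $ a *s axis a 1) \<in> (coord_subspace i :: 'n subspc)"
    unfolding coord_subspace_def
  proof (intro vec.span_sum)
    fix a
    show "v $ a *s axis a 1 \<in> vec.span {axis a 1 :: (complex, 'n) vec |a. ix a \<le> i}"
    proof (cases "ix a \<le> i")
      case True
      thus ?thesis by (intro vec.span_scale vec.span_base) auto
    next
      case False
      thus ?thesis using v by (simp add: vec.span_zero)
    qed
  qed
  thus "v \<in> (coord_subspace i :: 'n subspc)" by (simp add: basis_expansion)
qed

lemma subspace_coord_subspace [simp]: "vec.subspace (coord_subspace i)"
  unfolding coord_subspace_def by (rule vec.subspace_span)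

lemma coord_subspace_mono: "i \<le> j \<Longrightarrow> coord_subspace i \<subseteq> coord_subspace j"
  by (auto simp: mem_coord_subspace)

lemma coord_subspace_0 [simp]: "coord_subspace 0 = {0 :: complex ^ 'n::{finite,linorder}}"
proof -
  have "0 < ix a" for a :: 'n using ix_bounds(1)[of a] by simp
  thus ?thesis by (auto simp: mem_coord_subspace vec_eq_iff)
qed

lemma coord_subspace_UNIV [simp]:
  assumes "CARD('n) \<le> i"
  shows "coord_subspace i = (UNIV :: 'n::{finite,linorder} subspc)"
proof -
  have "\<not> i < ix a" for a :: 'n using ix_bounds(2)[of a] assms by simp
  thus ?thesis by (auto simp: mem_coord_subspace)
qed

lemma dim_coord_subspace:
  assumes "i \<le> CARD('n)"
  shows "vec.dim (coord_subspace i :: 'n::{finite,linorder} subspc) = i"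
proof -
  have "(coord_subspace i :: 'n subspc) = {v. \<forall>a. a \<notin> {a. ix a \<le> i} \<longrightarrow> v $ a = 0}"
    by (auto simp: mem_coord_subspace not_le)
  hence "vec.dim (coord_subspace i :: 'n subspc) = card {a::'n. ix a \<le> i}"
    by (simp only: dim_substandard_cart)
  also have "\<dots> = card (ix ` {a::'n. ix a \<le> i})"
    by (rule card_image[symmetric]) (auto simp: inj_on_def)
  also have "ix ` {a::'n. ix a \<le> i} = {1..i}"
    using assms ix_bounds ex_ix[where 'n = 'n] by (fastforce simp: image_iff)
  finally show ?thesis by simp
qed

abbreviation gflag :: "'n::{finite,linorder} mat \<Rightarrow> nat \<Rightarrow> 'n subspc" where
  "gflag g i \<equiv> act g (coord_subspace i)"

lemma borel_subgroup_iff: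
  "g \<in> borel_subgroup \<longleftrightarrow> invertible g \<and> (\<forall>i. gflag g i = coord_subspace i)"
proof -
  have "gflag g i = coord_subspace i" if "invertible g" "\<not> i \<le> CARD('a)" for i
    using that by simp
  thus ?thesis unfolding borel_subgroup_def carrier_GL mem_Collect_eq by metis
qed

text \<open>
  The description of \<open>G/B\<close> as the variety of complete flags: a coset consists of all matrices with the
  same flag.  The members of dimension \<open>0\<close> and at least \<open>n\<close> are the same for all invertible matrices,
  so equality of the functions \<open>gflag\<close> is equality of flags.
\<close>

lemma coset_borel:
  fixes h :: "'n::{finite,linorder} mat"
  assumes "invertible h"
  shows "h <#\<^bsub>GL\<^esub> borel_subgroup = {g. invertible g \<and> gflag g = gflag h}"
proof (intro equalityI subsetI)
  fix g assume "g \<in> h <#\<^bsub>GL\<^esub> borel_subgroup"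
  then obtain b where "b \<in> borel_subgroup" "g = h ** b" by (auto simp: l_coset_def)
  thus "g \<in> {g. invertible g \<and> gflag g = gflag h}"
    using assms by (auto simp: borel_subgroup_iff act_mult invertible_mult)
next
  fix g assume g: "g \<in> {g. invertible g \<and> gflag g = gflag h}"
  hence "gflag (matrix_inv h ** g) i = coord_subspace i" for i
    using assms fun_cong[of "gflag g" "gflag h" i] by (simp add: act_mult)
  hence "matrix_inv h ** g \<in> borel_subgroup"
    using g assms by (simp add: borel_subgroup_iff invertible_mult)
  moreover have "g = h ** (matrix_inv h ** g)" using assms by simp
  ultimately show "g \<in> h <#\<^bsub>GL\<^esub> borel_subgroup" by (auto simp: l_coset_def)
qed

lemma coset_borel_eq_iff:
  assumes "invertible g" "invertible h"
  shows "g <#\<^bsub>GL\<^esub> borel_subgroup = h <#\<^bsub>GL\<^esub> borel_subgroup \<longleftrightarrow> gflag g = gflag h"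
  using assms by (auto simp: coset_borel)

lemma coset_coset:
  assumes "invertible g" "invertible h"
  shows "g <#\<^bsub>GL\<^esub> (h <#\<^bsub>GL\<^esub> S) = (g ** h) <#\<^bsub>GL\<^esub> S"
  by (auto simp: l_coset_def matrix_mul_assoc)

subsection \<open>Minimal parabolic subgroups\<close>

lemma simple_transposition_apply:
  fixes a c :: "'n::{finite,linorder}"
  assumes "ix c = Transposition.transpose j (j + 1) (ix a)"
  shows "(simple_transposition j *v v) $ a = v $ c"
proof -
  have "(ix a = Transposition.transpose j (j + 1) (ix b)) \<longleftrightarrow> b = c" for b :: 'n
    using assms by (metis ix_inject transpose_involutory)
  thus ?thesis
    by (simp add: matrix_vector_mult_def simple_transposition_def
        if_distrib[of "\<lambda>x. x * _"] cong: if_cong)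
qed

lemma ex_ix_transpose:
  assumes "1 \<le> j" "j < CARD('n::{finite,linorder})"
  shows "\<exists>c::'n. ix c = Transposition.transpose j (j + 1) (ix (a :: 'n))"
  using assms ix_bounds[of a] by (intro ex_ix) (auto simp: Transposition.transpose_def)

lemma invertible_simple_transposition:
  assumes "1 \<le> j" "j < CARD('n::{finite,linorder})"
  shows "invertible (simple_transposition j :: 'n mat)"
proof (rule invertible_if_left_inverse)
  fix x :: "(complex, 'n) vec"
  show "simple_transposition j *v (simple_transposition j *v x) = x"
  proof (subst vec_eq_iff, rule allI)
    fix a :: 'n
    obtain c :: 'n where c: "ix c = Transposition.transpose j (j + 1) (ix a)"
      using ex_ix_transpose[OF assms] by blast
    hence "ix a = Transposition.transpose j (j + 1) (ix c)" by simp
    with c show "(simple_transposition j *v (simple_transposition j *v x)) $ a = x $ a"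
      by (simp add: simple_transposition_apply)
  qed
qed

lemma gflag_simple_transposition:
  assumes j: "1 \<le> j" "j < CARD('n::{finite,linorder})" and "i \<noteq> j"
  shows "gflag (simple_transposition j :: 'n mat) i = coord_subspace i"
proof (rule act_eq_if_subset)
  show "gflag (simple_transposition j :: 'n mat) i \<subseteq> coord_subspace i"
  proof
    fix w :: "(complex, 'n) vec" assume "w \<in> gflag (simple_transposition j) i"
    then obtain v where v: "v \<in> coord_subspace i" "w = simple_transposition j *v v"
      by (auto simp: act_def)
    show "w \<in> coord_subspace i"
      unfolding mem_coord_subspace
    proof (intro allI impI)
      fix a :: 'n assume a: "i < ix a"
      obtain c :: 'n where c: "ix c = Transposition.transpose j (j + 1) (ix a)"
        using ex_ix_transpose[OF j] by blast
      hence "i < ix c" using a \<open>i \<noteq> j\<close> by (auto simp: Transposition.transpose_def split: if_splits)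
      thus "w $ a = 0" using v c by (simp add: simple_transposition_apply[OF c] mem_coord_subspace)
    qed
  qed
qed (use j in \<open>auto intro: invertible_simple_transposition\<close>)

definition elementary :: "'n \<Rightarrow> 'n \<Rightarrow> complex \<Rightarrow> 'n::finite mat" where
  "elementary a b c = (\<chi> r s. (if r = s then 1 else 0) + (if r = a \<and> s = b then c else 0))"

lemma elementary_apply:
  "(elementary a b c *v x) $ r = x $ r + (if r = a then c * x $ b else 0)"
proof -
  have "(elementary a b c *v x) $ r =
      (\<Sum>s\<in>UNIV. (if s = r then x $ s else 0) + (if s = b then if r = a then c * x $ s else 0 else 0))"
    unfolding matrix_vector_mult_def elementary_def
    by (auto intro!: sum.cong simp: distrib_right)
  thus ?thesis by (simp add: sum.distrib)
qed

lemma invertible_elementary: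
  assumes "a \<noteq> b"
  shows "invertible (elementary a b c)"
  by (rule invertible_if_left_inverse[of "elementary a b (- c)"])
     (use assms in \<open>auto simp: vec_eq_iff elementary_apply\<close>)

lemma elementary_mem_borel:
  assumes "ix a < ix b"
  shows "elementary a b c \<in> borel_subgroup"
proof -
  have inv: "invertible (elementary a b c)" using assms by (intro invertible_elementary) auto
  have "gflag (elementary a b c) i = coord_subspace i" for i
    by (rule act_eq_if_subset)
       (use inv assms in \<open>auto simp: act_def mem_coord_subspace elementary_apply\<close>)
  thus ?thesis using inv by (simp add: borel_subgroup_iff)
qed

lemma one_mem_borel [simp]: "mat 1 \<in> borel_subgroup"
  by (simp add: borel_subgroup_iff)

lemma minimal_parabolic_fixes:
  assumes j: "1 \<le> j" "j < CARD('n::{finite,linorder})"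
    and p: "(p :: 'n mat) \<in> minimal_parabolic j"
  shows "invertible p" "i \<noteq> j \<Longrightarrow> gflag p i = coord_subspace i"
  using p invertible_simple_transposition[OF j] gflag_simple_transposition[OF j, of i]
  by (auto simp: minimal_parabolic_def borel_subgroup_iff invertible_mult act_mult)

text \<open>
  A subspace \<open>V\<close> between \<open>E\<^sub>j\<^sub>-\<^sub>1\<close> and \<open>E\<^sub>j\<^sub>+\<^sub>1\<close> other than \<open>E\<^sub>j\<close> contains a vector
  \<open>c e\<^sub>j + e\<^sub>j\<^sub>+\<^sub>1\<close>.  The transposition \<open>s\<^sub>j\<close> followed by an elementary matrix moves \<open>e\<^sub>j\<close> to it and
  fixes \<open>E\<^sub>j\<^sub>-\<^sub>1\<close>.  So \<open>P\<^sub>j\<close> acts transitively on the projective line of all such \<open>V\<close>.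
\<close>

lemma minimal_parabolic_transitive:
  fixes V :: "'n::{finite,linorder} subspc"
  assumes j: "1 \<le> j" "j < CARD('n)"
    and V: "vec.subspace V" "vec.dim V = j" "coord_subspace (j - 1) \<subseteq> V" "V \<subseteq> coord_subspace (j + 1)"
  shows "\<exists>p\<in>minimal_parabolic j. gflag p j = V"
proof (cases "V \<subseteq> coord_subspace j")
  case True
  hence "V = coord_subspace j"
    using V j by (intro vec.subspace_dim_equal) (simp_all add: dim_coord_subspace)
  thus ?thesis by (intro bexI[of _ "mat 1"]) (simp_all add: minimal_parabolic_def)
next
  case False
  obtain a b :: 'n where ab: "ix a = j" "ix b = j + 1"
    using j ex_ix[of j, where 'n = 'n] ex_ix[of "j + 1", where 'n = 'n] by auto
  obtain v where v: "v \<in> V" "v \<notin> coord_subspace j" using False by blast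
  have "v $ b \<noteq> 0"
  proof
    assume "v $ b = 0"
    hence "v \<in> coord_subspace j"
      using v V ab unfolding mem_coord_subspace subset_iff
      by (metis Suc_eq_plus1 Suc_lessI ix_inject)
    with v show False by simp
  qed
  \<comment> \<open>\<open>w\<close> is \<open>v / v\<^sub>b\<close> without its coordinates before \<open>a\<close>, which form a vector of \<open>E\<^sub>j\<^sub>-\<^sub>1 \<subseteq> V\<close>.\<close>
  define c where "c = v $ a / v $ b"
  define w where "w = c *s axis a 1 + axis b (1::complex)"
  have wV: "w \<in> V"
  proof -
    have "w - (1 / v $ b) *s v \<in> coord_subspace (j - 1)"
      unfolding mem_coord_subspace
    proof (intro allI impI)
      fix d :: 'n assume d: "j - 1 < ix d"
      consider "d = a" | "d = b" | "j + 1 < ix d"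
        using d j ab by (metis Suc_eq_plus1 Suc_pred' ix_inject less_antisym linorder_neqE_nat
            not_less_eq le_simps(3) One_nat_def)
      thus "(w - (1 / v $ b) *s v) $ d = 0"
      proof cases
        case 3
        hence "v $ d = 0" using v V by (auto simp: mem_coord_subspace)
        thus ?thesis using 3 ab by (auto simp: w_def axis_def)
      qed (use ab \<open>v $ b \<noteq> 0\<close> in \<open>auto simp: w_def c_def axis_def\<close>)
    qed
    hence "(w - (1 / v $ b) *s v) + (1 / v $ b) *s v \<in> V"
      using V v by (intro vec.subspace_add[OF V(1)] vec.subspace_scale[OF V(1)]) auto
    thus ?thesis by simp
  qed
  define p where "p = elementary a b c ** simple_transposition j"
  have p: "p \<in> minimal_parabolic j"
    unfolding minimal_parabolic_def p_def using ab
    by (intro UnI2 CollectI exI[of _ "elementary a b c"] exI[of _ "mat 1"])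
       (simp add: elementary_mem_borel)
  have "gflag p j = V"
  proof (rule act_eq_if_subset)
    show "invertible p" using minimal_parabolic_fixes(1)[OF j p] .
    show "gflag p j \<subseteq> V"
    proof
      fix x assume "x \<in> gflag p j"
      then obtain u where u: "u \<in> coord_subspace j" "x = p *v u" by (auto simp: act_def)
      have s: "(simple_transposition j *v u) $ d = (if d = a then 0 else if d = b then u $ a else u $ d)"
        for d
      proof -
        have "u $ b = 0" using u ab by (auto simp: mem_coord_subspace)
        moreover have "ix (if d = a then b else if d = b then a else d)
            = Transposition.transpose j (j + 1) (ix d)"
          using ab ix_inject[of d a] ix_inject[of d b] by (auto simp: Transposition.transpose_def simp del: ix_inject)
        ultimately show ?thesis by (subst simple_transposition_apply) auto
      qed
      have "x - u $ a *s w \<in> coord_subspace (j - 1)"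
        unfolding mem_coord_subspace
      proof (intro allI impI)
        fix d :: 'n assume d: "j - 1 < ix d"
        consider "d = a" | "d = b" | "j < ix d" "d \<noteq> a" "d \<noteq> b"
          using d j ab by (metis Suc_pred' ix_inject less_antisym linorder_neqE_nat
            not_less_eq le_simps(3) One_nat_def)
        thus "(x - u $ a *s w) $ d = 0"
          using u ab
          by cases (auto simp: u(2) p_def matrix_vector_mul_assoc[symmetric] elementary_apply s
              w_def axis_def mem_coord_subspace)
      qed
      hence "(x - u $ a *s w) + u $ a *s w \<in> V"
        using V wV by (intro vec.subspace_add[OF V(1)] vec.subspace_scale[OF V(1)]) auto
      thus "x \<in> V" by simp
    qed
  qed (use V j in \<open>simp_all add: dim_coord_subspace\<close>)
  with p show ?thesis by blast
qed

text \<open>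
  \<open>P\<^sub>j = B \<union> B s\<^sub>j B\<close> is the stabilizer of the coordinate flag without its \<open>j\<close>-th member: by transitivity
  \<open>g\<close> agrees on \<open>E\<^sub>j\<close> with some \<open>p\<close> of \<open>P\<^sub>j\<close>, and then \<open>p\<inverse> g\<close> fixes the whole flag, so
  it lies in \<open>B\<close>.
\<close>

lemma minimal_parabolic_iff:
  fixes g :: "'n::{finite,linorder} mat"
  assumes j: "1 \<le> j" "j < CARD('n)"
  shows "g \<in> minimal_parabolic j \<longleftrightarrow> invertible g \<and> (\<forall>i. i \<noteq> j \<longrightarrow> gflag g i = coord_subspace i)"
proof
  assume "invertible g \<and> (\<forall>i. i \<noteq> j \<longrightarrow> gflag g i = coord_subspace i)"
  hence g: "invertible g" and stab: "\<And>i. i \<noteq> j \<Longrightarrow> gflag g i = coord_subspace i" by auto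
  have "\<exists>p\<in>minimal_parabolic j. gflag p j = gflag g j"
  proof (rule minimal_parabolic_transitive[OF j])
    show "vec.subspace (gflag g j)" by (simp add: subspace_act)
    show "vec.dim (gflag g j) = j" using g j by (simp add: dim_act dim_coord_subspace)
    show "coord_subspace (j - 1) \<subseteq> gflag g j"
      using stab[of "j - 1"] act_mono[OF coord_subspace_mono[of "j - 1" j], of g] j by simp
    show "gflag g j \<subseteq> coord_subspace (j + 1)"
      using stab[of "j + 1"] act_mono[OF coord_subspace_mono[of j "j + 1"], of g] j by simp
  qed
  then obtain p where p: "p \<in> minimal_parabolic j" "gflag p j = gflag g j" by blast
  note fp = minimal_parabolic_fixes[OF j p(1)]
  have "gflag (matrix_inv p ** g) i = coord_subspace i" for i
    using fp(2)[of i] stab[of i] p(2) act_inv_act(1)[OF fp(1), of "coord_subspace i"]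
    by (cases "i = j") (simp_all add: act_mult)
  hence b: "matrix_inv p ** g \<in> borel_subgroup"
    using g fp(1) by (simp add: borel_subgroup_iff invertible_mult)
  have borel_mult: "b ** b' \<in> borel_subgroup" if "b \<in> borel_subgroup" "b' \<in> borel_subgroup"
    for b b' :: "'n mat"
    using that by (simp add: borel_subgroup_iff act_mult invertible_mult)
  have "p ** (matrix_inv p ** g) \<in> minimal_parabolic j"
    using p(1)[unfolded minimal_parabolic_def]
  proof
    assume "p \<in> {b ** simple_transposition j ** b' |b b'. b \<in> borel_subgroup \<and> b' \<in> borel_subgroup}"
    then obtain b1 b2 where *: "b1 \<in> borel_subgroup" "b2 \<in> borel_subgroup"
      "p = b1 ** simple_transposition j ** b2" by blast
    hence "p ** (matrix_inv p ** g) = b1 ** simple_transposition j ** (b2 ** (matrix_inv p ** g))"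
      by (simp only: matrix_mul_assoc)
    thus ?thesis unfolding minimal_parabolic_def using * borel_mult[OF *(2) b] by blast
  qed (use borel_mult[OF _ b] in \<open>simp add: minimal_parabolic_def\<close>)
  thus "g \<in> minimal_parabolic j" using fp(1) by simp
qed (use minimal_parabolic_fixes[OF j] in auto)

lemma coset_minimal_parabolic:
  fixes h :: "'n::{finite,linorder} mat"
  assumes h: "invertible h" and j: "1 \<le> j" "j < CARD('n)"
  shows "(h <#\<^bsub>GL\<^esub> borel_subgroup) <#>\<^bsub>GL\<^esub> minimal_parabolic j =
    {g. invertible g \<and> (\<forall>i. i \<noteq> j \<longrightarrow> gflag g i = gflag h i)}"
proof (intro equalityI subsetI)
  fix g assume "g \<in> (h <#\<^bsub>GL\<^esub> borel_subgroup) <#>\<^bsub>GL\<^esub> minimal_parabolic j"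
  then obtain h' p where *: "h' \<in> h <#\<^bsub>GL\<^esub> borel_subgroup" "p \<in> minimal_parabolic j" "g = h' ** p"
    by (auto simp: set_mult_def)
  hence "invertible h'" "gflag h' = gflag h" by (auto simp: coset_borel[OF h])
  with * show "g \<in> {g. invertible g \<and> (\<forall>i. i \<noteq> j \<longrightarrow> gflag g i = gflag h i)}"
    by (auto simp: minimal_parabolic_iff[OF j] act_mult invertible_mult fun_eq_iff)
next
  fix g assume g: "g \<in> {g. invertible g \<and> (\<forall>i. i \<noteq> j \<longrightarrow> gflag g i = gflag h i)}"
  hence "matrix_inv h ** g \<in> minimal_parabolic j"
    using h by (simp add: minimal_parabolic_iff[OF j] act_mult invertible_mult)
  moreover have "h \<in> h <#\<^bsub>GL\<^esub> borel_subgroup" using h by (simp add: coset_borel)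
  moreover have "g = h ** (matrix_inv h ** g)" using h by simp
  ultimately show "g \<in> (h <#\<^bsub>GL\<^esub> borel_subgroup) <#>\<^bsub>GL\<^esub> minimal_parabolic j"
    unfolding set_mult_def by auto
qed

subsection \<open>Maximal parabolic subgroups\<close>

lemma maximal_parabolic_fixes:
  assumes "(p :: 'n::{finite,linorder} mat) \<in> maximal_parabolic i"
  shows "invertible p \<and> gflag p i = coord_subspace i"
proof -
  let ?H = "{g :: 'n mat. invertible g \<and> gflag g i = coord_subspace i}"
  have "subgroup ?H GL"
  proof (rule group.subgroupI[OF group_GL])
    have "mat 1 \<in> ?H" by simp
    thus "?H \<noteq> {}" by blast
    show "inv\<^bsub>GL\<^esub> g \<in> ?H" if "g \<in> ?H" for g
      using that act_inv_act(1)[of g "coord_subspace i"] by (auto simp: inv_GL)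
  qed (auto simp: act_mult invertible_mult)
  moreover have "borel_subgroup \<union> simple_transposition ` ({1..<CARD('n)} - {i}) \<subseteq> ?H"
    by (auto simp: borel_subgroup_iff invertible_simple_transposition gflag_simple_transposition)
  ultimately have "maximal_parabolic i \<subseteq> ?H"
    unfolding maximal_parabolic_def by (intro group.generate_subgroup_incl[OF group_GL])
  thus ?thesis using assms by blast
qed

lemma coset_to_subspace_borel:
  assumes "invertible h"
  shows "coset_to_subspace i (h <#\<^bsub>GL\<^esub> borel_subgroup) = gflag h i"
proof -
  have "gflag g i = gflag h i" if "g \<in> h <#\<^bsub>GL\<^esub> borel_subgroup" for g
    using that assms by (simp add: coset_borel fun_eq_iff)
  moreover have "h \<in> h <#\<^bsub>GL\<^esub> borel_subgroup" using assms by (simp add: coset_borel)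
  ultimately show ?thesis unfolding coset_to_subspace_def by blast
qed

lemma coset_to_subspace_maximal:
  assumes h: "invertible h"
  shows "coset_to_subspace i ((h <#\<^bsub>GL\<^esub> borel_subgroup) <#>\<^bsub>GL\<^esub> maximal_parabolic i) = gflag h i"
proof -
  have "gflag g i = gflag h i"
    if g: "g \<in> (h <#\<^bsub>GL\<^esub> borel_subgroup) <#>\<^bsub>GL\<^esub> maximal_parabolic i" for g
  proof -
    obtain h' p where "h' \<in> h <#\<^bsub>GL\<^esub> borel_subgroup" "p \<in> maximal_parabolic i" "g = h' ** p"
      using g by (auto simp: set_mult_def)
    thus ?thesis using h maximal_parabolic_fixes[of p i] by (simp add: coset_borel act_mult fun_eq_iff)
  qed
  moreover have "h \<in> (h <#\<^bsub>GL\<^esub> borel_subgroup) <#>\<^bsub>GL\<^esub> maximal_parabolic i"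
  proof -
    have "h \<in> h <#\<^bsub>GL\<^esub> borel_subgroup" using h by (simp add: coset_borel)
    moreover have "mat 1 \<in> maximal_parabolic i"
      unfolding maximal_parabolic_def by (rule generate.incl) simp
    ultimately show ?thesis unfolding set_mult_def by (force simp: matrix_mul_rid)
  qed
  ultimately show ?thesis unfolding coset_to_subspace_def by blast
qed

lemma coset_to_flag_borel:
  fixes h :: "'n::{finite,linorder} mat"
  assumes "invertible h"
  shows "coset_to_flag (h <#\<^bsub>GL\<^esub> borel_subgroup) = map (gflag h) [1..<CARD('n)]"
  using assms by (simp add: coset_to_flag_def coset_to_subspace_borel)


section \<open>Maps into the general linear group\<close>

lemma ringed_GL: "ringed GL_fspace"
  by (simp add: GL_fspace_def ringed_sub)

lemma points_GL [simp]: "points GL_fspace = {g. invertible g}"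
  by (auto simp: GL_fspace_def)

lemma regular_at_entry:
  assumes "morphism_at X GL_fspace x h"
  shows "regular_at X x (\<lambda>y. h y $ a $ b)"
proof -
  let ?M = "initial_fspace UNIV {(UNIV, \<lambda>g. g $ a $ b) | a b. True} :: 'b mat fspace"
  have "regular ?M (UNIV \<inter> UNIV) (\<lambda>g. g $ a $ b)"
    by (rule regular_initial_generator) auto
  hence *: "regular_at ?M (h x) (\<lambda>g. g $ a $ b)"
    unfolding regular_at_def by (intro exI[of _ UNIV]) simp
  have "morphism_at GL_fspace ?M (h x) (\<lambda>g. g)"
    unfolding GL_fspace_def
    by (rule morphism_at_sub_incl[OF ringed_initial]) (use morphism_at_points[OF assms] in simp)
  from morphism_at_regular[OF this *] show ?thesis
    by (rule morphism_at_regular[OF assms])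
qed

lemma regular_at_det:
  assumes X: "ringed X" and x: "x \<in> points X" and h: "\<And>a b. regular_at X x (\<lambda>y. h y $ a $ b)"
  shows "regular_at X x (\<lambda>y. det (h y))"
  unfolding det_def
  by (intro ringed.regular_at_sum[OF X x] ringed.regular_at_mult[OF X]
      ringed.regular_at_prod[OF X x] ringed.regular_at_const[OF X x] h)

lemma morphism_at_GL:
  assumes X: "ringed X" and x: "x \<in> points X" and h: "\<And>a b. regular_at X x (\<lambda>y. h y $ a $ b)"
    and inv: "invertible (h x)"
  shows "morphism_at X GL_fspace x h"
  unfolding GL_fspace_def
proof (rule morphism_at_sub[OF X ringed_initial])
  show "morphism_at X (initial_fspace UNIV {(UNIV, \<lambda>g. g $ a $ b) |a b. True}) x h"
    by (rule morphism_at_initial[OF X x]) (use h in auto)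
  show "\<forall>\<^sub>F y in nhdsin (ztop X) x. h y \<in> carrier GL"
    using ringed.regular_at_nonzero[OF X regular_at_det[OF X x h]] inv
    by (simp add: invertible_det_nz)
qed

text \<open>
  By Cramer's rule the entries of the inverse are quotients of determinants.
\<close>

lemma regular_at_matrix_inv:
  fixes h :: "'x \<Rightarrow> 'n::finite mat"
  assumes X: "ringed X" and x: "x \<in> points X" and h: "\<And>a b. regular_at X x (\<lambda>y. h y $ a $ b)"
    and inv: "invertible (h x)"
  shows "regular_at X x (\<lambda>y. matrix_inv (h y) $ a $ b)"
proof -
  define c where "c = (\<lambda>y. (\<chi> i j. if j = a then axis b 1 $ i else h y $ i $ j) :: 'n mat)"
  have entry: "matrix_inv (h y) $ a $ b = det (c y) / det (h y)" if "det (h y) \<noteq> 0" for y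
  proof -
    have "h y *v (matrix_inv (h y) *v axis b 1) = axis b 1"
      using that by (simp add: invertible_det_nz)
    hence "(matrix_inv (h y) *v axis b 1) $ a = det (c y) / det (h y)"
      unfolding cramer[OF that] c_def by simp
    moreover have "(matrix_inv (h y) *v axis b 1) $ a = matrix_inv (h y) $ a $ b"
      by (simp add: matrix_vector_mult_def axis_def if_distrib cong: if_cong)
    ultimately show ?thesis by simp
  qed
  have nz: "det (h x) \<noteq> 0" using inv by (simp add: invertible_det_nz)
  have reg: "regular_at X x (\<lambda>y. c y $ i $ j)" for i j
    using h by (cases "j = a") (auto simp: c_def intro: ringed.regular_at_const[OF X x])
  have "regular_at X x (\<lambda>y. det (c y) / det (h y))"
    using nz by (intro ringed.regular_at_divide[OF X] regular_at_det[OF X x] reg h)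
  moreover have "\<forall>\<^sub>F y in nhdsin (ztop X) x. det (c y) / det (h y) = matrix_inv (h y) $ a $ b"
    using ringed.regular_at_nonzero[OF X regular_at_det[OF X x h] nz]
    by eventually_elim (simp add: entry)
  ultimately show ?thesis by (rule ringed.regular_at_cong[OF X])
qed

lemma morphism_at_GL_mult:
  assumes X: "ringed X" and g: "morphism_at X GL_fspace x g" and h: "morphism_at X GL_fspace x h"
  shows "morphism_at X GL_fspace x (\<lambda>y. g y ** h y)"
proof (rule morphism_at_GL[OF X])
  show x: "x \<in> points X" using morphism_at_points[OF g] by simp
  show "regular_at X x (\<lambda>y. (g y ** h y) $ a $ b)" for a b
    unfolding matrix_matrix_mult_def vec_lambda_beta
    by (intro ringed.regular_at_sum[OF X x] ringed.regular_at_mult[OF X] regular_at_entry g h)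
  show "invertible (g x ** h x)"
    using morphism_at_points[OF g] morphism_at_points[OF h] by (simp add: invertible_mult)
qed

lemma morphism_at_GL_inv:
  assumes X: "ringed X" and g: "morphism_at X GL_fspace x g"
  shows "morphism_at X GL_fspace x (\<lambda>y. matrix_inv (g y))"
proof (rule morphism_at_GL[OF X])
  show x: "x \<in> points X" and "invertible (matrix_inv (g x))"
    using morphism_at_points[OF g] by simp_all
  show "regular_at X x (\<lambda>y. matrix_inv (g y) $ a $ b)" for a b
    by (rule regular_at_matrix_inv[OF X x regular_at_entry[OF g]])
       (use morphism_at_points[OF g] in simp)
qed

lemma morphism_at_id: "x \<in> points X \<Longrightarrow> morphism_at X X x (\<lambda>y. y)"
  by (simp add: morphism_at_def filterlim_iff)

lemma morphism_at_const:
  assumes X: "ringed X" and "x \<in> points X" "c \<in> points Y"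
  shows "morphism_at X Y x (\<lambda>_. c)"
  using assms eventually_nhdsin_self[of _ "ztop Y" c]
  by (auto simp: morphism_at_def filterlim_iff intro: ringed.regular_at_const[OF X]
      eventually_mono[OF eventually_True])

section \<open>Local sections over Grassmannians\<close>

lemma ringed_grassmannian: "ringed (grassmannian_fspace i)"
  by (simp add: grassmannian_fspace_def ringed_quotient ringed_GL)

lemma points_grassmannian: "points (grassmannian_fspace i) = {gflag g i | g. invertible g}"
  by (auto simp: grassmannian_fspace_def)

lemma morphism_at_gflag:
  assumes "morphism_at X GL_fspace x h"
  shows "morphism_at X (grassmannian_fspace i) x (\<lambda>y. gflag (h y) i)"
proof -
  have "morphism GL_fspace (grassmannian_fspace i) (\<lambda>g. gflag g i)"
    unfolding grassmannian_fspace_def by (rule morphism_quotient_proj)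
  thus ?thesis
    using morphism_at_points[OF assms]
    by (intro morphism_at_compose[OF assms] morphism_at_if_morphism) auto
qed

text \<open>
  The tautological bundle of a Grassmannian has a local section through every vector.  After moving
  \<open>W\<^sub>0\<close> to \<open>E\<^sub>i\<close> by \<open>g\<^sub>0\<inverse>\<close>, the subspaces near it are those that the projection onto the first \<open>i\<close>
  coordinates maps bijectively onto \<open>E\<^sub>i\<close>, and the section assigns to such a subspace its unique vector
  whose projection is that of the given vector.  This description depends on the subspace only, so
  it descends to the quotient; on \<open>g E\<^sub>i\<close> Cramer's rule for the upper left block \<open>D g\<close> of \<open>g\<^sub>0\<inverse> g\<close>
  shows that it is regular in \<open>g\<close>.
\<close>

lemma tautological_section:
  fixes W\<^sub>0 :: "'n::{finite,linorder} subspc"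
  assumes W0: "W\<^sub>0 \<in> points (grassmannian_fspace i)" and w0: "w\<^sub>0 \<in> W\<^sub>0"
  shows "\<exists>v. (\<forall>a. regular_at (grassmannian_fspace i) W\<^sub>0 (\<lambda>W. v W $ a)) \<and>
             (\<forall>\<^sub>F W in nhdsin (ztop (grassmannian_fspace i)) W\<^sub>0. v W \<in> W) \<and> v W\<^sub>0 = w\<^sub>0"
proof -
  let ?E = "coord_subspace i :: 'n subspc"
  obtain g0 :: "'n mat" where g0: "invertible g0" "W\<^sub>0 = gflag g0 i"
    using W0 by (auto simp: points_grassmannian)
  define u where "u = matrix_inv g0 *v w\<^sub>0"
  have u: "u \<in> ?E" using w0 g0 by (simp add: u_def mem_act_iff)
  \<comment> \<open>The block is completed by an identity block, so that its size does not depend on \<open>i\<close>.\<close>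
  define D where "D = (\<lambda>g. (\<chi> a b. if ix a \<le> i \<and> ix b \<le> i then (matrix_inv g0 ** g) $ a $ b
                              else mat 1 $ a $ b) :: 'n mat)"
  have D_out: "(D g *v x) $ a = x $ a" if "i < ix a" for g x a
    using that by (simp add: D_def matrix_vector_mult_def mat_def
        if_distrib[of "\<lambda>x. x * _"] cong: if_cong)
  have D_in: "(D g *v x) $ a = (matrix_inv g0 *v (g *v x)) $ a" if "ix a \<le> i" "x \<in> ?E" for g x a
  proof -
    have "D g $ a $ b * x $ b = (matrix_inv g0 ** g) $ a $ b * x $ b" for b
      using that by (cases "ix b \<le> i") (auto simp: D_def mem_coord_subspace)
    thus ?thesis unfolding matrix_vector_mul_assoc
      by (simp only: matrix_vector_mult_def vec_lambda_beta)
  qed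
  define v where "v = (\<lambda>W. THE w. w \<in> W \<and> (\<forall>a. ix a \<le> i \<longrightarrow> (matrix_inv g0 *v w) $ a = u $ a))"
  \<comment> \<open>The vectors of \<open>g E\<^sub>i\<close> with prescribed first coordinates, by solving \<open>D g x = t\<close>.\<close>
  have coords: "(w \<in> gflag g i \<and> (\<forall>a. ix a \<le> i \<longrightarrow> (matrix_inv g0 *v w) $ a = t $ a)) \<longleftrightarrow>
      w = g *v (matrix_inv (D g) *v t)"
    if g: "invertible g" and D: "det (D g) \<noteq> 0" and t: "t \<in> ?E" for g w t
  proof -
    have invD: "invertible (D g)" using D by (simp add: invertible_det_nz)
    define x where "x = matrix_inv (D g) *v t"
    have Dx: "D g *v x = t" using invD by (simp add: x_def)
    have xE: "x \<in> ?E" using D_out[of _ g x] t unfolding Dx by (simp add: mem_coord_subspace)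
    show ?thesis
    proof
      assume *: "w \<in> gflag g i \<and> (\<forall>a. ix a \<le> i \<longrightarrow> (matrix_inv g0 *v w) $ a = t $ a)"
      then obtain y where y: "y \<in> ?E" "w = g *v y" by (auto simp: act_def)
      have "(D g *v y) $ a = t $ a" for a
        using * y t D_out[of a g y] D_in[of a y g] by (cases "ix a \<le> i") (auto simp: mem_coord_subspace)
      hence "D g *v y = t" by (simp add: vec_eq_iff)
      hence "y = matrix_inv (D g) *v t" using invD by (metis matrix_inv_apply(1))
      thus "w = g *v (matrix_inv (D g) *v t)" using y by simp
    next
      assume "w = g *v (matrix_inv (D g) *v t)"
      thus "w \<in> gflag g i \<and> (\<forall>a. ix a \<le> i \<longrightarrow> (matrix_inv g0 *v w) $ a = t $ a)"
        using xE Dx D_in[of _ x g] by (auto simp: x_def[symmetric] act_def)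
    qed
  qed
  have v_gflag: "v (gflag g i) = g *v (matrix_inv (D g) *v u)"
    if "invertible g" "det (D g) \<noteq> 0" for g
    unfolding v_def coords[OF that u] by simp
  \<comment> \<open>The condition \<open>det (D g) \<noteq> 0\<close> must be seen to depend on \<open>g E\<^sub>i\<close> only: it says that no nonzero
    vector of the subspace projects to \<open>0\<close>.\<close>
  define U where "U = {W \<in> points (grassmannian_fspace i).
      \<forall>w\<in>W. (\<forall>a. ix a \<le> i \<longrightarrow> (matrix_inv g0 *v w) $ a = 0) \<longrightarrow> w = 0}"
  have U_iff: "gflag g i \<in> U \<longleftrightarrow> det (D g) \<noteq> 0" if g: "invertible g" for g
  proof
    assume U: "gflag g i \<in> U"
    have "x = 0" if x: "D g *v x = 0" for x
    proof -
      have xE: "x \<in> ?E" using D_out[of _ g x] x by (simp add: mem_coord_subspace)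
      hence "\<forall>a. ix a \<le> i \<longrightarrow> (matrix_inv g0 *v (g *v x)) $ a = 0"
        using D_in[of _ x g] x by simp
      hence "g *v x = 0" using U xE by (auto simp: U_def act_def)
      thus "x = 0" using matrix_inv_apply(1)[OF g, of x] by simp
    qed
    hence "invertible (D g)"
      unfolding invertible_left_inverse matrix_left_invertible_ker by blast
    thus "det (D g) \<noteq> 0" by (simp add: invertible_det_nz)
  next
    assume D: "det (D g) \<noteq> 0"
    have "gflag g i \<in> points (grassmannian_fspace i)" using g by (auto simp: points_grassmannian)
    thus "gflag g i \<in> U"
      using coords[OF g D, of 0] by (auto simp: U_def mem_coord_subspace)
  qed
  have pre: "{g \<in> points GL_fspace. gflag g i \<in> U} = {g. invertible g \<and> det (D g) \<noteq> 0}"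
    using U_iff by auto
  have entry: "regular_at GL_fspace g (\<lambda>g. g $ a $ b)" if "invertible g" for g :: "'n mat" and a b
    using that by (intro regular_at_entry morphism_at_id) simp
  have regD: "regular_at GL_fspace g (\<lambda>g. D g $ a $ b)" if g: "invertible g" for g a b
  proof (cases "ix a \<le> i \<and> ix b \<le> i")
    case True
    have "regular_at GL_fspace g (\<lambda>g. \<Sum>c\<in>UNIV. matrix_inv g0 $ a $ c * g $ c $ b)"
      using g by (intro ringed.regular_at_sum[OF ringed_GL] ringed.regular_at_mult[OF ringed_GL]
          ringed.regular_at_const[OF ringed_GL] entry) auto
    thus ?thesis using True by (simp add: D_def matrix_matrix_mult_def)
  next
    case False
    thus ?thesis using g by (auto simp: D_def intro!: ringed.regular_at_const[OF ringed_GL])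
  qed
  have detD: "\<forall>\<^sub>F h in nhdsin (ztop GL_fspace) g. h \<in> {g. invertible g \<and> det (D g) \<noteq> 0}"
    if g: "invertible g" "det (D g) \<noteq> 0" for g
  proof -
    have "\<forall>\<^sub>F h in nhdsin (ztop GL_fspace) g. det (D h) \<noteq> 0"
      using g by (intro ringed.regular_at_nonzero[OF ringed_GL] regular_at_det[OF ringed_GL] regD) auto
    moreover have "\<forall>\<^sub>F h in nhdsin (ztop GL_fspace) g. h \<in> points GL_fspace"
      by (rule morphism_at_eventually_points[OF morphism_at_id]) (use g in simp)
    ultimately show ?thesis by eventually_elim simp
  qed
  have openpre: "openin (ztop GL_fspace) {g. invertible g \<and> det (D g) \<noteq> 0}"
    by (rule openin_if_eventually) (use detD in auto)
  have openU: "openin (ztop (grassmannian_fspace i)) U"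
    using openpre unfolding grassmannian_fspace_def openin_quotient_fspace pre
    by (auto simp: U_def grassmannian_fspace_def)
  have "regular (grassmannian_fspace i) U (\<lambda>W. v W $ a)" for a
    unfolding grassmannian_fspace_def regular_quotient pre
  proof
    show "openin (ztop (quotient_fspace GL_fspace (\<lambda>g. gflag g i))) U"
      using openU by (simp add: grassmannian_fspace_def)
    show "regular GL_fspace {g. invertible g \<and> det (D g) \<noteq> 0} ((\<lambda>W. v W $ a) \<circ> (\<lambda>g. gflag g i))"
      unfolding ringed.regular_iff[OF ringed_GL]
    proof (intro conjI openpre ballI)
      fix g assume g: "g \<in> {g. invertible g \<and> det (D g) \<noteq> 0}"
      have "regular_at GL_fspace g (\<lambda>g. \<Sum>b\<in>UNIV. g $ a $ b *
          (\<Sum>c\<in>UNIV. matrix_inv (D g) $ b $ c * u $ c))"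
        using g by (intro ringed.regular_at_sum[OF ringed_GL] ringed.regular_at_mult[OF ringed_GL]
            ringed.regular_at_const[OF ringed_GL] entry regular_at_matrix_inv[OF ringed_GL] regD)
          (auto simp: invertible_det_nz)
      moreover have "\<forall>\<^sub>F g in nhdsin (ztop GL_fspace) g. (\<Sum>b\<in>UNIV. g $ a $ b *
          (\<Sum>c\<in>UNIV. matrix_inv (D g) $ b $ c * u $ c)) = v (gflag g i) $ a"
        using detD[of g] g by (auto elim!: eventually_mono simp: v_gflag matrix_vector_mult_def)
      ultimately show "regular_at GL_fspace g ((\<lambda>W. v W $ a) \<circ> (\<lambda>g. gflag g i))"
        unfolding o_def by (rule ringed.regular_at_cong[OF ringed_GL])
    qed
  qed
  moreover have D0: "D g0 = mat 1" using g0 by (simp add: D_def matrix_inv_inverse vec_eq_iff)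
  hence W0U: "W\<^sub>0 \<in> U" using U_iff g0 by simp
  moreover have "v W\<^sub>0 = w\<^sub>0" using v_gflag[OF g0(1)] g0 D0 by (simp add: u_def)
  moreover have "v W \<in> W" if W: "W \<in> U" for W
  proof -
    obtain g where g: "invertible g" "W = gflag g i"
      using W by (auto simp: U_def points_grassmannian)
    hence D: "det (D g) \<noteq> 0" using W U_iff by simp
    show ?thesis using coords[OF g(1) D u, of "v W"] v_gflag[OF g(1) D] g by blast
  qed
  ultimately show ?thesis
    using eventually_nhdsin_open[OF openU W0U]
    by (intro exI[of _ v]) (auto simp: regular_at_def elim: eventually_mono)
qed

lemma gflag_subset:
  assumes "vec.subspace V" "\<And>a. ix a \<le> i \<Longrightarrow> h *v axis a 1 \<in> V"
  shows "gflag h i \<subseteq> V"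
proof -
  have "vec.subspace {v. h *v v \<in> V}"
    using assms(1) by (auto simp: vec.subspace_def vec.add vec.scale)
  hence "coord_subspace i \<subseteq> {v. h *v v \<in> V}"
    unfolding coord_subspace_def by (intro vec.span_minimal) (use assms in auto)
  thus ?thesis by (auto simp: act_def)
qed

text \<open>
  A regular family \<open>W\<close> of partial flags, with members in the dimensions \<open>J\<close>, is locally the family of
  flags of a regular family of matrices.  Choose a matrix for the flag at \<open>x\<close>.  Each of its columns
  extends to a regular section of the smallest member that contains it.  The matrix with these
  columns is still invertible near \<open>x\<close>, and it maps each coordinate subspace into, hence by
  dimension onto, the member of the flag.  The cases used are one single dimension and all
  dimensions, that is, local sections of the quotient maps to Grassmannians and to \<open>G/B\<close>.
\<close>

lemma local_flag_lift:
  fixes W :: "nat \<Rightarrow> 'x \<Rightarrow> 'n::{finite,linorder} subspc"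
  assumes X: "ringed X" and x: "x \<in> points X" and J: "J \<subseteq> {..CARD('n)}"
    and W: "\<And>i. i \<in> J \<Longrightarrow> morphism_at X (grassmannian_fspace i) x (W i)"
    and flag: "\<forall>\<^sub>F y in nhdsin (ztop X) x. \<exists>g. invertible g \<and> (\<forall>i\<in>J. W i y = gflag g i)"
  shows "\<exists>h. morphism_at X GL_fspace x h \<and>
             (\<forall>\<^sub>F y in nhdsin (ztop X) x. invertible (h y) \<and> (\<forall>i\<in>J. gflag (h y) i = W i y))"
proof -
  let ?n = "CARD('n)"
  \<comment> \<open>The dimension of the smallest member that contains the column \<open>a\<close>, or \<open>n\<close> for the whole space.\<close>
  define idx where "idx a = (LEAST i. i \<in> insert ?n J \<and> ix a \<le> i)" for a :: 'n
  define W' where "W' i y = (if i \<in> J then W i y else UNIV)" for i y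
  have idx: "idx a \<in> insert ?n J" "ix a \<le> idx a" for a :: 'n
    using LeastI[of "\<lambda>i. i \<in> insert ?n J \<and> ix a \<le> i" ?n] ix_bounds(2)[of a]
    by (auto simp: idx_def)
  have idx_le: "idx a \<le> i" if "i \<in> J" "ix a \<le> i" for a i
    unfolding idx_def using that by (intro Least_le) auto
  have W': "morphism_at X (grassmannian_fspace i) x (W' i)" if "i \<in> insert ?n J" for i
  proof (cases "i \<in> J")
    case True
    thus ?thesis using W by (simp add: W'_def[abs_def])
  next
    case False
    have "UNIV \<in> points (grassmannian_fspace ?n :: 'n subspc fspace)"
      unfolding points_grassmannian by (auto intro!: exI[of _ "mat 1"])
    thus ?thesis using False that morphism_at_const[OF X x] by (simp add: W'_def[abs_def])
  qed
  obtain g0 :: "'n mat" where g0: "invertible g0" "\<And>i. i \<in> J \<Longrightarrow> W i x = gflag g0 i"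
    using eventually_nhdsin_self[OF flag x] by blast
  have "\<exists>v. (\<forall>b. regular_at X x (\<lambda>y. v y $ b)) \<and>
      (\<forall>\<^sub>F y in nhdsin (ztop X) x. v y \<in> W' (idx a) y) \<and> v x = g0 *v axis a 1" for a
  proof -
    have "axis a 1 \<in> (coord_subspace (idx a) :: 'n subspc)"
      using idx(2)[of a] by (auto simp: mem_coord_subspace axis_def)
    hence "g0 *v axis a 1 \<in> W' (idx a) x"
      using g0 by (auto simp: W'_def act_def)
    then obtain v where v:
      "\<And>b. regular_at (grassmannian_fspace (idx a)) (W' (idx a) x) (\<lambda>V. v V $ b)"
      "\<forall>\<^sub>F V in nhdsin (ztop (grassmannian_fspace (idx a))) (W' (idx a) x). v V \<in> V"
      "v (W' (idx a) x) = g0 *v axis a 1"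
      using tautological_section[of "W' (idx a) x" "idx a" "g0 *v axis a 1"]
        morphism_at_points[OF W'[OF idx(1)[of a]]] by blast
    show ?thesis
      using v(3) morphism_at_regular[OF W'[OF idx(1)] v(1)]
        morphism_at_eventually[OF W'[OF idx(1)] v(2)]
      by (intro exI[of _ "\<lambda>y. v (W' (idx a) y)"] conjI allI)
  qed
  hence "\<forall>a. \<exists>v. (\<forall>b. regular_at X x (\<lambda>y. v y $ b)) \<and>
      (\<forall>\<^sub>F y in nhdsin (ztop X) x. v y \<in> W' (idx a) y) \<and> v x = g0 *v axis a 1"
    by blast
  from choice[OF this] obtain v where v: "\<And>a b. regular_at X x (\<lambda>y. v a y $ b)"
      "\<And>a. \<forall>\<^sub>F y in nhdsin (ztop X) x. v a y \<in> W' (idx a) y" "\<And>a. v a x = g0 *v axis a 1"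
    by blast
  define h where "h y = (\<chi> b a. v a y $ b)" for y
  have col: "h y *v axis a 1 = v a y" for y a
    by (simp add: h_def vec_eq_iff matrix_vector_mult_def axis_def if_distrib cong: if_cong)
  have "h x = g0"
    by (simp add: h_def v(3) vec_eq_iff matrix_vector_mult_def axis_def if_distrib cong: if_cong)
  hence h: "morphism_at X GL_fspace x h"
    using g0 v(1) by (intro morphism_at_GL[OF X x]) (simp_all add: h_def)
  have "\<forall>\<^sub>F y in nhdsin (ztop X) x. \<forall>a\<in>UNIV. v a y \<in> W' (idx a) y"
    by (intro eventually_ball_finite) (simp_all add: v(2))
  with flag morphism_at_eventually_points[OF h]
  have "\<forall>\<^sub>F y in nhdsin (ztop X) x. invertible (h y) \<and> (\<forall>i\<in>J. gflag (h y) i = W i y)"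
  proof eventually_elim
    case (elim y)
    then obtain g where g: "invertible g" "\<And>i. i \<in> J \<Longrightarrow> W i y = gflag g i" by blast
    have inv: "invertible (h y)" using elim by simp
    have "gflag (h y) i = gflag g i" if i: "i \<in> J" for i
    proof (rule act_eq_if_subset[OF inv])
      show "gflag (h y) i \<subseteq> gflag g i"
      proof (rule gflag_subset)
        fix a :: 'n assume a: "ix a \<le> i"
        have "h y *v axis a 1 \<in> W' (idx a) y" using elim by (simp add: col)
        also have "\<dots> = gflag g (idx a)" using g idx(1)[of a] by (auto simp: W'_def)
        also have "\<dots> \<subseteq> gflag g i" by (intro act_mono coord_subspace_mono idx_le i a)
        finally show "h y *v axis a 1 \<in> gflag g i" .
      qed (simp add: subspace_act)
    qed (use g in \<open>simp_all add: subspace_act dim_act\<close>)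
    thus ?case using inv g by simp
  qed
  with h show ?thesis by blast
qed

text \<open>
  Near each point \<open>W\<close> is \<open>h E\<^sub>j\<close> for a regular \<open>h\<close>, and then the result is the flag member of the
  product \<open>g h\<close>.
\<close>

lemma morphism_at_act:
  fixes W :: "'x \<Rightarrow> 'n::{finite,linorder} subspc"
  assumes X: "ringed X" and j: "j \<le> CARD('n)"
    and g: "morphism_at X GL_fspace x g" and W: "morphism_at X (grassmannian_fspace j) x W"
  shows "morphism_at X (grassmannian_fspace j) x (\<lambda>y. act (g y) (W y))"
proof -
  have x: "x \<in> points X" using morphism_at_points[OF g] by simp
  have "\<exists>h. morphism_at X GL_fspace x h \<and>
      (\<forall>\<^sub>F y in nhdsin (ztop X) x. invertible (h y) \<and> (\<forall>i\<in>{j}. gflag (h y) i = W y))"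
    by (rule local_flag_lift[OF X x])
       (use j W morphism_at_eventually_points[OF W]
         in \<open>auto simp: points_grassmannian elim!: eventually_mono\<close>)
  then obtain h where h: "morphism_at X GL_fspace x h" and
    "\<forall>\<^sub>F y in nhdsin (ztop X) x. invertible (h y) \<and> (\<forall>i\<in>{j}. gflag (h y) i = W y)"
    by blast
  hence hW: "\<forall>\<^sub>F y in nhdsin (ztop X) x. gflag (h y) j = W y"
    by (auto elim!: eventually_mono)
  have "morphism_at X (grassmannian_fspace j) x (\<lambda>y. gflag (g y ** h y) j)"
    by (intro morphism_at_gflag morphism_at_GL_mult X g h)
  moreover have "\<forall>\<^sub>F y in nhdsin (ztop X) x. gflag (g y ** h y) j = act (g y) (W y)"
    using hW by eventually_elim (simp add: act_mult)
  ultimately show ?thesis by (rule morphism_at_cong[OF X])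
qed


section \<open>Galleries of matrices\<close>

text \<open>
  Representatives \<open>h\<^sub>0, \<dots>, h\<^sub>N\<close> of the points of the Barbasch--Evens--Magyar variety; the right border
  \<open>R\<^sup>(\<^sup>N\<^sup>+\<^sup>1\<^sup>-\<^sup>k\<^sup>)\<close> of the corresponding configuration is the flag of \<open>h\<^sub>k\<close>.
\<close>

definition gallery :: "'n::{finite,linorder} mat set set \<Rightarrow> nat list \<Rightarrow> 'n mat list \<Rightarrow> bool" where
  "gallery Y Q hs \<longleftrightarrow> length hs = Suc (length Q) \<and> (\<forall>k\<le>length Q. invertible (hs ! k)) \<and>
     hs ! 0 <#\<^bsub>GL\<^esub> borel_subgroup \<in> Y \<and>
     (\<forall>k<length Q. \<forall>i. i \<noteq> rev Q ! k \<longrightarrow> gflag (hs ! Suc k) i = gflag (hs ! k) i)"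

definition gallery_config :: "nat list \<Rightarrow> 'n::{finite,linorder} mat list \<Rightarrow> 'n subspc list" where
  "gallery_config Q hs = map (gflag (hs ! 0)) [1..<CARD('n)] @
     map (\<lambda>k. gflag (hs ! Suc k) (rev Q ! k)) [0..<length Q]"

lemma valid_nth:
  assumes "set Q \<subseteq> {1..<n}" "k < length Q"
  shows "1 \<le> rev Q ! k" "rev Q ! k < n"
  using assms nth_mem[of k "rev Q"] by auto

subsection \<open>Configurations come from galleries\<close>

lemma ex_length_Suc:
  "(\<exists>h hs. Suc (length hs) = Suc m \<and> P (h # hs)) \<longleftrightarrow> (\<exists>hs. length hs = Suc m \<and> P hs)"
  by (metis length_Cons length_Suc_conv)

text \<open>
  If the border is the flag of \<open>g\<close>, then \<open>g\<inverse>\<close> moves the condition on the next subspace \<open>V\<close> to the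
  coordinate flag, where \<open>P\<^sub>j\<close> acts transitively, so that \<open>V = g p E\<^sub>j\<close> and \<open>g p\<close> represents the
  new border.
\<close>

lemma fits_iff:
  fixes g :: "'n::{finite,linorder} mat"
  assumes "set js \<subseteq> {1..<CARD('n)}" "invertible g"
  shows "fits (map (gflag g) [0..<Suc CARD('n)]) js Vs \<longleftrightarrow>
    (\<exists>hs. length hs = length js \<and>
       (\<forall>k<length js. invertible (hs ! k) \<and>
          (\<forall>i. i \<noteq> js ! k \<longrightarrow> gflag (hs ! k) i = gflag ((g # hs) ! k) i)) \<and>
       Vs = map (\<lambda>k. gflag (hs ! k) (js ! k)) [0..<length js])"
  using assms
proof (induction js arbitrary: g Vs)
  case Nil
  thus ?case by (cases Vs) auto
next
  case (Cons j js)
  let ?n = "CARD('n)"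
  have j: "1 \<le> j" "j < ?n" and js: "set js \<subseteq> {1..<?n}" and g: "invertible g"
    using Cons.prems by auto
  have border: "(map (gflag g) [0..<Suc ?n])[j := gflag h j] = map (gflag h) [0..<Suc ?n]"
    if "\<And>i. i \<noteq> j \<Longrightarrow> gflag h i = gflag g i" for h
  proof (rule nth_equalityI)
    fix i assume "i < length ((map (gflag g) [0..<Suc ?n])[j := gflag h j])"
    thus "(map (gflag g) [0..<Suc ?n])[j := gflag h j] ! i = map (gflag h) [0..<Suc ?n] ! i"
      using that[of i] by (cases "i = j") (simp_all add: nth_list_update del: upt_Suc)
  qed simp
  have nth: "map (gflag g) [0..<Suc ?n] ! i = gflag g i" if "i \<le> ?n" for i
    using that by (simp del: upt_Suc)
  have step: "vec.subspace V \<and> vec.dim V = j \<and> gflag g (j - 1) \<subseteq> V \<and> V \<subseteq> gflag g (j + 1) \<longleftrightarrow>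
      (\<exists>h. invertible h \<and> (\<forall>i. i \<noteq> j \<longrightarrow> gflag h i = gflag g i) \<and> V = gflag h j)" for V
  proof
    assume V: "vec.subspace V \<and> vec.dim V = j \<and> gflag g (j - 1) \<subseteq> V \<and> V \<subseteq> gflag g (j + 1)"
    have "\<exists>p\<in>minimal_parabolic j. gflag p j = act (matrix_inv g) V"
      using V g by (intro minimal_parabolic_transitive[OF j])
        (simp_all add: subspace_act dim_act act_inv_subset_iff subset_act_inv_iff)
    then obtain p where p: "p \<in> minimal_parabolic j" "gflag p j = act (matrix_inv g) V" by blast
    thus "\<exists>h. invertible h \<and> (\<forall>i. i \<noteq> j \<longrightarrow> gflag h i = gflag g i) \<and> V = gflag h j"
      using g by (intro exI[of _ "g ** p"])
        (simp add: minimal_parabolic_iff[OF j] act_mult invertible_mult)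
  next
    assume "\<exists>h. invertible h \<and> (\<forall>i. i \<noteq> j \<longrightarrow> gflag h i = gflag g i) \<and> V = gflag h j"
    then obtain h where h: "invertible h" "\<And>i. i \<noteq> j \<Longrightarrow> gflag h i = gflag g i" "V = gflag h j"
      by blast
    have "gflag g (j - 1) = gflag h (j - 1)" "gflag g (j + 1) = gflag h (j + 1)"
      using h j by simp_all
    thus "vec.subspace V \<and> vec.dim V = j \<and> gflag g (j - 1) \<subseteq> V \<and> V \<subseteq> gflag g (j + 1)"
      using h j act_mono[OF coord_subspace_mono[of "j - 1" j], of h]
        act_mono[OF coord_subspace_mono[of j "j + 1"], of h]
      by (simp add: subspace_act dim_act dim_coord_subspace)
  qed
  show ?case
  proof (cases Vs)
    case Nil
    thus ?thesis by (auto simp del: upt_Suc simp: upt_conv_Cons)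
  next
    case (Cons V Vs')
    let ?R = "map (gflag g) [0..<Suc ?n]"
    have "fits ?R (j # js) Vs \<longleftrightarrow>
        (vec.subspace V \<and> vec.dim V = j \<and> gflag g (j - 1) \<subseteq> V \<and> V \<subseteq> gflag g (j + 1)) \<and>
        fits (?R[j := V]) js Vs'"
      unfolding Cons fits.simps using nth[of "j - 1"] nth[of "j + 1"] j by (simp only:) auto
    also have "\<dots> \<longleftrightarrow> (\<exists>h. invertible h \<and> (\<forall>i. i \<noteq> j \<longrightarrow> gflag h i = gflag g i) \<and> V = gflag h j \<and>
        fits (map (gflag h) [0..<Suc ?n]) js Vs')"
      (is "?l \<longleftrightarrow> ?r")
    proof
      assume ?l
      then obtain h where h: "invertible h" "\<And>i. i \<noteq> j \<Longrightarrow> gflag h i = gflag g i" "V = gflag h j"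
        and f: "fits (?R[j := V]) js Vs'" unfolding step by blast
      have "fits (map (gflag h) [0..<Suc ?n]) js Vs'" using f border[OF h(2)] h(3) by simp
      thus ?r using h by blast
    next
      assume ?r
      then obtain h where h: "invertible h" "\<And>i. i \<noteq> j \<Longrightarrow> gflag h i = gflag g i" "V = gflag h j"
        and f: "fits (map (gflag h) [0..<Suc ?n]) js Vs'" by blast
      have "fits (?R[j := V]) js Vs'" using f border[OF h(2)] h(3) by simp
      thus ?l unfolding step using h by blast
    qed
    also have "\<dots> \<longleftrightarrow> (\<exists>h hs. invertible h \<and> (\<forall>i. i \<noteq> j \<longrightarrow> gflag h i = gflag g i) \<and> V = gflag h j \<and>
        length hs = length js \<and>
       (\<forall>k<length js. invertible (hs ! k) \<and>
          (\<forall>i. i \<noteq> js ! k \<longrightarrow> gflag (hs ! k) i = gflag ((h # hs) ! k) i)) \<and>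
       Vs' = map (\<lambda>k. gflag (hs ! k) (js ! k)) [0..<length js])"
      using Cons.IH[OF js] by blast
    also have "\<dots> \<longleftrightarrow> (\<exists>h hs. length (h # hs) = length (j # js) \<and>
       (\<forall>k<length (j # js). invertible ((h # hs) ! k) \<and>
          (\<forall>i. i \<noteq> (j # js) ! k \<longrightarrow> gflag ((h # hs) ! k) i = gflag ((g # h # hs) ! k) i)) \<and>
       Vs = map (\<lambda>k. gflag ((h # hs) ! k) ((j # js) ! k)) [0..<length (j # js)])"
      unfolding length_Cons All_less_Suc2 map_upt_Suc Cons by auto
    also have "\<dots> \<longleftrightarrow> (\<exists>hs. length hs = length (j # js) \<and>
       (\<forall>k<length (j # js). invertible (hs ! k) \<and>
          (\<forall>i. i \<noteq> (j # js) ! k \<longrightarrow> gflag (hs ! k) i = gflag ((g # hs) ! k) i)) \<and>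
       Vs = map (\<lambda>k. gflag (hs ! k) ((j # js) ! k)) [0..<length (j # js)])"
      using ex_length_Suc[of "length js"] unfolding length_Cons .
    finally show ?thesis .
  qed
qed

lemma border_gflag:
  fixes g :: "'n::{finite,linorder} mat"
  assumes "invertible g"
  shows "{0} # map (gflag g) [1..<CARD('n)] @ [UNIV] = map (gflag g) [0..<Suc CARD('n)]"
proof -
  have "[0..<Suc CARD('n)] = 0 # [1..<CARD('n)] @ [CARD('n)]"
    using upt_conv_Cons[of 0 "CARD('n)"] by simp
  thus ?thesis using assms by (simp del: upt_Suc)
qed

lemma configuration_space_eq:
  fixes Y :: "'n::{finite,linorder} mat set set"
  assumes Y: "Y \<subseteq> flag_variety" and Q: "set Q \<subseteq> {1..<CARD('n)}"
  shows "configuration_space Q (coset_to_flag ` Y) = gallery_config Q ` {hs. gallery Y Q hs}"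
proof (intro equalityI subsetI)
  fix y assume "y \<in> configuration_space Q (coset_to_flag ` Y)"
  then obtain c Vs where c: "c \<in> Y" "y = coset_to_flag c @ Vs"
      "fits ({0} # coset_to_flag c @ [UNIV]) (rev Q) Vs"
    by (auto simp: configuration_space_def)
  obtain g where g: "invertible g" "c = g <#\<^bsub>GL\<^esub> borel_subgroup"
    using c(1) Y by (auto simp: LCOSETS_def)
  have "fits (map (gflag g) [0..<Suc CARD('n)]) (rev Q) Vs"
    using c(3) by (simp only: g coset_to_flag_borel border_gflag)
  then obtain hs where hs: "length hs = length Q"
      "\<forall>k<length Q. invertible (hs ! k) \<and>
         (\<forall>i. i \<noteq> rev Q ! k \<longrightarrow> gflag (hs ! k) i = gflag ((g # hs) ! k) i)"
      "Vs = map (\<lambda>k. gflag (hs ! k) (rev Q ! k)) [0..<length Q]"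
    using Q g by (subst (asm) fits_iff) auto
  have "gallery Y Q (g # hs)"
    using hs g c(1) by (auto simp: gallery_def nth_Cons split: nat.split)
  moreover have "y = gallery_config Q (g # hs)"
    using c(2) hs(3) g by (simp add: gallery_config_def coset_to_flag_borel)
  ultimately show "y \<in> gallery_config Q ` {hs. gallery Y Q hs}" by blast
next
  fix y assume "y \<in> gallery_config Q ` {hs. gallery Y Q hs}"
  then obtain hs where hs: "gallery Y Q hs" "y = gallery_config Q hs" by blast
  obtain g hs' where gh: "hs = g # hs'" using hs(1) by (cases hs) (auto simp: gallery_def)
  have g: "invertible g" using hs(1) gh by (auto simp: gallery_def)
  have "invertible (hs' ! k)" if "k < length Q" for k
  proof -
    have "invertible (hs ! Suc k)" using hs(1) that by (simp add: gallery_def)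
    thus ?thesis by (simp add: gh)
  qed
  note inv = this
  let ?Vs = "map (\<lambda>k. gflag (hs' ! k) (rev Q ! k)) [0..<length Q]"
  have "fits (map (gflag g) [0..<Suc CARD('n)]) (rev Q) ?Vs"
    using hs(1) Q by (subst fits_iff[OF _ g]) (auto simp: gallery_def gh inv intro!: exI[of _ hs'])
  hence "fits ({0} # coset_to_flag (g <#\<^bsub>GL\<^esub> borel_subgroup) @ [UNIV]) (rev Q) ?Vs"
    by (simp only: g coset_to_flag_borel border_gflag)
  moreover have "g <#\<^bsub>GL\<^esub> borel_subgroup \<in> Y" using hs(1) by (simp add: gallery_def gh)
  moreover have "y = coset_to_flag (g <#\<^bsub>GL\<^esub> borel_subgroup) @ ?Vs"
    using hs(2) g by (simp add: gallery_config_def gh coset_to_flag_borel)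
  ultimately show "y \<in> configuration_space Q (coset_to_flag ` Y)"
    unfolding configuration_space_def by blast
qed

subsection \<open>The image of delta\<close>

lemma BEM_eq:
  fixes Y :: "'n::{finite,linorder} mat set set"
  assumes Y: "Y \<subseteq> flag_variety" and Q: "set Q \<subseteq> {1..<CARD('n)}"
  shows "BEM Y Q = map (\<lambda>h. h <#\<^bsub>GL\<^esub> borel_subgroup) ` {hs. gallery Y Q hs}"
proof (intro equalityI subsetI)
  fix xs assume xs: "xs \<in> BEM Y Q"
  hence len: "length xs = Suc (length Q)" by (simp add: BEM_def)
  have "xs ! k \<in> flag_variety" if "k \<le> length Q" for k
  proof (cases k)
    case 0
    thus ?thesis using xs Y by (auto simp: BEM_def)
  next
    case (Suc l)
    hence "xs ! k = tl xs ! l" "l < length (tl xs)" using len that by (simp_all add: nth_tl)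
    thus ?thesis using xs nth_mem[of l "tl xs"] by (auto simp: BEM_def)
  qed
  hence "\<forall>k. \<exists>h. k \<le> length Q \<longrightarrow> invertible h \<and> xs ! k = h <#\<^bsub>GL\<^esub> borel_subgroup"
    by (force simp: LCOSETS_def)
  then obtain h where h: "\<And>k. k \<le> length Q \<Longrightarrow> invertible (h k)"
      "\<And>k. k \<le> length Q \<Longrightarrow> xs ! k = h k <#\<^bsub>GL\<^esub> borel_subgroup" by metis
  define hs where "hs = map h [0..<Suc (length Q)]"
  have hs: "hs ! k = h k" if "k \<le> length Q" for k
    using that by (simp add: hs_def nth_append del: upt_Suc)
  have "gflag (h (Suc k)) i = gflag (h k) i" if k: "k < length Q" "i \<noteq> rev Q ! k" for k i
  proof -
    have "xs ! k <#>\<^bsub>GL\<^esub> minimal_parabolic (rev Q ! k) =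
        xs ! Suc k <#>\<^bsub>GL\<^esub> minimal_parabolic (rev Q ! k)"
      using xs k by (simp add: BEM_def)
    hence "{g. invertible g \<and> (\<forall>i. i \<noteq> rev Q ! k \<longrightarrow> gflag g i = gflag (h k) i)} =
        {g. invertible g \<and> (\<forall>i. i \<noteq> rev Q ! k \<longrightarrow> gflag g i = gflag (h (Suc k)) i)}"
      using h k by (simp add: coset_minimal_parabolic[OF _ valid_nth[OF Q]])
    moreover have "h k \<in> {g. invertible g \<and> (\<forall>i. i \<noteq> rev Q ! k \<longrightarrow> gflag g i = gflag (h k) i)}"
      using h(1)[of k] k by simp
    ultimately have "h k \<in> {g. invertible g \<and> (\<forall>i. i \<noteq> rev Q ! k \<longrightarrow> gflag g i = gflag (h (Suc k)) i)}"
      by (rule subst)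
    thus ?thesis using k by simp
  qed
  moreover have "h 0 <#\<^bsub>GL\<^esub> borel_subgroup \<in> Y" using xs h(2)[of 0] by (simp add: BEM_def)
  ultimately have "gallery Y Q hs"
    unfolding gallery_def using h hs by (simp add: hs_def del: upt_Suc)
  moreover have "xs = map (\<lambda>h. h <#\<^bsub>GL\<^esub> borel_subgroup) hs"
    using len h hs by (intro nth_equalityI) (simp_all add: hs_def del: upt_Suc)
  ultimately show "xs \<in> map (\<lambda>h. h <#\<^bsub>GL\<^esub> borel_subgroup) ` {hs. gallery Y Q hs}" by blast
next
  fix xs assume "xs \<in> map (\<lambda>h. h <#\<^bsub>GL\<^esub> borel_subgroup) ` {hs. gallery Y Q hs}"
  then obtain hs where hs: "gallery Y Q hs" "xs = map (\<lambda>h. h <#\<^bsub>GL\<^esub> borel_subgroup) hs" by blast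
  have len: "length hs = Suc (length Q)" and inv: "\<And>k. k \<le> length Q \<Longrightarrow> invertible (hs ! k)"
    using hs by (auto simp: gallery_def)
  have "h <#\<^bsub>GL\<^esub> borel_subgroup \<in> flag_variety" if h: "h \<in> set (tl hs)" for h
  proof -
    have "h \<in> set hs" using h by (cases hs) auto
    hence "h \<in> carrier GL" using len inv by (auto simp: in_set_conv_nth less_Suc_eq_le)
    thus ?thesis by (auto simp: LCOSETS_def simp del: carrier_GL)
  qed
  hence "set (tl xs) \<subseteq> flag_variety" by (auto simp: hs(2) map_tl[symmetric])
  moreover have "xs ! k <#>\<^bsub>GL\<^esub> minimal_parabolic (rev Q ! k) =
        xs ! (k + 1) <#>\<^bsub>GL\<^esub> minimal_parabolic (rev Q ! k)" if "k < length Q" for k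
    using that hs(1) len inv by (auto simp: hs(2) coset_minimal_parabolic[OF _ valid_nth[OF Q]] gallery_def)
  ultimately show "xs \<in> BEM Y Q"
    using hs len by (auto simp: BEM_def gallery_def)
qed

lemma delta_gallery:
  fixes hs :: "'n::{finite,linorder} mat list"
  assumes "gallery Y Q hs"
  shows "cosets_to_subspaces Q (delta Q (map (\<lambda>h. h <#\<^bsub>GL\<^esub> borel_subgroup) hs)) = gallery_config Q hs"
proof -
  have inv: "\<And>k. k \<le> length Q \<Longrightarrow> invertible (hs ! k)" and len: "length hs = Suc (length Q)"
    using assms by (auto simp: gallery_def)
  show ?thesis
    by (rule nth_equalityI)
       (use inv len in \<open>auto simp: cosets_to_subspaces_def delta_def dims_def gallery_config_def
          nth_append coset_to_subspace_maximal simp del: upt_Suc\<close>)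
qed

subsection \<open>The points of the Barbasch--Evens variety\<close>

text \<open>
  The list \<open>mat 1 # hs\<close> shifts the indices by one, so the entries are \<open>h\<^sub>0\<close> and the
  quotients of consecutive matrices.  For the empty word this is \<open>([], h\<^sub>0 B)\<close>.
\<close>

definition gallery_BE ::
    "nat list \<Rightarrow> 'n::{finite,linorder} mat list \<Rightarrow> 'n mat list \<times> 'n mat set" where
  "gallery_BE Q hs =
     (map (\<lambda>i. matrix_inv ((mat 1 # hs) ! i) ** hs ! i) [0..<length Q],
      (matrix_inv ((mat 1 # hs) ! length Q) ** hs ! length Q) <#\<^bsub>GL\<^esub> borel_subgroup)"

definition BE_factor :: "'n::{finite,linorder} mat set set \<Rightarrow> nat list \<Rightarrow> nat \<Rightarrow> 'n mat set" where
  "BE_factor Y Q k = (preimage Y # map minimal_parabolic (rev Q)) ! k"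

lemma BE_factors_nth:
  "k \<le> length Q \<Longrightarrow> BE_factors Y Q ! k = sub_fspace GL_fspace (BE_factor Y Q k)"
  unfolding BE_factors_def BE_factor_def by (subst nth_map) auto

lemma length_BE_factors: "length (BE_factors Y Q) = Suc (length Q)"
  by (simp add: BE_factors_def)

lemma last_BE_factors: "last (BE_factors Y Q) = sub_fspace GL_fspace (BE_factor Y Q (length Q))"
  using length_BE_factors[of Y Q] BE_factors_nth[of "length Q" Q Y]
  by (subst last_conv_nth) auto

lemma butlast_BE_factors_nth:
  "k < length Q \<Longrightarrow> butlast (BE_factors Y Q) ! k = sub_fspace GL_fspace (BE_factor Y Q k)"
  by (simp add: nth_butlast length_BE_factors BE_factors_nth)

lemma points_BE_total:
  "points (BE_total Y Q) = {(gs, c). length gs = length Q \<and>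
     (\<forall>i<length Q. invertible (gs ! i) \<and> gs ! i \<in> BE_factor Y Q i) \<and>
     (\<exists>p. invertible p \<and> p \<in> BE_factor Y Q (length Q) \<and> c = p <#\<^bsub>GL\<^esub> borel_subgroup)}"
  unfolding BE_total_def points_pair points_list points_quotient last_BE_factors
  by (auto simp: butlast_BE_factors_nth length_BE_factors)

lemma gallery_BE_factor:
  fixes Y :: "'n::{finite,linorder} mat set set"
  assumes Q: "set Q \<subseteq> {1..<CARD('n)}" and hs: "gallery Y Q hs" and k: "k \<le> length Q"
  shows "invertible (matrix_inv ((mat 1 # hs) ! k) ** hs ! k)"
    and "matrix_inv ((mat 1 # hs) ! k) ** hs ! k \<in> BE_factor Y Q k"
proof -
  have inv: "\<And>k. k \<le> length Q \<Longrightarrow> invertible (hs ! k)" using hs by (auto simp: gallery_def)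
  have "invertible (matrix_inv ((mat 1 # hs) ! k) ** hs ! k) \<and>
      matrix_inv ((mat 1 # hs) ! k) ** hs ! k \<in> BE_factor Y Q k"
  proof (cases k)
    case 0
    thus ?thesis using hs inv[of 0] by (simp add: BE_factor_def preimage_def gallery_def)
  next
    case (Suc l)
    have "matrix_inv (hs ! l) ** hs ! Suc l \<in> minimal_parabolic (rev Q ! l)"
      using hs inv[of l] inv[of "Suc l"] Suc k
      by (simp add: minimal_parabolic_iff[OF valid_nth[OF Q]] gallery_def act_mult invertible_mult)
    thus ?thesis using Suc k inv[of l] inv[of "Suc l"] by (simp add: BE_factor_def invertible_mult)
  qed
  thus "invertible (matrix_inv ((mat 1 # hs) ! k) ** hs ! k)"
    "matrix_inv ((mat 1 # hs) ! k) ** hs ! k \<in> BE_factor Y Q k" by auto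
qed

text \<open>
  Partial products recover the matrices of a gallery from the consecutive quotients.
\<close>

primrec mprod :: "'n::finite mat list \<Rightarrow> nat \<Rightarrow> 'n mat" where
  "mprod gs 0 = mat 1"
| "mprod gs (Suc k) = mprod gs k ** gs ! k"

lemma mprod_gallery_BE:
  assumes "\<And>k. k \<le> length Q \<Longrightarrow> invertible (hs ! k)" "k \<le> length Q"
  shows "mprod (fst (gallery_BE Q hs)) k = (mat 1 # hs) ! k"
  using assms(2)
proof (induction k)
  case (Suc k)
  have "invertible ((mat 1 # hs) ! k)"
    using assms(1)[of "k - 1"] Suc.prems by (cases k) auto
  thus ?case using Suc by (simp add: gallery_BE_def)
qed simp

lemma points_BE_total_gallery:
  fixes Y :: "'n::{finite,linorder} mat set set"
  assumes Q: "set Q \<subseteq> {1..<CARD('n)}"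
  shows "points (BE_total Y Q) = gallery_BE Q ` {hs. gallery Y Q hs}"
proof (intro equalityI subsetI)
  fix z assume "z \<in> points (BE_total Y Q)"
  then obtain gs p where z: "z = (gs, p <#\<^bsub>GL\<^esub> borel_subgroup)" and len: "length gs = length Q"
    and gs: "\<And>i. i < length Q \<Longrightarrow> invertible (gs ! i) \<and> gs ! i \<in> BE_factor Y Q i"
    and p: "invertible p" "p \<in> BE_factor Y Q (length Q)"
    by (auto simp: points_BE_total)
  define ps where "ps = gs @ [p]"
  have ps: "invertible (ps ! k)" "ps ! k \<in> BE_factor Y Q k" if "k \<le> length Q" for k
    using that gs[of k] p len by (cases "k = length Q"; simp add: ps_def nth_append)+
  have inv: "invertible (mprod ps k)" if "k \<le> Suc (length Q)" for k
    using that by (induction k) (simp_all add: invertible_mult ps)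
  define hs where "hs = map (\<lambda>k. mprod ps (Suc k)) [0..<Suc (length Q)]"
  have hs: "hs ! k = mprod ps (Suc k)" if "k \<le> length Q" for k
    using that unfolding hs_def by (subst nth_map) (auto simp del: upt_Suc)
  have hs1: "(mat 1 # hs) ! k = mprod ps k" if "k \<le> Suc (length Q)" for k
    using that hs[of "k - 1"] by (cases k) auto
  have "gflag (hs ! Suc k) i = gflag (hs ! k) i" if "k < length Q" "i \<noteq> rev Q ! k" for k i
    using that ps(2)[of "Suc k"] by (simp add: hs act_mult BE_factor_def minimal_parabolic_iff[OF valid_nth[OF Q]])
  moreover have "hs ! 0 <#\<^bsub>GL\<^esub> borel_subgroup \<in> Y"
    using ps(2)[of 0] by (simp add: hs BE_factor_def preimage_def)
  moreover have "length hs = Suc (length Q)" by (simp add: hs_def)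
  ultimately have "gallery Y Q hs" using inv by (simp add: gallery_def hs del: mprod.simps)
  moreover have "matrix_inv ((mat 1 # hs) ! k) ** hs ! k = ps ! k" if "k \<le> length Q" for k
    using that inv[of k] by (simp add: hs1 hs)
  hence "z = gallery_BE Q hs"
    using len by (auto simp: gallery_BE_def z ps_def nth_append intro!: nth_equalityI)
  ultimately show "z \<in> gallery_BE Q ` {hs. gallery Y Q hs}" by blast
next
  fix z assume "z \<in> gallery_BE Q ` {hs. gallery Y Q hs}"
  then obtain hs where "gallery Y Q hs" "z = gallery_BE Q hs" by blast
  with gallery_BE_factor[OF Q this(1)] show "z \<in> points (BE_total Y Q)"
    unfolding points_BE_total gallery_BE_def by auto
qed

lemma gallery_BE_eqI:
  assumes inv: "\<And>k. k \<le> length Q \<Longrightarrow> invertible (hs ! k) \<and> invertible (hs' ! k)"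
    and eq: "\<And>k. k < length Q \<Longrightarrow> hs ! k = hs' ! k"
    and last: "gflag (hs ! length Q) = gflag (hs' ! length Q)"
  shows "gallery_BE Q hs = gallery_BE Q hs'"
proof -
  have eq1: "(mat 1 # hs) ! k = (mat 1 # hs') ! k" if "k \<le> length Q" for k
    using that eq[of "k - 1"] by (cases k) auto
  have "invertible ((mat 1 # hs') ! length Q)" using inv[of "length Q - 1"] by (cases "length Q") auto
  hence "(matrix_inv ((mat 1 # hs') ! length Q) ** hs ! length Q) <#\<^bsub>GL\<^esub> borel_subgroup =
      (matrix_inv ((mat 1 # hs') ! length Q) ** hs' ! length Q) <#\<^bsub>GL\<^esub> borel_subgroup"
    using inv[of "length Q"] last by (simp add: coset_borel_eq_iff invertible_mult act_mult fun_eq_iff)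
  thus ?thesis using eq1 eq by (simp add: gallery_BE_def)
qed

lemma gallery_BE_eqD:
  assumes inv: "\<And>k. k \<le> length Q \<Longrightarrow> invertible (hs ! k) \<and> invertible (hs' ! k)"
    and eq: "gallery_BE Q hs = gallery_BE Q hs'" and k: "k \<le> length Q"
  shows "gflag (hs ! k) = gflag (hs' ! k)"
proof -
  have *: "(mat 1 # hs) ! i = (mat 1 # hs') ! i" if "i \<le> length Q" for i
    using mprod_gallery_BE[of Q hs i] mprod_gallery_BE[of Q hs' i] inv eq that by simp
  show ?thesis
  proof (cases "k = length Q")
    case False
    thus ?thesis using *[of "Suc k"] k by simp
  next
    case True
    have "invertible ((mat 1 # hs') ! length Q)" using inv[of "length Q - 1"] by (cases "length Q") auto
    moreover have "(matrix_inv ((mat 1 # hs') ! length Q) ** hs ! length Q) <#\<^bsub>GL\<^esub> borel_subgroup =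
      (matrix_inv ((mat 1 # hs') ! length Q) ** hs' ! length Q) <#\<^bsub>GL\<^esub> borel_subgroup"
      using eq *[of "length Q"] by (simp add: gallery_BE_def)
    ultimately show ?thesis using inv[of "length Q"] True
      by (simp add: coset_borel_eq_iff invertible_mult act_mult fun_eq_iff act_eq_iff)
  qed
qed

text \<open>
  The twist by \<open>b\<^sub>N, \<dots>, b\<^sub>1\<close> multiplies \<open>h\<^sub>k\<close> by an element of \<open>B\<close> on the right, and it does
  so independently for all \<open>k < N\<close>; the last matrix enters only through its coset.  So the
  \<open>B\<^sup>N\<close>-orbits are the choices of representatives for a fixed list of flags.
\<close>

lemma BE_class_gallery:
  assumes len: "length hs = Suc (length Q)" and inv': "\<forall>k\<le>length Q. invertible (hs ! k)"
  shows "BE_class Q (gallery_BE Q hs) = gallery_BE Q ` {hs'. length hs' = Suc (length Q) \<and>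
     (\<forall>k\<le>length Q. invertible (hs' ! k) \<and> gflag (hs' ! k) = gflag (hs ! k))}"
proof -
  let ?N = "length Q"
  have inv: "\<And>k. k \<le> ?N \<Longrightarrow> invertible (hs ! k)" using inv' by blast
  \<comment> \<open>The gallery after the twist; the last matrix is left as it is.\<close>
  define mv where "mv bs = map (\<lambda>k. hs ! k ** (bs @ [mat 1]) ! k) [0..<Suc ?N]" for bs :: "'a mat list"
  have mv: "mv bs ! k = hs ! k ** (bs @ [mat 1]) ! k" if "k \<le> ?N" for bs k
    using that unfolding mv_def by (subst nth_map) (auto simp del: upt_Suc)
  have twist: "BE_twist bs (gallery_BE Q hs) = gallery_BE Q (mv bs)"
    if bs: "length bs = ?N" "set bs \<subseteq> borel_subgroup" for bs
  proof -
    have b: "invertible (bs ! k)" if "k < ?N" for k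
    proof -
      have "bs ! k \<in> borel_subgroup" using that bs by (metis nth_mem subsetD)
      thus ?thesis by (simp add: borel_subgroup_iff)
    qed
    have inv1: "invertible ((mat 1 # hs) ! k)" "invertible ((mat 1 # bs) ! k)" if "k \<le> ?N" for k
      using that inv[of "k - 1"] b[of "k - 1"] by (cases k; simp)+
    have mv1: "(mat 1 # mv bs) ! k = (mat 1 # hs) ! k ** (mat 1 # bs) ! k" if "k \<le> ?N" for k
      using that mv[of "k - 1" bs] bs by (cases k) (auto simp: nth_append)
    have last: "last (mat 1 # bs) = (mat 1 # bs) ! ?N" using bs by (subst last_conv_nth) auto
    let ?a = "\<lambda>k. matrix_inv ((mat 1 # hs) ! k)"
    have "matrix_inv ((mat 1 # bs) ! k) ** (?a k ** hs ! k) ** bs ! k =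
        matrix_inv ((mat 1 # mv bs) ! k) ** mv bs ! k" if "k < ?N" for k
      using that bs(1) inv1[of k] mv1[of k] mv[of k bs]
      by (simp add: matrix_inv_mult matrix_mul_assoc nth_append)
    hence "fst (BE_twist bs (gallery_BE Q hs)) = fst (gallery_BE Q (mv bs))"
      by (simp add: BE_twist_def gallery_BE_def)
    moreover have "mv bs ! ?N = hs ! ?N"
      using mv[of ?N bs] bs(1) nth_append_length[of bs "mat 1" "[]"] by simp
    hence "matrix_inv ((mat 1 # bs) ! ?N) ** (?a ?N ** hs ! ?N) =
        matrix_inv ((mat 1 # mv bs) ! ?N) ** mv bs ! ?N"
      using inv1[of ?N] mv1[of ?N] by (simp add: matrix_inv_mult matrix_mul_assoc)
    hence "snd (BE_twist bs (gallery_BE Q hs)) = snd (gallery_BE Q (mv bs))"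
      unfolding BE_twist_def gallery_BE_def last snd_conv
      using inv1[of ?N] inv[of ?N] by (simp only: coset_coset invertible_matrix_inv invertible_mult order_refl)
    ultimately show ?thesis by (rule prod_eqI)
  qed
  show ?thesis
  proof (intro equalityI subsetI)
    fix z assume "z \<in> BE_class Q (gallery_BE Q hs)"
    then obtain bs where bs: "length bs = ?N" "set bs \<subseteq> borel_subgroup" "z = gallery_BE Q (mv bs)"
      using twist by (auto simp: BE_class_def)
    have "(bs @ [mat 1]) ! k \<in> borel_subgroup" if "k \<le> ?N" for k
      using that bs nth_mem[of k bs] by (auto simp: nth_append)
    hence "invertible (mv bs ! k) \<and> gflag (mv bs ! k) = gflag (hs ! k)" if "k \<le> ?N" for k
      using that inv[of k] by (auto simp: mv borel_subgroup_iff invertible_mult act_mult)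
    moreover have "length (mv bs) = Suc ?N" by (simp add: mv_def)
    ultimately show "z \<in> gallery_BE Q ` {hs'. length hs' = Suc ?N \<and>
        (\<forall>k\<le>?N. invertible (hs' ! k) \<and> gflag (hs' ! k) = gflag (hs ! k))}" using bs(3) by blast
  next
    fix z assume "z \<in> gallery_BE Q ` {hs'. length hs' = Suc ?N \<and>
        (\<forall>k\<le>?N. invertible (hs' ! k) \<and> gflag (hs' ! k) = gflag (hs ! k))}"
    then obtain hs' where hs': "length hs' = Suc ?N" "z = gallery_BE Q hs'"
      "\<And>k. k \<le> ?N \<Longrightarrow> invertible (hs' ! k) \<and> gflag (hs' ! k) = gflag (hs ! k)" by blast
    define bs where "bs = map (\<lambda>k. matrix_inv (hs ! k) ** hs' ! k) [0..<?N]"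
    have b: "bs ! k = matrix_inv (hs ! k) ** hs' ! k" if "k < ?N" for k using that by (simp add: bs_def)
    have lbs: "length bs = ?N" by (simp add: bs_def)
    have "matrix_inv (hs ! k) ** hs' ! k \<in> borel_subgroup" if "k < ?N" for k
      using that inv[of k] hs'(3)[of k]
      by (simp add: borel_subgroup_iff invertible_mult act_mult fun_eq_iff)
    hence "set bs \<subseteq> borel_subgroup" by (auto simp: bs_def)
    with lbs twist[OF lbs] have "gallery_BE Q (mv bs) \<in> BE_class Q (gallery_BE Q hs)"
      unfolding BE_class_def by (intro CollectI exI[of _ bs]) simp
    moreover have "gallery_BE Q (mv bs) = gallery_BE Q hs'"
      by (rule gallery_BE_eqI)
         (use lbs b inv hs'(3) in \<open>auto simp: mv nth_append le_less\<close>)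
    ultimately show "z \<in> BE_class Q (gallery_BE Q hs)" using hs'(2) by simp
  qed
qed

text \<open>
  A configuration determines its successive borders, since each border differs from the one before
  only by the new subspace.
\<close>

lemma gallery_config_eq_iff:
  assumes hs: "gallery Y Q hs" and hs': "gallery Y' Q hs'"
  shows "gallery_config Q hs = gallery_config Q hs' \<longleftrightarrow>
    (\<forall>k\<le>length Q. gflag (hs ! k) = gflag (hs' ! k))"
proof
  assume eq: "gallery_config Q hs = gallery_config Q hs'"
  let ?n = "CARD('a)"
  have inv: "invertible (hs ! k)" "invertible (hs' ! k)" if "k \<le> length Q" for k
    using that hs hs' by (auto simp: gallery_def)
  have eq0: "map (gflag (hs ! 0)) [1..<?n] = map (gflag (hs' ! 0)) [1..<?n]"
    and eqS: "map (\<lambda>k. gflag (hs ! Suc k) (rev Q ! k)) [0..<length Q] =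
      map (\<lambda>k. gflag (hs' ! Suc k) (rev Q ! k)) [0..<length Q]"
    using eq unfolding gallery_config_def by (subst (asm) append_eq_append_conv, simp, blast)+
  have "gflag (hs ! k) = gflag (hs' ! k)" if "k \<le> length Q" for k
    using that
  proof (induction k)
    case 0
    have "gflag (hs ! 0) i = gflag (hs' ! 0) i" for i
    proof -
      consider "i = 0" | "i \<in> {1..<?n}" | "?n \<le> i" by force
      thus ?thesis
      proof cases
        case 2
        thus ?thesis using eq0 unfolding map_eq_conv by simp
      qed (use inv[of 0] in simp_all)
    qed
    thus ?case by blast
  next
    case (Suc k)
    have "gflag (hs ! Suc k) i = gflag (hs' ! Suc k) i" for i
    proof (cases "i = rev Q ! k")
      case True
      thus ?thesis using eqS Suc.prems by simp
    next
      case False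
      thus ?thesis using Suc hs hs' fun_cong[OF Suc.IH, of i] by (simp add: gallery_def)
    qed
    thus ?case by blast
  qed
  thus "\<forall>k\<le>length Q. gflag (hs ! k) = gflag (hs' ! k)" by blast
next
  assume "\<forall>k\<le>length Q. gflag (hs ! k) = gflag (hs' ! k)"
  hence "gflag (hs ! 0) = gflag (hs' ! 0)"
    "\<And>k i. k < length Q \<Longrightarrow> gflag (hs ! Suc k) i = gflag (hs' ! Suc k) i"
    by (simp_all add: fun_eq_iff)
  thus "gallery_config Q hs = gallery_config Q hs'"
    unfolding gallery_config_def by simp
qed

text \<open>
  Both sides of the isomorphism determine the flags of the gallery and are determined by them.
\<close>

lemma BE_class_eq_iff:
  assumes hs: "gallery Y Q hs" and hs': "gallery Y' Q hs'"
  shows "BE_class Q (gallery_BE Q hs) = BE_class Q (gallery_BE Q hs') \<longleftrightarrow>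
    gallery_config Q hs = gallery_config Q hs'"
proof -
  have len: "length hs = Suc (length Q)" "length hs' = Suc (length Q)"
    and inv: "\<forall>k\<le>length Q. invertible (hs ! k)" "\<forall>k\<le>length Q. invertible (hs' ! k)"
    using hs hs' by (auto simp: gallery_def)
  note cls = BE_class_gallery[OF len(1) inv(1)] BE_class_gallery[OF len(2) inv(2)]
  show ?thesis unfolding gallery_config_eq_iff[OF hs hs']
  proof
    assume "BE_class Q (gallery_BE Q hs) = BE_class Q (gallery_BE Q hs')"
    moreover have "gallery_BE Q hs \<in> BE_class Q (gallery_BE Q hs)"
      unfolding cls using len inv by blast
    ultimately obtain hs'' where hs'': "gallery_BE Q hs = gallery_BE Q hs''"
      "\<And>k. k \<le> length Q \<Longrightarrow> invertible (hs'' ! k) \<and> gflag (hs'' ! k) = gflag (hs' ! k)"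
      unfolding cls(2) by blast
    show "\<forall>k\<le>length Q. gflag (hs ! k) = gflag (hs' ! k)"
      using gallery_BE_eqD[OF _ hs''(1)] hs''(2) inv by simp
  next
    assume "\<forall>k\<le>length Q. gflag (hs ! k) = gflag (hs' ! k)"
    thus "BE_class Q (gallery_BE Q hs) = BE_class Q (gallery_BE Q hs')"
      unfolding cls by (intro arg_cong[of _ _ "image _"]) auto
  qed
qed


section \<open>The isomorphism\<close>

text \<open>
  The two maps are defined by choosing a gallery; \<open>BE_class_eq_iff\<close> makes the result independent of
  the choice.
\<close>

definition config_to_BE ::
    "'n::{finite,linorder} mat set set \<Rightarrow> nat list \<Rightarrow> 'n subspc list \<Rightarrow> ('n mat list \<times> 'n mat set) set" where
  "config_to_BE Y Q y = BE_class Q (gallery_BE Q (SOME hs. gallery Y Q hs \<and> gallery_config Q hs = y))"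

definition BE_to_config ::
    "'n::{finite,linorder} mat set set \<Rightarrow> nat list \<Rightarrow> ('n mat list \<times> 'n mat set) set \<Rightarrow> 'n subspc list" where
  "BE_to_config Y Q Z =
     gallery_config Q (SOME hs. gallery Y Q hs \<and> BE_class Q (gallery_BE Q hs) = Z)"

lemma config_to_BE_gallery:
  assumes "gallery Y Q hs"
  shows "config_to_BE Y Q (gallery_config Q hs) = BE_class Q (gallery_BE Q hs)"
proof -
  let ?P = "\<lambda>hs'. gallery Y Q hs' \<and> gallery_config Q hs' = gallery_config Q hs"
  have "?P (SOME hs'. ?P hs')" by (rule someI[of ?P hs]) (use assms in simp)
  thus ?thesis unfolding config_to_BE_def using BE_class_eq_iff[OF _ assms] by blast
qed

lemma BE_to_config_gallery:
  assumes "gallery Y Q hs"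
  shows "BE_to_config Y Q (BE_class Q (gallery_BE Q hs)) = gallery_config Q hs"
proof -
  let ?P = "\<lambda>hs'. gallery Y Q hs' \<and> BE_class Q (gallery_BE Q hs') = BE_class Q (gallery_BE Q hs)"
  have "?P (SOME hs'. ?P hs')" by (rule someI[of ?P hs]) (use assms in simp)
  thus ?thesis unfolding BE_to_config_def using BE_class_eq_iff[OF _ assms] by blast
qed

subsection \<open>Points and coordinates\<close>

lemma length_gallery_config:
  "length (gallery_config Q (hs :: 'n::{finite,linorder} mat list)) = length (dims TYPE('n) Q)"
  by (simp add: gallery_config_def dims_def)

text \<open>
  The index of the gallery matrix whose flag contains the \<open>i\<close>-th subspace of a configuration,
  counted from \<open>0\<close>.
\<close>

definition config_step :: "'n::finite itself \<Rightarrow> nat \<Rightarrow> nat" where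
  "config_step _ i = (if i < CARD('n) - 1 then 0 else i - (CARD('n) - 1) + 1)"

lemma gallery_config_nth:
  fixes hs :: "'n::{finite,linorder} mat list"
  assumes "i < length (dims TYPE('n) Q)"
  shows "gallery_config Q hs ! i = gflag (hs ! config_step TYPE('n) i) (dims TYPE('n) Q ! i)"
    and "config_step TYPE('n) i \<le> length Q"
  using assms by (auto simp: gallery_config_def dims_def nth_append config_step_def)

lemma dims_le:
  assumes "set Q \<subseteq> {1..<CARD('n)}" "i < length (dims TYPE('n::finite) Q)"
  shows "dims TYPE('n) Q ! i \<le> CARD('n)"
proof -
  have "set (dims TYPE('n) Q) \<subseteq> {1..<CARD('n)}" using assms(1) by (auto simp: dims_def)
  thus ?thesis using nth_mem[OF assms(2)] by fastforce
qed

lemma points_configuration: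
  fixes Y :: "'n::{finite,linorder} mat set set"
  assumes Y: "Y \<subseteq> flag_variety" and Q: "set Q \<subseteq> {1..<CARD('n)}"
  shows "points (configuration_fspace Q (coset_to_flag ` Y)) = gallery_config Q ` {hs. gallery Y Q hs}"
proof -
  have "gallery_config Q hs \<in> points (list_fspace (map grassmannian_fspace (dims TYPE('n) Q)))"
    if "gallery Y Q hs" for hs
    using that
    by (auto simp: points_list length_gallery_config gallery_config_nth points_grassmannian gallery_def
        intro!: exI)
  thus ?thesis
    unfolding configuration_fspace_def points_sub configuration_space_eq[OF Y Q] by auto
qed

lemma ringed_configuration: "ringed (configuration_fspace Q \<F>)"
  by (simp add: configuration_fspace_def ringed_sub)

lemma ringed_BE_total: "ringed (BE_total Y Q)"
  by (simp add: BE_total_def ringed_pair)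

lemma ringed_BE: "ringed (BE Y Q)"
  by (simp add: BE_def ringed_quotient ringed_BE_total)

lemma points_BE:
  fixes Y :: "'n::{finite,linorder} mat set set"
  assumes Q: "set Q \<subseteq> {1..<CARD('n)}"
  shows "points (BE Y Q) = (\<lambda>hs. BE_class Q (gallery_BE Q hs)) ` {hs. gallery Y Q hs}"
  unfolding BE_def points_quotient points_BE_total_gallery[OF Q] image_image ..

subsection \<open>From the Barbasch--Evens variety to the configuration space\<close>

lemma morphism_at_BE_total_GL:
  assumes z: "z \<in> points (BE_total Y Q)" and i: "i < length Q"
  shows "morphism_at (BE_total Y Q) GL_fspace z (\<lambda>z. fst z ! i)"
proof -
  let ?L = "list_fspace (butlast (BE_factors Y Q))"
  have fst: "morphism_at (BE_total Y Q) ?L z fst"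
    unfolding BE_total_def by (rule morphism_at_fst) (use z in \<open>auto simp: BE_total_def ringed_list\<close>)
  have nth: "morphism_at ?L (butlast (BE_factors Y Q) ! i) (fst z) (\<lambda>ys. ys ! i)"
    by (rule morphism_at_nth)
       (use morphism_at_points[OF fst] i in \<open>auto simp: length_BE_factors butlast_BE_factors_nth ringed_sub\<close>)
  have "morphism_at (BE_total Y Q) (sub_fspace GL_fspace (BE_factor Y Q i)) z (\<lambda>z. fst z ! i)"
    using morphism_at_compose[OF fst nth] i by (simp add: butlast_BE_factors_nth)
  from morphism_at_compose[OF this morphism_at_sub_incl[OF ringed_GL]] morphism_at_points[OF this]
  show ?thesis by simp
qed

lemma morphism_at_BE_total_mprod:
  assumes z: "z \<in> points (BE_total Y Q)" and k: "k \<le> length Q"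
  shows "morphism_at (BE_total Y Q) GL_fspace z (\<lambda>z. mprod (fst z) k)"
  using k
proof (induction k)
  case 0
  show ?case unfolding mprod.simps by (rule morphism_at_const[OF ringed_BE_total z]) simp
next
  case (Suc k)
  thus ?case unfolding mprod.simps
    by (intro morphism_at_GL_mult[OF ringed_BE_total] morphism_at_BE_total_GL[OF z]) simp_all
qed

text \<open>
  The last coordinate is a coset \<open>p\<^sub>1B\<close>, not a matrix; the subspace \<open>p\<^sub>1E\<^sub>d\<close> depends
  regularly on it by the universal property of the quotient.
\<close>

lemma morphism_at_BE_total_last:
  fixes Y :: "'n::{finite,linorder} mat set set"
  assumes z: "z \<in> points (BE_total Y Q)"
  shows "morphism_at (BE_total Y Q) (grassmannian_fspace d) z (\<lambda>z. coset_to_subspace d (snd z))"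
proof -
  let ?S = "BE_factor Y Q (length Q)"
  let ?X = "sub_fspace GL_fspace ?S"
  let ?Q = "quotient_fspace ?X (\<lambda>p. p <#\<^bsub>GL\<^esub> borel_subgroup)"
  have snd: "morphism_at (BE_total Y Q) ?Q z snd"
    unfolding BE_total_def last_BE_factors
    by (rule morphism_at_snd)
       (use z in \<open>auto simp: BE_total_def last_BE_factors ringed_quotient ringed_sub\<close>)
  have "morphism ?X (grassmannian_fspace d) (\<lambda>p. coset_to_subspace d (p <#\<^bsub>GL\<^esub> borel_subgroup))"
  proof (rule morphism_if_morphism_at[OF ringed_sub ringed_grassmannian])
    fix p assume p: "p \<in> points ?X"
    have "morphism_at ?X GL_fspace p (\<lambda>p. p)"
      by (rule morphism_at_sub_incl[OF ringed_GL]) (use p in simp)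
    hence "morphism_at ?X (grassmannian_fspace d) p (\<lambda>p. gflag p d)" by (rule morphism_at_gflag)
    moreover have "\<forall>\<^sub>F q in nhdsin (ztop ?X) p. gflag q d = coset_to_subspace d (q <#\<^bsub>GL\<^esub> borel_subgroup)"
      using morphism_at_eventually_points[OF morphism_at_id[OF p]]
      by eventually_elim (simp add: coset_to_subspace_borel)
    ultimately show "morphism_at ?X (grassmannian_fspace d) p
        (\<lambda>p. coset_to_subspace d (p <#\<^bsub>GL\<^esub> borel_subgroup))"
      by (rule morphism_at_cong[OF ringed_sub])
  qed
  hence "morphism ?Q (grassmannian_fspace d) (coset_to_subspace d)"
    by (rule morphism_from_quotient[OF ringed_grassmannian])
  thus ?thesis
    using morphism_at_points[OF snd] by (intro morphism_at_compose[OF snd] morphism_at_if_morphism) auto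
qed

lemma gflag_gallery_BE:
  assumes hs: "gallery Y Q hs" and k: "k \<le> length Q"
  shows "gflag (hs ! k) d =
    (if k < length Q then gflag (mprod (fst (gallery_BE Q hs)) (Suc k)) d
     else act (mprod (fst (gallery_BE Q hs)) k) (coset_to_subspace d (snd (gallery_BE Q hs))))"
proof -
  have inv: "\<And>k. k \<le> length Q \<Longrightarrow> invertible (hs ! k)" using hs by (auto simp: gallery_def)
  have inv1: "invertible ((mat 1 # hs) ! length Q)" using inv[of "length Q - 1"] by (cases "length Q") auto
  show ?thesis
  proof (cases "k < length Q")
    case True
    thus ?thesis using mprod_gallery_BE[of Q hs "Suc k"] inv by (simp del: mprod.simps)
  next
    case False
    hence "k = length Q" using k by simp
    moreover have "coset_to_subspace d (snd (gallery_BE Q hs)) =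
        gflag (matrix_inv ((mat 1 # hs) ! length Q) ** hs ! length Q) d"
      using inv1 inv[of "length Q"]
      by (simp add: gallery_BE_def coset_to_subspace_borel invertible_mult)
    ultimately show ?thesis
      using mprod_gallery_BE[of Q hs "length Q"] inv inv1 by (simp add: act_mult[symmetric])
  qed
qed

text \<open>
  The coordinates of the image are \<open>g p\<^sub>N \<dots> p\<^sub>k E\<^sub>d\<close> with \<open>k \<ge> 2\<close>, regular in the matrices, and
  \<open>g p\<^sub>N \<dots> p\<^sub>2\<close> applied to \<open>p\<^sub>1E\<^sub>d\<close>, where the action on the Grassmannian is needed.
\<close>

lemma morphism_BE_to_config:
  fixes Y :: "'n::{finite,linorder} mat set set"
  assumes Y: "Y \<subseteq> flag_variety" and Q: "set Q \<subseteq> {1..<CARD('n)}"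
  shows "morphism (BE Y Q) (configuration_fspace Q (coset_to_flag ` Y)) (BE_to_config Y Q)"
  unfolding BE_def
proof (rule morphism_from_quotient[OF ringed_configuration],
    rule morphism_if_morphism_at[OF ringed_BE_total ringed_configuration])
  fix z assume z: "z \<in> points (BE_total Y Q)"
  let ?\<phi> = "\<lambda>z. BE_to_config Y Q (BE_class Q z)"
  let ?Gr = "map grassmannian_fspace (dims TYPE('n) Q) :: 'n subspc fspace list"
  have near: "\<forall>\<^sub>F z in nhdsin (ztop (BE_total Y Q)) z. z \<in> gallery_BE Q ` {hs. gallery Y Q hs}"
    using morphism_at_eventually_points[OF morphism_at_id[OF z]] by (simp add: points_BE_total_gallery[OF Q])
  have "morphism_at (BE_total Y Q) (?Gr ! i) z (\<lambda>z. ?\<phi> z ! i)" if i: "i < length ?Gr" for i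
  proof -
    let ?k = "config_step TYPE('n) i" and ?d = "dims TYPE('n) Q ! i"
    have k: "?k \<le> length Q" using i gallery_config_nth(2) by simp
    have d: "?d \<le> CARD('n)" using i dims_le[OF Q] by simp
    have "morphism_at (BE_total Y Q) (grassmannian_fspace ?d) z
        (\<lambda>z. if ?k < length Q then gflag (mprod (fst z) (Suc ?k)) ?d
             else act (mprod (fst z) ?k) (coset_to_subspace ?d (snd z)))"
    proof (cases "?k < length Q")
      case True
      thus ?thesis using morphism_at_gflag[OF morphism_at_BE_total_mprod[OF z, of "Suc ?k"]]
        by (simp del: mprod.simps)
    next
      case False
      thus ?thesis
        using morphism_at_act[OF ringed_BE_total d morphism_at_BE_total_mprod[OF z k]
            morphism_at_BE_total_last[OF z]] by simp
    qed
    moreover have "\<forall>\<^sub>F z in nhdsin (ztop (BE_total Y Q)) z.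
        (if ?k < length Q then gflag (mprod (fst z) (Suc ?k)) ?d
         else act (mprod (fst z) ?k) (coset_to_subspace ?d (snd z))) = ?\<phi> z ! i"
      using near
    proof eventually_elim
      case (elim z)
      then obtain hs where hs: "gallery Y Q hs" "z = gallery_BE Q hs" by blast
      show ?case
        using i unfolding hs(2) gflag_gallery_BE[OF hs(1) k, symmetric] BE_to_config_gallery[OF hs(1)]
        by (simp add: gallery_config_nth)
    qed
    ultimately have "morphism_at (BE_total Y Q) (grassmannian_fspace ?d) z (\<lambda>z. ?\<phi> z ! i)"
      by (rule morphism_at_cong[OF ringed_BE_total])
    thus ?thesis using i by simp
  qed
  hence "morphism_at (BE_total Y Q) (list_fspace ?Gr) z ?\<phi>"
    by (intro morphism_at_list[OF ringed_BE_total z])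
       (simp_all add: BE_to_config_def length_gallery_config ringed_grassmannian)
  moreover have "\<forall>\<^sub>F z in nhdsin (ztop (BE_total Y Q)) z.
      ?\<phi> z \<in> configuration_space Q (coset_to_flag ` Y)"
    using near by eventually_elim (auto simp: BE_to_config_gallery configuration_space_eq[OF Y Q])
  ultimately show "morphism_at (BE_total Y Q) (configuration_fspace Q (coset_to_flag ` Y)) z ?\<phi>"
    unfolding configuration_fspace_def by (rule morphism_at_sub[OF ringed_BE_total ringed_list])
qed

subsection \<open>From the configuration space to the Barbasch--Evens variety\<close>

text \<open>
  The position in a configuration of the \<open>i\<close>-dimensional member of the border after \<open>k\<close> steps.
\<close>

primrec border_pos :: "nat \<Rightarrow> nat list \<Rightarrow> nat \<Rightarrow> nat \<Rightarrow> nat" where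
  "border_pos n Q 0 i = i - 1"
| "border_pos n Q (Suc k) i = (if i = rev Q ! k then n - 1 + k else border_pos n Q k i)"

lemma border_pos:
  fixes hs :: "'n::{finite,linorder} mat list"
  assumes hs: "gallery Y Q hs" and i: "1 \<le> i" "i < CARD('n)" and k: "k \<le> length Q"
  shows "border_pos CARD('n) Q k i < length (dims TYPE('n) Q)"
    and "dims TYPE('n) Q ! border_pos CARD('n) Q k i = i"
    and "gallery_config Q hs ! border_pos CARD('n) Q k i = gflag (hs ! k) i"
proof -
  have "border_pos CARD('n) Q k i < length (dims TYPE('n) Q) \<and>
      dims TYPE('n) Q ! border_pos CARD('n) Q k i = i \<and>
      gallery_config Q hs ! border_pos CARD('n) Q k i = gflag (hs ! k) i"
    using k
  proof (induction k)
    case 0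
    thus ?case using i by (auto simp: dims_def gallery_config_def nth_append)
  next
    case (Suc k)
    show ?case
    proof (cases "i = rev Q ! k")
      case True
      thus ?thesis using i Suc.prems by (auto simp: dims_def gallery_config_def nth_append)
    next
      case False
      thus ?thesis using Suc hs by (simp add: gallery_def)
    qed
  qed
  thus "border_pos CARD('n) Q k i < length (dims TYPE('n) Q)"
    "dims TYPE('n) Q ! border_pos CARD('n) Q k i = i"
    "gallery_config Q hs ! border_pos CARD('n) Q k i = gflag (hs ! k) i" by auto
qed

lemma gflag_eqI:
  fixes g h :: "'n::{finite,linorder} mat"
  assumes "invertible g" "invertible h" "\<And>i. 1 \<le> i \<Longrightarrow> i < CARD('n) \<Longrightarrow> gflag g i = gflag h i"
  shows "gflag g = gflag h"
proof
  fix i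
  consider "i = 0" | "1 \<le> i \<and> i < CARD('n)" | "CARD('n) \<le> i" by linarith
  thus "gflag g i = gflag h i" using assms by cases simp_all
qed

text \<open>
  All borders are regular families of flags, because their members are coordinates of the
  configuration.  Near a given point they are the flags of regular matrices \<open>h\<^sub>k\<close>.  These form a
  gallery, and its image in the total space of the quotient is regular, being made of the
  quotients \<open>h\<^sub>k\<inverse> h\<^sub>k\<^sub>+\<^sub>1\<close>.
\<close>

lemma morphism_config_to_BE:
  fixes Y :: "'n::{finite,linorder} mat set set"
  assumes Y: "Y \<subseteq> flag_variety" and Q: "set Q \<subseteq> {1..<CARD('n)}"
  shows "morphism (configuration_fspace Q (coset_to_flag ` Y)) (BE Y Q) (config_to_BE Y Q)"
proof (rule morphism_if_morphism_at[OF ringed_configuration ringed_BE])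
  let ?C = "configuration_fspace Q (coset_to_flag ` Y)"
  let ?Gr = "map grassmannian_fspace (dims TYPE('n) Q) :: 'n subspc fspace list"
  let ?N = "length Q" and ?n = "CARD('n)"
  fix y assume y: "y \<in> points ?C"
  have near: "\<forall>\<^sub>F y in nhdsin (ztop ?C) y. y \<in> gallery_config Q ` {hs. gallery Y Q hs}"
    using morphism_at_eventually_points[OF morphism_at_id[OF y]] by (simp add: points_configuration[OF Y Q])
  obtain hs0 where hs0: "gallery Y Q hs0" using y by (auto simp: points_configuration[OF Y Q])
  have coord: "morphism_at ?C (?Gr ! i) y (\<lambda>y. y ! i)" if i: "i < length ?Gr" for i
  proof -
    have incl: "morphism_at ?C (list_fspace ?Gr) y (\<lambda>y. y)"
      unfolding configuration_fspace_def
      by (rule morphism_at_sub_incl[OF ringed_list]) (use y in \<open>simp add: configuration_fspace_def\<close>)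
    have "morphism_at (list_fspace ?Gr) (?Gr ! i) y (\<lambda>y. y ! i)"
      by (rule morphism_at_nth) (use morphism_at_points[OF incl] i in \<open>simp_all add: ringed_grassmannian\<close>)
    with incl show ?thesis by (rule morphism_at_compose)
  qed
  let ?W = "\<lambda>k i y. y ! border_pos ?n Q k i"
  have "\<exists>h. morphism_at ?C GL_fspace y h \<and>
      (\<forall>\<^sub>F y in nhdsin (ztop ?C) y. invertible (h y) \<and> (\<forall>i\<in>{1..<?n}. gflag (h y) i = ?W k i y))"
    if k: "k \<le> ?N" for k
  proof (rule local_flag_lift[OF ringed_configuration y])
    show "morphism_at ?C (grassmannian_fspace i) y (?W k i)" if "i \<in> {1..<?n}" for i
      using coord[of "border_pos ?n Q k i"] border_pos(1,2)[OF hs0 _ _ k, of i] that by simp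
    show "\<forall>\<^sub>F y in nhdsin (ztop ?C) y. \<exists>g. invertible g \<and> (\<forall>i\<in>{1..<?n}. ?W k i y = gflag g i)"
      using near
    proof eventually_elim
      case (elim y)
      then obtain hs where hs: "gallery Y Q hs" "y = gallery_config Q hs" by blast
      thus ?case using border_pos(3)[OF hs(1) _ _ k] k
        by (intro exI[of _ "hs ! k"]) (auto simp: gallery_def)
    qed
  qed auto
  hence "\<forall>k. \<exists>h. k \<le> ?N \<longrightarrow> morphism_at ?C GL_fspace y h \<and>
      (\<forall>\<^sub>F y in nhdsin (ztop ?C) y. invertible (h y) \<and> (\<forall>i\<in>{1..<?n}. gflag (h y) i = ?W k i y))"
    by blast
  from choice[OF this] obtain h where h: "\<And>k. k \<le> ?N \<Longrightarrow> morphism_at ?C GL_fspace y (h k)"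
    "\<And>k. k \<le> ?N \<Longrightarrow> \<forall>\<^sub>F y in nhdsin (ztop ?C) y. invertible (h k y) \<and>
        (\<forall>i\<in>{1..<?n}. gflag (h k y) i = ?W k i y)"
    by blast
  define H where "H y = map (\<lambda>k. h k y) [0..<Suc ?N]" for y
  have H: "H y ! k = h k y" if "k \<le> ?N" for k y
    using that unfolding H_def by (subst nth_map) (auto simp del: upt_Suc)
  have "\<forall>\<^sub>F y in nhdsin (ztop ?C) y. \<forall>k\<in>{..?N}. invertible (h k y) \<and>
        (\<forall>i\<in>{1..<?n}. gflag (h k y) i = ?W k i y)"
    by (intro eventually_ball_finite ballI h(2)) simp_all
  with near have nearH: "\<forall>\<^sub>F y in nhdsin (ztop ?C) y. gallery Y Q (H y) \<and> gallery_config Q (H y) = y"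
  proof eventually_elim
    case (elim y)
    then obtain hs where hs: "gallery Y Q hs" "y = gallery_config Q hs" by blast
    have inv: "invertible (hs ! k)" if "k \<le> ?N" for k using that hs by (simp add: gallery_def)
    have eq: "gflag (H y ! k) = gflag (hs ! k)" if k: "k \<le> ?N" for k
      using elim(2) border_pos(3)[OF hs(1) _ _ k] inv[OF k] k
      by (intro gflag_eqI) (auto simp: H hs(2))
    hence eqi: "gflag (H y ! k) i = gflag (hs ! k) i" if "k \<le> ?N" for k i using that by (simp add: fun_eq_iff)
    have "H y ! 0 <#\<^bsub>GL\<^esub> borel_subgroup = hs ! 0 <#\<^bsub>GL\<^esub> borel_subgroup"
      using elim(2) inv[of 0] eq[of 0] by (simp add: coset_borel_eq_iff H)
    hence gal: "gallery Y Q (H y)"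
      using hs(1) eqi elim(2) by (simp add: gallery_def H) (simp add: H_def)
    with eq hs show ?case using gallery_config_eq_iff[OF gal hs(1)] by simp
  qed
  let ?p = "\<lambda>k y. matrix_inv ((mat 1 # H y) ! k) ** H y ! k"
  have p: "morphism_at ?C (sub_fspace GL_fspace (BE_factor Y Q k)) y (?p k)" if k: "k \<le> ?N" for k
  proof (rule morphism_at_sub[OF ringed_configuration ringed_GL])
    have "morphism_at ?C GL_fspace y (\<lambda>y. (mat 1 # H y) ! k)"
      using k h(1)[of "k - 1"] morphism_at_const[OF ringed_configuration y, of "mat 1" GL_fspace]
      by (cases k) (simp_all add: H)
    thus "morphism_at ?C GL_fspace y (?p k)"
      using h(1)[OF k] k
      by (intro morphism_at_GL_mult morphism_at_GL_inv ringed_configuration) (simp_all add: H)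
    show "\<forall>\<^sub>F y in nhdsin (ztop ?C) y. ?p k y \<in> BE_factor Y Q k"
      using nearH by eventually_elim (use gallery_BE_factor(2)[OF Q _ k] in blast)
  qed
  have "morphism_at ?C (list_fspace (butlast (BE_factors Y Q))) y (\<lambda>y. map (\<lambda>i. ?p i y) [0..<?N])"
    using p by (intro morphism_at_list[OF ringed_configuration y])
      (simp_all add: length_BE_factors butlast_BE_factors_nth ringed_sub)
  moreover have "morphism_at ?C (quotient_fspace (last (BE_factors Y Q)) (\<lambda>p. p <#\<^bsub>GL\<^esub> borel_subgroup)) y
      (\<lambda>y. ?p ?N y <#\<^bsub>GL\<^esub> borel_subgroup)"
    unfolding last_BE_factors
    using morphism_at_points[OF p[OF order_refl]]
    by (intro morphism_at_compose[OF p[OF order_refl]] morphism_at_if_morphism[OF morphism_quotient_proj]) auto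
  ultimately have "morphism_at ?C (BE_total Y Q) y (\<lambda>y. gallery_BE Q (H y))"
    unfolding BE_total_def gallery_BE_def
    by (intro morphism_at_pair ringed_configuration ringed_list)
       (simp_all add: last_BE_factors ringed_quotient ringed_sub)
  hence "morphism_at ?C (BE Y Q) y (\<lambda>y. BE_class Q (gallery_BE Q (H y)))"
    by (rule morphism_at_compose)
       (use morphism_at_points[OF \<open>morphism_at ?C (BE_total Y Q) y (\<lambda>y. gallery_BE Q (H y))\<close>]
         in \<open>auto simp: BE_def intro: morphism_at_if_morphism[OF morphism_quotient_proj]\<close>)
  moreover have "\<forall>\<^sub>F y in nhdsin (ztop ?C) y. BE_class Q (gallery_BE Q (H y)) = config_to_BE Y Q y"
    using nearH by eventually_elim (use config_to_BE_gallery in metis)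
  ultimately show "morphism_at ?C (BE Y Q) y (config_to_BE Y Q)"
    by (rule morphism_at_cong[OF ringed_configuration])
qed

subsection \<open>Equivariance\<close>

lemma gallery_act:
  assumes hs: "gallery Y Q hs" and k: "invertible k"
    and Y: "\<And>c. c \<in> Y \<Longrightarrow> k <#\<^bsub>GL\<^esub> c \<in> Y"
  shows "gallery Y Q (map ((**) k) hs)"
proof -
  have "k <#\<^bsub>GL\<^esub> (hs ! 0 <#\<^bsub>GL\<^esub> borel_subgroup) \<in> Y" using hs by (intro Y) (simp add: gallery_def)
  hence "(k ** hs ! 0) <#\<^bsub>GL\<^esub> borel_subgroup \<in> Y"
    using hs k by (simp add: coset_coset gallery_def)
  thus ?thesis using hs k by (auto simp: gallery_def act_mult invertible_mult)
qed

lemma gallery_config_act: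
  "length hs = Suc (length Q) \<Longrightarrow>
     gallery_config Q (map ((**) k) hs) = map (act k) (gallery_config Q hs)"
  by (simp add: gallery_config_def act_mult)

lemma BE_act_class:
  fixes hs :: "'n::{finite,linorder} mat list"
  assumes hs: "gallery Y Q hs" and k: "invertible k"
  shows "BE_act k (BE_class Q (gallery_BE Q hs)) = BE_class Q (gallery_BE Q (map ((**) k) hs))"
proof -
  let ?N = "length Q"
  let ?a = "\<lambda>(gs, c). case gs of [] \<Rightarrow> ([], k <#\<^bsub>GL\<^esub> c) | g # ps \<Rightarrow> ((k ** g) # ps, c)"
  have len: "length hs = Suc ?N" and inv: "\<forall>l\<le>?N. invertible (hs ! l)"
    using hs by (auto simp: gallery_def)
  have act: "?a (gallery_BE Q hs') = gallery_BE Q (map ((**) k) hs')"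
    if len: "length hs' = Suc ?N" and inv: "\<forall>l\<le>?N. invertible (hs' ! l)" for hs'
  proof (cases ?N)
    case 0
    thus ?thesis using len inv k by (simp add: gallery_BE_def coset_coset)
  next
    case (Suc m)
    have "matrix_inv (k ** hs' ! l) ** (k ** hs' ! Suc l) = matrix_inv (hs' ! l) ** hs' ! Suc l"
      if "l \<le> m" for l
      using that inv k Suc by (simp add: matrix_inv_mult matrix_mul_assoc[symmetric])
    thus ?thesis using len Suc by (simp add: gallery_BE_def map_upt_Suc del: upt_Suc)
  qed
  let ?H = "\<lambda>hs. {hs'. length hs' = Suc ?N \<and>
      (\<forall>l\<le>?N. invertible (hs' ! l) \<and> gflag (hs' ! l) = gflag (hs ! l))}"
  have "BE_act k (BE_class Q (gallery_BE Q hs)) = (\<lambda>hs'. ?a (gallery_BE Q hs')) ` ?H hs"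
    unfolding BE_class_gallery[OF len inv] BE_act_def image_image ..
  also have "\<dots> = (\<lambda>hs'. gallery_BE Q (map ((**) k) hs')) ` ?H hs"
    by (intro image_cong refl act) auto
  also have "\<dots> = gallery_BE Q ` (map ((**) k) ` ?H hs)" by (simp only: image_image)
  also have "map ((**) k) ` ?H hs = ?H (map ((**) k) hs)"
  proof (intro equalityI subsetI)
    fix hs' assume "hs' \<in> map ((**) k) ` ?H hs"
    thus "hs' \<in> ?H (map ((**) k) hs)"
      using k len by (auto simp: invertible_mult act_mult fun_eq_iff)
  next
    fix hs' assume hs': "hs' \<in> ?H (map ((**) k) hs)"
    have "map ((**) (matrix_inv k)) hs' \<in> ?H hs"
      using hs' k len by (auto simp: invertible_mult act_mult fun_eq_iff)
    moreover have "hs' = map ((**) k) (map ((**) (matrix_inv k)) hs')"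
      using k by (simp add: o_def)
    ultimately show "hs' \<in> map ((**) k) ` ?H hs" by (rule rev_image_eqI)
  qed
  also have "gallery_BE Q ` ?H (map ((**) k) hs) = BE_class Q (gallery_BE Q (map ((**) k) hs))"
    by (rule BE_class_gallery[symmetric]) (use len inv k in \<open>auto simp: invertible_mult\<close>)
  finally show ?thesis .
qed

subsection \<open>Orbits of the fixed point group\<close>

text \<open>
  Each of the involutions is a homomorphism, as conjugation or as the inverse transpose followed
  by a conjugation.
\<close>

lemma fixed_subgroup_mult:
  fixes \<theta> :: "'n::finite mat \<Rightarrow> 'n mat"
  assumes inv: "(\<exists>p q. involution_GLp_GLq p q \<theta>) \<or> (\<exists>m. involution_Sp m \<theta>) \<or> involution_O \<theta>"
    and g: "g \<in> fixed_subgroup \<theta>" and h: "h \<in> fixed_subgroup \<theta>"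
  shows "g ** h \<in> fixed_subgroup \<theta>"
proof -
  have gh: "invertible g" "invertible h" "\<theta> g = g" "\<theta> h = h" using g h by (auto simp: fixed_subgroup_def)
  have conj: "S ** (A ** B) ** matrix_inv S = (S ** A ** matrix_inv S) ** (S ** B ** matrix_inv S)"
    if "invertible S" for S A B :: "'n mat"
    using that by (simp add: matrix_mul_assoc[symmetric])
  have hom: "\<theta> (g ** h) = \<theta> g ** \<theta> h"
  proof -
    consider D where "invertible D" "\<forall>g\<in>carrier GL. \<theta> g = D ** g ** matrix_inv D"
      | S where "invertible S" "\<forall>g\<in>carrier GL. \<theta> g = S ** transpose (matrix_inv g) ** matrix_inv S"
      using inv unfolding involution_GLp_GLq_def involution_Sp_def involution_O_def
      using invertible_right_inverse by blast
    thus ?thesis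
    proof cases
      case 1
      thus ?thesis using gh(1,2) conj[of D g h] by (simp add: invertible_mult)
    next
      case 2
      have "transpose (matrix_inv (g ** h)) = transpose (matrix_inv g) ** transpose (matrix_inv h)"
        using gh by (simp add: matrix_inv_mult matrix_transpose_mul)
      thus ?thesis using 2 gh(1,2) conj[of S] by (simp add: invertible_mult)
    qed
  qed
  thus ?thesis using gh by (simp add: fixed_subgroup_def invertible_mult)
qed

lemma orbit_subset_stable:
  assumes K: "K \<subseteq> carrier GL" "\<forall>g\<in>K. \<forall>h\<in>K. g ** h \<in> K"
    and x: "x \<in> flag_variety" and Y: "Y = orbit (GL\<lparr>carrier := K\<rparr>) (\<lambda>k c. k <#\<^bsub>GL\<^esub> c) x"
  shows "Y \<subseteq> flag_variety" and "k \<in> K \<Longrightarrow> c \<in> Y \<Longrightarrow> k <#\<^bsub>GL\<^esub> c \<in> Y"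
proof -
  obtain g where g: "invertible g" "x = g <#\<^bsub>GL\<^esub> borel_subgroup" using x by (auto simp: LCOSETS_def)
  have inv: "invertible k" if "k \<in> K" for k using that K(1) by auto
  have Y': "Y = {(k ** g) <#\<^bsub>GL\<^esub> borel_subgroup | k. k \<in> K}"
    using inv g by (auto simp: Y orbit_def coset_coset) (metis coset_coset)
  have "(k ** g) <#\<^bsub>GL\<^esub> borel_subgroup \<in> flag_variety" if "k \<in> K" for k
    using inv[OF that] g unfolding LCOSETS_def by (auto simp: invertible_mult intro!: bexI[of _ "k ** g"])
  thus "Y \<subseteq> flag_variety" by (auto simp: Y')
  show "k <#\<^bsub>GL\<^esub> c \<in> Y" if k: "k \<in> K" "c \<in> Y"
  proof -
    obtain l where l: "l \<in> K" "c = (l ** g) <#\<^bsub>GL\<^esub> borel_subgroup" using k by (auto simp: Y')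
    have "k <#\<^bsub>GL\<^esub> c = (k ** l ** g) <#\<^bsub>GL\<^esub> borel_subgroup"
      using inv[OF k(1)] inv[OF l(1)] g l by (simp add: coset_coset invertible_mult matrix_mul_assoc)
    thus ?thesis using K(2) k(1) l(1) by (auto simp: Y')
  qed
qed

theorem theorem5p5:
  fixes \<theta> :: "'n::{finite,linorder} mat \<Rightarrow> 'n mat"
    and K :: "'n mat set"
    and Y\<^sub>0 :: "'n mat set set"
    and Q :: "nat list"
  assumes "(\<exists>p q. involution_GLp_GLq p q \<theta>) \<or> (\<exists>m. involution_Sp m \<theta>) \<or> involution_O \<theta>"
    and "\<theta> ` borel_subgroup = borel_subgroup"
    and "\<exists>T. maximal_torus T \<and> T \<subseteq> borel_subgroup \<and> \<theta> ` T = T"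
    and "K = fixed_subgroup \<theta>"
    and "closed_orbit K Y\<^sub>0"
    and "set Q \<subseteq> {1..<CARD('n)}"
  shows "configuration_space Q (coset_to_flag ` Y\<^sub>0) = cosets_to_subspaces Q ` delta Q ` BEM Y\<^sub>0 Q \<and>
         equivariantly_isomorphic K
           (configuration_fspace Q (coset_to_flag ` Y\<^sub>0)) (\<lambda>k. map (act k))
           (BE Y\<^sub>0 Q) BE_act"
proof
  note Q = assms(6)
  have K: "K \<subseteq> carrier GL" "\<forall>g\<in>K. \<forall>h\<in>K. g ** h \<in> K"
    using assms(4) fixed_subgroup_mult[OF assms(1)] by (auto simp: fixed_subgroup_def)
  obtain x where x: "x \<in> flag_variety" "Y\<^sub>0 = orbit (GL\<lparr>carrier := K\<rparr>) (\<lambda>k c. k <#\<^bsub>GL\<^esub> c) x"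
    using assms(5) by (auto simp: closed_orbit_def)
  note Y = orbit_subset_stable(1)[OF K x] and stable = orbit_subset_stable(2)[OF K x]
  show "configuration_space Q (coset_to_flag ` Y\<^sub>0) = cosets_to_subspaces Q ` delta Q ` BEM Y\<^sub>0 Q"
    unfolding configuration_space_eq[OF Y Q] BEM_eq[OF Y Q] image_image
    by (intro image_cong refl) (simp add: delta_gallery)
  let ?C = "configuration_fspace Q (coset_to_flag ` Y\<^sub>0)"
  note points = points_configuration[OF Y Q] points_BE[OF Q]
  have len: "length hs = Suc (length Q)" if "gallery Y\<^sub>0 Q hs" for hs
    using that by (simp add: gallery_def)
  have K_act: "gallery Y\<^sub>0 Q (map ((**) k) hs)" if "k \<in> K" "gallery Y\<^sub>0 Q hs" for k hs
    using that K(1) stable by (intro gallery_act) auto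
  have config_act: "map (act k) (gallery_config Q hs) = gallery_config Q (map ((**) k) hs)"
    if "gallery Y\<^sub>0 Q hs" for k hs
    using gallery_config_act[OF len[OF that]] by simp
  have class_act: "BE_act k (BE_class Q (gallery_BE Q hs)) = BE_class Q (gallery_BE Q (map ((**) k) hs))"
    if "k \<in> K" "gallery Y\<^sub>0 Q hs" for k hs
    using that K(1) by (intro BE_act_class) auto
  have "isomorphism ?C (BE Y\<^sub>0 Q) (config_to_BE Y\<^sub>0 Q)"
    unfolding isomorphism_def
  proof (intro conjI exI[of _ "BE_to_config Y\<^sub>0 Q"])
    show "morphism ?C (BE Y\<^sub>0 Q) (config_to_BE Y\<^sub>0 Q)" by (rule morphism_config_to_BE[OF Y Q])
    show "morphism (BE Y\<^sub>0 Q) ?C (BE_to_config Y\<^sub>0 Q)" by (rule morphism_BE_to_config[OF Y Q])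
  qed (auto simp: points config_to_BE_gallery BE_to_config_gallery)
  moreover have "config_to_BE Y\<^sub>0 Q (map (act k) y) = BE_act k (config_to_BE Y\<^sub>0 Q y)"
    if "k \<in> K" "y \<in> points ?C" for k y
    using that by (auto simp: points config_act config_to_BE_gallery K_act class_act)
  ultimately show "equivariantly_isomorphic K ?C (\<lambda>k. map (act k)) (BE Y\<^sub>0 Q) BE_act"
    unfolding equivariantly_isomorphic_def
    by (intro conjI exI[of _ "config_to_BE Y\<^sub>0 Q"])
       (auto simp: points config_act class_act intro: K_act)
qed

end
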